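(* Let $H$ be an odd unicyclic graph on $[n]=\{1,\dots,n\}$, let $u,v$ be two non-adjacent vertices of the unique cycle of $H$ with $\deg_H(u)=\deg_H(v)=2$, and let $G$ be the graph obtained from $H$ by adding the chord $e=\{u,v\}$. Assume that $G$ is connected and that $\operatorname{char}(\mathbb{K})\neq 2$. Then the following are equivalent: (i) $L_G$ is an almost complete intersection; (ii) $\mathcal{I}_G$ is an almost complete intersection; (iii) $H$ is an odd cycle.
   Context: All graphs are finite and simple. Let $\mathbb{K}$ be a field and $S=\mathbb{K}[x_1,\dots,x_n,y_1,\dots,y_n]$. For a graph $G$ on $[n]$, the Lovász-Saks-Schrijver (LSS) ideal is $L_G=(x_ix_j+y_iy_j : \{i,j\}\in E(G))\subset S$ and the parity binomial edge ideal is $\mathcal{I}_G=(x_ix_j-y_iy_j : \{i,j\}\in E(G))\subset S$. For a homogeneous ideal $I$, $\mu(I)$ is the cardinality of a minimal homogeneous generating set; $I$ is a complete intersection if $\mu(I)=\operatorname{ht}(I)$, and an almost complete intersection if $\mu(I)=\operatorname{ht}(I)+1$ and $I_{\mathfrak p}$ is a complete intersection (i.e. $\mu(I_{\mathfrak p})=\operatorname{ht}(I_{\mathfrak p})$) for every minimal prime $\mathfrak p$ of $I$. A unicyclic graph is a graph containing exactly one cycle; it is odd unicyclic if that cycle has odd length. *)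

theory Defs
  imports
    "HOL-Algebra.Ideal"
    "HOL-Library.Poly_Mapping"
    "HOL-Library.Extended_Nat"
begin

section \<open>Heights, minimal primes and localization in a commutative ring\<close>

definition prime_height :: "('a, 'b) ring_scheme \<Rightarrow> 'a set \<Rightarrow> enat" where
  "prime_height R P = Sup {enat k | k. \<exists>Q :: nat \<Rightarrow> 'a set.
     (\<forall>i\<le>k. primeideal (Q i) R) \<and> (\<forall>i<k. Q i \<subset> Q (Suc i)) \<and> Q k = P}"

definition ideal_height :: "('a, 'b) ring_scheme \<Rightarrow> 'a set \<Rightarrow> enat" where
  "ideal_height R I = (INF P \<in> {P. primeideal P R \<and> I \<subseteq> P}. prime_height R P)"

definition minimal_prime_over :: "('a, 'b) ring_scheme \<Rightarrow> 'a set \<Rightarrow> 'a set \<Rightarrow> bool" where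
  "minimal_prime_over R I P \<longleftrightarrow> primeideal P R \<and> I \<subseteq> P \<and>
     (\<forall>Q. primeideal Q R \<and> I \<subseteq> Q \<and> Q \<subseteq> P \<longrightarrow> Q = P)"

text \<open>The localization \<open>M\<^sup>-\<^sup>1 R\<close> at a multiplicative set \<open>M\<close>, with classes of
  pairs \<open>(a, s)\<close> playing the role of the fractions \<open>a / s\<close>.\<close>

definition loc_rel :: "('a, 'b) ring_scheme \<Rightarrow> 'a set \<Rightarrow> (('a \<times> 'a) \<times> ('a \<times> 'a)) set" where
  "loc_rel R M = {((a, s), (b, t)). a \<in> carrier R \<and> s \<in> M \<and> b \<in> carrier R \<and> t \<in> M \<and>
     (\<exists>w\<in>M. w \<otimes>\<^bsub>R\<^esub> ((a \<otimes>\<^bsub>R\<^esub> t) \<ominus>\<^bsub>R\<^esub> (b \<otimes>\<^bsub>R\<^esub> s)) = \<zero>\<^bsub>R\<^esub>)}"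

definition fraction :: "('a, 'b) ring_scheme \<Rightarrow> 'a set \<Rightarrow> 'a \<Rightarrow> 'a \<Rightarrow> ('a \<times> 'a) set" where
  "fraction R M a s = loc_rel R M `` {(a, s)}"

definition localization :: "('a, 'b) ring_scheme \<Rightarrow> 'a set \<Rightarrow> ('a \<times> 'a) set ring" where
  "localization R M =
    \<lparr>carrier = (carrier R \<times> M) // loc_rel R M,
     mult = (\<lambda>X Y. \<Union>(a, s)\<in>X. \<Union>(b, t)\<in>Y. fraction R M (a \<otimes>\<^bsub>R\<^esub> b) (s \<otimes>\<^bsub>R\<^esub> t)),
     one = fraction R M \<one>\<^bsub>R\<^esub> \<one>\<^bsub>R\<^esub>,
     zero = fraction R M \<zero>\<^bsub>R\<^esub> \<one>\<^bsub>R\<^esub>,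
     add = (\<lambda>X Y. \<Union>(a, s)\<in>X. \<Union>(b, t)\<in>Y.
              fraction R M ((a \<otimes>\<^bsub>R\<^esub> t) \<oplus>\<^bsub>R\<^esub> (b \<otimes>\<^bsub>R\<^esub> s)) (s \<otimes>\<^bsub>R\<^esub> t))\<rparr>"

definition local_ring_at :: "('a, 'b) ring_scheme \<Rightarrow> 'a set \<Rightarrow> ('a \<times> 'a) set ring" where
  "local_ring_at R P = localization R (carrier R - P)"

text \<open>By common denominators, these fractions already form the whole ideal that \<open>I\<close>
  generates in \<open>R\<^sub>P\<close>.\<close>

definition local_ideal_at :: "('a, 'b) ring_scheme \<Rightarrow> 'a set \<Rightarrow> 'a set \<Rightarrow> ('a \<times> 'a) set set" where
  "local_ideal_at R P I = {fraction R (carrier R - P) a s | a s. a \<in> I \<and> s \<in> carrier R - P}"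

definition min_gens :: "('a, 'b) ring_scheme \<Rightarrow> 'a set \<Rightarrow> nat" where
  "min_gens R I = (LEAST k. \<exists>A. A \<subseteq> carrier R \<and> finite A \<and> card A = k \<and> genideal R A = I)"


section \<open>The polynomial ring and homogeneous ideals\<close>

datatype xy_var = X nat | Y nat

type_synonym 'k xy_poly = "(xy_var \<Rightarrow>\<^sub>0 nat) \<Rightarrow>\<^sub>0 'k"

definition xy_vars :: "nat \<Rightarrow> xy_var set" where
  "xy_vars n = X ` {1..n} \<union> Y ` {1..n}"

text \<open>\<open>xy_ring n\<close> is \<open>K[x\<^sub>1, \<dots>, x\<^sub>n, y\<^sub>1, \<dots>, y\<^sub>n]\<close>: the finitely supported
  functions from exponent vectors to \<open>K\<close> in which only these variables occur, with the
  convolution product of \<open>poly_mapping\<close>.\<close>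

definition xy_ring :: "nat \<Rightarrow> 'k::field xy_poly ring" where
  "xy_ring n =
    \<lparr>carrier = {f. \<forall>m \<in> Poly_Mapping.keys f. Poly_Mapping.keys m \<subseteq> xy_vars n},
     mult = (*), one = 1, zero = 0, add = (+)\<rparr>"

definition x_var :: "nat \<Rightarrow> 'k::field xy_poly" where
  "x_var i = Poly_Mapping.single (Poly_Mapping.single (X i) 1) 1"

definition y_var :: "nat \<Rightarrow> 'k::field xy_poly" where
  "y_var i = Poly_Mapping.single (Poly_Mapping.single (Y i) 1) 1"

definition homogeneous_poly :: "'k::field xy_poly \<Rightarrow> bool" where
  "homogeneous_poly f \<longleftrightarrow>
     (\<exists>d. \<forall>m \<in> Poly_Mapping.keys f. (\<Sum>v \<in> Poly_Mapping.keys m. Poly_Mapping.lookup m v) = d)"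

definition homogeneous_generating_set :: "nat \<Rightarrow> 'k::field xy_poly set \<Rightarrow> 'k xy_poly set \<Rightarrow> bool" where
  "homogeneous_generating_set n I A \<longleftrightarrow>
     A \<subseteq> carrier (xy_ring n) \<and> (\<forall>f\<in>A. homogeneous_poly f) \<and> genideal (xy_ring n) A = I"

definition homogeneous_ideal :: "nat \<Rightarrow> 'k::field xy_poly set \<Rightarrow> bool" where
  "homogeneous_ideal n I \<longleftrightarrow> (\<exists>A. homogeneous_generating_set n I A)"

definition minimal_homogeneous_generating_set ::
    "nat \<Rightarrow> 'k::field xy_poly set \<Rightarrow> 'k xy_poly set \<Rightarrow> bool" where
  "minimal_homogeneous_generating_set n I A \<longleftrightarrow>
     finite A \<and> homogeneous_generating_set n I A \<and>
     (\<forall>B. B \<subset> A \<longrightarrow> \<not> homogeneous_generating_set n I B)"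

text \<open>All minimal homogeneous generating sets of a homogeneous ideal are finite and have the
  same cardinality, so \<open>LEAST\<close> only picks out this common value.\<close>

definition mu :: "nat \<Rightarrow> 'k::field xy_poly set \<Rightarrow> nat" where
  "mu n I = (LEAST k. \<exists>A. minimal_homogeneous_generating_set n I A \<and> card A = k)"

definition almost_complete_intersection :: "nat \<Rightarrow> 'k::field xy_poly set \<Rightarrow> bool" where
  "almost_complete_intersection n I \<longleftrightarrow>
     homogeneous_ideal n I \<and>
     enat (mu n I) = ideal_height (xy_ring n) I + 1 \<and>
     (\<forall>P. minimal_prime_over (xy_ring n) I P \<longrightarrow>
        enat (min_gens (local_ring_at (xy_ring n) P) (local_ideal_at (xy_ring n) P I)) =
        ideal_height (local_ring_at (xy_ring n) P) (local_ideal_at (xy_ring n) P I))"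


section \<open>Finite simple graphs\<close>

text \<open>A graph is a vertex set together with a set of two-element subsets of it.\<close>

definition simple_graph :: "'v set \<Rightarrow> 'v set set \<Rightarrow> bool" where
  "simple_graph V E \<longleftrightarrow> finite V \<and> (\<forall>e\<in>E. e \<subseteq> V \<and> card e = 2)"

definition graph_degree :: "'v set set \<Rightarrow> 'v \<Rightarrow> nat" where
  "graph_degree E v = card {e \<in> E. v \<in> e}"

definition graph_connected :: "'v set \<Rightarrow> 'v set set \<Rightarrow> bool" where
  "graph_connected V E \<longleftrightarrow> V \<noteq> {} \<and> (\<forall>a\<in>V. \<forall>b\<in>V. (a, b) \<in> {(x, y). {x, y} \<in> E}\<^sup>*)"

text \<open>A cycle is identified with its edge set, so that closed walks differing only in their
  starting point or direction give the same cycle.\<close>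

definition cycle_edges :: "'v set set \<Rightarrow> bool" where
  "cycle_edges C \<longleftrightarrow> (\<exists>vs. distinct vs \<and> 3 \<le> length vs \<and>
     C = {{vs ! i, vs ! (Suc i mod length vs)} | i. i < length vs})"

definition odd_unicyclic :: "'v set set \<Rightarrow> bool" where
  "odd_unicyclic E \<longleftrightarrow> (\<exists>!C. cycle_edges C \<and> C \<subseteq> E) \<and>
     (\<forall>C. cycle_edges C \<and> C \<subseteq> E \<longrightarrow> odd (card C))"

definition odd_cycle_graph :: "'v set \<Rightarrow> 'v set set \<Rightarrow> bool" where
  "odd_cycle_graph V E \<longleftrightarrow> cycle_edges E \<and> \<Union>E = V \<and> odd (card V)"


section \<open>The ideals of a graph on \<open>{1..n}\<close>\<close>

definition lss_ideal :: "nat \<Rightarrow> nat set set \<Rightarrow> 'k::field xy_poly set" where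
  "lss_ideal n E = genideal (xy_ring n)
     {x_var i * x_var j + y_var i * y_var j | i j. {i, j} \<in> E}"

definition parity_binomial_edge_ideal :: "nat \<Rightarrow> nat set set \<Rightarrow> 'k::field xy_poly set" where
  "parity_binomial_edge_ideal n E = genideal (xy_ring n)
     {x_var i * x_var j - y_var i * y_var j | i j. {i, j} \<in> E}"

end

theory Submission
  imports Defs "HOL-Computational_Algebra.Polynomial"
begin

text \<open>Both ideals are the case \<open>\<epsilon> = 1\<close> or \<open>\<epsilon> = -1\<close> of the ideal generated by
  \<open>x\<^sub>i x\<^sub>j + \<epsilon> y\<^sub>i y\<^sub>j\<close>, which expresses orthogonality of the vectors \<open>(x\<^sub>i, y\<^sub>i)\<close> along
  the edges. Its minimal number of generators is the number of edges of \<open>G\<close>.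

  If \<open>H\<close> is not a cycle, some vertex \<open>w\<close> of the cycle has degree at least 3. Setting the vectors
  at \<open>w\<close>, or at \<open>w\<close> and a chord end not adjacent to \<open>w\<close>, to zero leaves a bipartite graph with more
  components than deleted vertices, which gives a prime of height at most \<open>n - 1\<close> over the ideal,
  while \<open>G\<close> has at least \<open>n + 1\<close> edges.

  If \<open>H\<close> is an odd cycle, all primes over its edge ideal \<open>J\<close> have height at least \<open>n\<close>. At a minimal
  prime \<open>P\<close> over the ideal of \<open>G\<close>, either the generator of the chord lies in the localization of
  \<open>J\<close>, so that \<open>n\<close> generators suffice, or a one-parameter deformation of the generic point of \<open>P\<close>
  exhibits a strictly smaller prime over \<open>J\<close>, so that \<open>P\<close> has height at least \<open>n + 1\<close>. Krull's
  height theorem turns this into equality of height and number of local generators.\<close>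

section \<open>Ideals of subrings of a domain\<close>

text \<open>The number of generators is always at least \<open>n + 1\<close>, so the height decides
  the global part; heights are computed as codimensions, \<open>2 * n\<close> minus the size of a
  maximal set of variables independent modulo the prime. The real obstacle is the local condition at
  every minimal prime, and the minimal primes are not classified. Instead, one follows the vectors
  around the cycle: along nonzero vectors orthogonality and parallelism alternate, so an odd walk
  through nonzero vectors already makes its ends orthogonal, and the chord is then redundant
  locally. Only zero vectors can prevent this, and a zero vector is also what cuts the cycle open so
  that an arc can be moved without disturbing the cycle edges. Characteristic 2 has to be excluded
  where both chord ends lie on the moved arc: the derivative of the chord is then twice a product of
  coordinates. Krull's theorem is proved by a growth comparison in the style of Hilbert and Samuel,
  monomials of bounded exponents against the dimension modulo powers of the ideal.\<close>

definition subdom :: "'a::idom set \<Rightarrow> bool" where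
  "subdom S \<longleftrightarrow> 0 \<in> S \<and> 1 \<in> S \<and> (\<forall>a\<in>S. \<forall>b\<in>S. a + b \<in> S \<and> a * b \<in> S) \<and> (\<forall>a\<in>S. - a \<in> S)"

definition ideal_in :: "'a::idom set \<Rightarrow> 'a set \<Rightarrow> bool" where
  "ideal_in S I \<longleftrightarrow> I \<subseteq> S \<and> 0 \<in> I \<and> (\<forall>a\<in>I. \<forall>b\<in>I. a + b \<in> I) \<and> (\<forall>r\<in>S. \<forall>a\<in>I. r * a \<in> I)"

definition prime_in :: "'a::idom set \<Rightarrow> 'a set \<Rightarrow> bool" where
  "prime_in S P \<longleftrightarrow> ideal_in S P \<and> 1 \<notin> P \<and> (\<forall>a\<in>S. \<forall>b\<in>S. a * b \<in> P \<longrightarrow> a \<in> P \<or> b \<in> P)"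

text \<open>Rings are handled as subsets of an integral domain type, so that type-class arithmetic
  applies to their elements; this record is the bridge to \<open>primeideal\<close>,
  \<open>genideal\<close> and the heights.\<close>

definition ring_of :: "'a::idom set \<Rightarrow> 'a ring" where
  "ring_of S = \<lparr>carrier = S, monoid.mult = (*), one = 1, zero = 0, add = (+)\<rparr>"

lemma ring_of_simps [simp]:
  "carrier (ring_of S) = S" "monoid.mult (ring_of S) = (*)" "one (ring_of S) = 1"
  "zero (ring_of S) = 0" "add (ring_of S) = (+)"
  by (simp_all add: ring_of_def)

lemma subdomD:
  assumes "subdom S"
  shows "0 \<in> S" "1 \<in> S" "\<And>a b. a \<in> S \<Longrightarrow> b \<in> S \<Longrightarrow> a + b \<in> S"
    "\<And>a b. a \<in> S \<Longrightarrow> b \<in> S \<Longrightarrow> a * b \<in> S" "\<And>a. a \<in> S \<Longrightarrow> - a \<in> S"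
    "\<And>a b. a \<in> S \<Longrightarrow> b \<in> S \<Longrightarrow> a - b \<in> S"
proof -
  show *: "0 \<in> S" "1 \<in> S" "\<And>a b. a \<in> S \<Longrightarrow> b \<in> S \<Longrightarrow> a + b \<in> S"
    "\<And>a b. a \<in> S \<Longrightarrow> b \<in> S \<Longrightarrow> a * b \<in> S" "\<And>a. a \<in> S \<Longrightarrow> - a \<in> S"
    using assms by (auto simp: subdom_def)
  show "a - b \<in> S" if "a \<in> S" "b \<in> S" for a b
    using *(3)[OF that(1) *(5)[OF that(2)]] by simp
qed

lemma subdom_power: "subdom S \<Longrightarrow> a \<in> S \<Longrightarrow> a ^ k \<in> S"
  by (induction k) (auto simp: subdomD)

lemma subdom_sum: "subdom S \<Longrightarrow> (\<And>i. i \<in> A \<Longrightarrow> f i \<in> S) \<Longrightarrow> sum f A \<in> S"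
  by (induction A rule: infinite_finite_induct) (auto simp: subdomD)

lemma subdom_prod: "subdom S \<Longrightarrow> (\<And>i. i \<in> A \<Longrightarrow> f i \<in> S) \<Longrightarrow> prod f A \<in> S"
  by (induction A rule: infinite_finite_induct) (auto simp: subdomD)

lemma ideal_inD:
  assumes "ideal_in S I"
  shows "\<And>a. a \<in> I \<Longrightarrow> a \<in> S" "0 \<in> I" "\<And>a b. a \<in> I \<Longrightarrow> b \<in> I \<Longrightarrow> a + b \<in> I"
    "\<And>r a. r \<in> S \<Longrightarrow> a \<in> I \<Longrightarrow> r * a \<in> I" "\<And>r a. r \<in> S \<Longrightarrow> a \<in> I \<Longrightarrow> a * r \<in> I"
  using assms by (auto simp: ideal_in_def mult.commute)

lemma ideal_in_uminus: "subdom S \<Longrightarrow> ideal_in S I \<Longrightarrow> a \<in> I \<Longrightarrow> - a \<in> I"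
  using ideal_inD(4)[of S I "-1" a] subdomD(2,5)[of S] by auto

lemma ideal_in_diff: "subdom S \<Longrightarrow> ideal_in S I \<Longrightarrow> a \<in> I \<Longrightarrow> b \<in> I \<Longrightarrow> a - b \<in> I"
  using ideal_inD(3)[of S I a "- b"] ideal_in_uminus[of S I b] by auto

lemma ideal_in_sum: "ideal_in S I \<Longrightarrow> (\<And>i. i \<in> A \<Longrightarrow> f i \<in> I) \<Longrightarrow> sum f A \<in> I"
  by (induction A rule: infinite_finite_induct) (auto simp: ideal_inD)

lemma ideal_in_add_cancel:
  "subdom S \<Longrightarrow> ideal_in S I \<Longrightarrow> a + b \<in> I \<Longrightarrow> b \<in> I \<Longrightarrow> a \<in> I"
  using ideal_in_diff[of S I "a + b" b] by simp

lemma prime_inD: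
  assumes "prime_in S P"
  shows "ideal_in S P" "1 \<notin> P" "\<And>a b. a \<in> S \<Longrightarrow> b \<in> S \<Longrightarrow> a * b \<in> P \<Longrightarrow> a \<in> P \<or> b \<in> P"
  using assms by (auto simp: prime_in_def)

lemma prime_in_power: "subdom S \<Longrightarrow> prime_in S P \<Longrightarrow> a \<in> S \<Longrightarrow> a ^ k \<in> P \<Longrightarrow> a \<in> P"
proof (induction k)
  case (Suc k)
  then show ?case using prime_inD(3)[of S P a "a ^ k"] subdom_power[of S a k] by auto
qed (auto dest: prime_inD(2))

lemma cring_ring_of:
  assumes "subdom S" shows "cring (ring_of S)"
proof (rule cringI)
  show "abelian_group (ring_of S)"
    by (rule abelian_groupI)
      (use subdomD[OF assms] in \<open>auto simp: algebra_simps intro!: bexI[where x = "- x" for x]\<close>)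
  show "comm_monoid (ring_of S)"
    by (rule comm_monoidI) (use subdomD[OF assms] in \<open>auto simp: algebra_simps\<close>)
qed (use subdomD[OF assms] in \<open>auto simp: algebra_simps\<close>)

lemma ring_of_a_inv:
  assumes "subdom S" "a \<in> S" shows "a_inv (ring_of S) a = - a"
proof -
  interpret cring "ring_of S" by (rule cring_ring_of[OF assms(1)])
  have "-a \<oplus>\<^bsub>ring_of S\<^esub> a = \<zero>\<^bsub>ring_of S\<^esub>" by simp
  then show ?thesis using assms subdomD(5)[OF assms] by (intro minus_equality) auto
qed

lemma ideal_ring_of:
  assumes "subdom S" shows "ideal I (ring_of S) \<longleftrightarrow> ideal_in S I"
proof
  interpret R: cring "ring_of S" by (rule cring_ring_of[OF assms])
  { assume "ideal I (ring_of S)"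
    then interpret ideal I "ring_of S" .
    show "ideal_in S I"
      using a_subset zero_closed a_closed I_l_closed by (auto simp: ideal_in_def) }
  assume I: "ideal_in S I"
  show "ideal I (ring_of S)"
  proof (rule idealI)
    show "subgroup I (add_monoid (ring_of S))"
    proof (rule group.subgroupI)
      show "inv\<^bsub>add_monoid (ring_of S)\<^esub> a \<in> I" if "a \<in> I" for a
      proof -
        have "a \<in> S" using that ideal_inD(1)[OF I] by auto
        moreover have "inv\<^bsub>add_monoid (ring_of S)\<^esub> a = - a"
          using ring_of_a_inv[OF assms \<open>a \<in> S\<close>] by (simp add: a_inv_def)
        ultimately show ?thesis using ideal_in_uminus[OF assms I that] by simp
      qed
      show "group (add_monoid (ring_of S))" by (rule R.a_group)
    qed (use I in \<open>auto simp: ideal_in_def\<close>)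
  qed (use R.ring_axioms ideal_inD(4,5)[OF I] in auto)
qed

lemma primeideal_ring_of:
  assumes "subdom S" shows "primeideal P (ring_of S) \<longleftrightarrow> prime_in S P"
proof
  assume P: "primeideal P (ring_of S)"
  then interpret primeideal P "ring_of S" .
  have "ideal_in S P" using ideal_ring_of[OF assms] is_ideal by blast
  moreover have "1 \<notin> P" using I_notcarr one_imp_carrier by auto
  ultimately show "prime_in S P" using I_prime by (auto simp: prime_in_def)
next
  assume P: "prime_in S P"
  show "primeideal P (ring_of S)"
  proof (rule primeidealI)
    show "ideal P (ring_of S)" using ideal_ring_of[OF assms] prime_inD(1)[OF P] by blast
    show "carrier (ring_of S) \<noteq> P" using subdomD(2)[OF assms] prime_inD(2)[OF P] by auto
  qed (use P cring_ring_of[OF assms] in \<open>auto simp: prime_in_def\<close>)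
qed

section \<open>Generated ideals and primes avoiding a multiplicative set\<close>

definition gen_in :: "'a::idom set \<Rightarrow> 'a set \<Rightarrow> 'a set" where
  "gen_in S A = genideal (ring_of S) A"

lemma
  assumes "subdom S" "A \<subseteq> S"
  shows gen_in_ideal: "ideal_in S (gen_in S A)"
    and gen_in_incl: "A \<subseteq> gen_in S A"
    and gen_in_least: "\<And>I. ideal_in S I \<Longrightarrow> A \<subseteq> I \<Longrightarrow> gen_in S A \<subseteq> I"
proof -
  interpret cring "ring_of S" by (rule cring_ring_of[OF assms(1)])
  show "ideal_in S (gen_in S A)"
    using genideal_ideal[of A] assms ideal_ring_of[OF assms(1)] by (simp add: gen_in_def)
  show "A \<subseteq> gen_in S A" using genideal_self[of A] assms by (simp add: gen_in_def)
  show "gen_in S A \<subseteq> I" if "ideal_in S I" "A \<subseteq> I" for I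
    using genideal_minimal[of I A] that ideal_ring_of[OF assms(1)] by (simp add: gen_in_def)
qed

lemma gen_in_finite:
  assumes S: "subdom S" and "finite A" "A \<subseteq> S" "f \<in> gen_in S A"
  shows "\<exists>r. (\<forall>a\<in>A. r a \<in> S) \<and> f = (\<Sum>a\<in>A. r a * a)"
proof -
  let ?I = "{f. \<exists>r. (\<forall>a\<in>A. r a \<in> S) \<and> f = (\<Sum>a\<in>A. r a * a)}"
  have "ideal_in S ?I"
    unfolding ideal_in_def
  proof (intro conjI ballI)
    show "?I \<subseteq> S" using assms(3) by (auto intro!: subdom_sum[OF S] subdomD(4)[OF S])
    show "0 \<in> ?I" using subdomD(1)[OF S] by (auto intro!: exI[of _ "\<lambda>_. 0"])
    fix a b assume "a \<in> ?I" "b \<in> ?I"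
    then obtain r s where "\<forall>a\<in>A. r a \<in> S" "a = (\<Sum>a\<in>A. r a * a)"
      "\<forall>a\<in>A. s a \<in> S" "b = (\<Sum>a\<in>A. s a * a)" by blast
    then show "a + b \<in> ?I"
      by (auto simp: sum.distrib distrib_right subdomD(3)[OF S] intro!: exI[of _ "\<lambda>a. r a + s a"])
  next
    fix t a assume "t \<in> S" "a \<in> ?I"
    then obtain r where "\<forall>a\<in>A. r a \<in> S" "a = (\<Sum>a\<in>A. r a * a)" by blast
    with \<open>t \<in> S\<close> show "t * a \<in> ?I"
      by (auto simp: sum_distrib_left mult.assoc subdomD(4)[OF S] intro!: exI[of _ "\<lambda>a. t * r a"])
  qed
  moreover have "A \<subseteq> ?I"
  proof
    fix a assume "a \<in> A"
    then have "a = (\<Sum>b\<in>A. (if b = a then 1 else 0) * b)"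
      using \<open>finite A\<close> by (subst sum.remove[of _ a]) auto
    then show "a \<in> ?I" using subdomD(1,2)[OF S] by (auto intro!: exI[of _ "\<lambda>b. if b = a then 1 else 0"])
  qed
  ultimately have "gen_in S A \<subseteq> ?I" by (rule gen_in_least[OF assms(1,3)])
  then show ?thesis using assms(4) by blast
qed

text \<open>An ideal \<open>Q\<close> maximal among those that contain \<open>J\<close> and miss
  \<open>M\<close> is prime: if neither \<open>a\<close> nor \<open>b\<close> is in
  \<open>Q\<close>, both enlargements of \<open>Q\<close> meet \<open>M\<close>, and the product of
  the two elements found there would lie in \<open>Q\<close> as soon as \<open>a * b\<close>
  does.\<close>

lemma prime_ideal_avoiding:
  assumes S: "subdom S" and J: "ideal_in S J" and M: "M \<subseteq> S" "1 \<in> M" "\<And>a b. a \<in> M \<Longrightarrow> b \<in> M \<Longrightarrow> a * b \<in> M"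
    and disj: "J \<inter> M = {}"
  shows "\<exists>Q. prime_in S Q \<and> J \<subseteq> Q \<and> Q \<inter> M = {}"
proof -
  let ?F = "{I. ideal_in S I \<and> J \<subseteq> I \<and> I \<inter> M = {}}"
  have "\<exists>Q\<in>?F. \<forall>X\<in>?F. Q \<subseteq> X \<longrightarrow> X = Q"
  proof (rule subset_Zorn_nonempty)
    show "?F \<noteq> {}" using J disj by blast
    fix \<C> assume C: "\<C> \<noteq> {}" "subset.chain ?F \<C>"
    have sub: "\<C> \<subseteq> ?F" and tot: "\<And>A B. A \<in> \<C> \<Longrightarrow> B \<in> \<C> \<Longrightarrow> A \<subseteq> B \<or> B \<subseteq> A"
      using C(2) by (auto simp: subset_chain_def)
    have "ideal_in S (\<Union>\<C>)"
      unfolding ideal_in_def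
    proof (intro conjI ballI)
      show "\<Union>\<C> \<subseteq> S" using sub by (auto simp: ideal_in_def)
      show "0 \<in> \<Union>\<C>" using sub C(1) by (force simp: ideal_in_def)
      show "a + b \<in> \<Union>\<C>" if "a \<in> \<Union>\<C>" "b \<in> \<Union>\<C>" for a b
      proof -
        obtain A B where AB: "A \<in> \<C>" "a \<in> A" "B \<in> \<C>" "b \<in> B" using \<open>a \<in> \<Union>\<C>\<close> \<open>b \<in> \<Union>\<C>\<close> by auto
        obtain D where "D \<in> \<C>" "a \<in> D" "b \<in> D" using tot[OF AB(1,3)] AB by blast
        then show ?thesis using sub ideal_inD(3)[of S D a b] by blast
      qed
      show "r * a \<in> \<Union>\<C>" if "r \<in> S" "a \<in> \<Union>\<C>" for r a
        using that sub ideal_inD(4)[of S _ r a] by blast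
    qed
    then show "\<Union>\<C> \<in> ?F" using sub C(1) by blast
  qed
  then obtain Q where QF: "Q \<in> ?F" and Qmax: "\<forall>I\<in>?F. Q \<subseteq> I \<longrightarrow> I = Q" by (rule bexE)
  have Q: "ideal_in S Q" "J \<subseteq> Q" "Q \<inter> M = {}" using QF by simp_all
  have max: "I = Q" if "ideal_in S I" "J \<subseteq> I" "I \<inter> M = {}" "Q \<subseteq> I" for I
    using Qmax that by simp
  have ext: "\<exists>m\<in>M. \<exists>r\<in>S. \<exists>q\<in>Q. m = r * a + q" if a: "a \<in> S" "a \<notin> Q" for a
  proof (rule ccontr)
    assume neg: "\<not> ?thesis"
    let ?X = "{r * a + q | r q. r \<in> S \<and> q \<in> Q}"
    have "ideal_in S ?X"
      unfolding ideal_in_def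
    proof (intro conjI ballI)
      show "?X \<subseteq> S" using a ideal_inD(1)[OF Q(1)] by (auto intro!: subdomD(3,4)[OF S])
      show "0 \<in> ?X" using subdomD(1)[OF S] ideal_inD(2)[OF Q(1)] by force
      fix x y assume "x \<in> ?X" "y \<in> ?X"
      then obtain r q r' q' where "x = r * a + q" "y = r' * a + q'" "r \<in> S" "r' \<in> S" "q \<in> Q" "q' \<in> Q"
        by blast
      then have "x + y = (r + r') * a + (q + q')" "r + r' \<in> S" "q + q' \<in> Q"
        by (simp_all add: distrib_right subdomD(3)[OF S] ideal_inD(3)[OF Q(1)])
      then show "x + y \<in> ?X" by blast
    next
      fix t x assume "t \<in> S" "x \<in> ?X"
      then obtain r q where "x = r * a + q" "r \<in> S" "q \<in> Q" by blast
      with \<open>t \<in> S\<close> have "t * x = (t * r) * a + t * q" "t * r \<in> S" "t * q \<in> Q"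
        by (simp_all add: distrib_left mult.assoc subdomD(4)[OF S] ideal_inD(4)[OF Q(1)])
      then show "t * x \<in> ?X" by blast
    qed
    moreover have "Q \<subseteq> ?X"
    proof
      fix q assume "q \<in> Q"
      then show "q \<in> ?X" using subdomD(1)[OF S] by (intro CollectI exI[of _ 0] exI[of _ q]) auto
    qed
    ultimately have "?X = Q" using Q neg by (intro max) (assumption | blast)+
    moreover have "a \<in> ?X"
      using subdomD(2)[OF S] ideal_inD(2)[OF Q(1)] by (intro CollectI exI[of _ 1] exI[of _ 0]) auto
    ultimately show False using a by simp
  qed
  have "prime_in S Q"
    unfolding prime_in_def
  proof (intro conjI ballI impI)
    show "1 \<notin> Q" using Q(3) M by blast
    fix a b assume ab: "a \<in> S" "b \<in> S" "a * b \<in> Q"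
    show "a \<in> Q \<or> b \<in> Q"
    proof (rule ccontr)
      assume "\<not> ?thesis"
      then obtain m r q m' r' q' where m: "m \<in> M" "r \<in> S" "q \<in> Q" "m = r * a + q"
        "m' \<in> M" "r' \<in> S" "q' \<in> Q" "m' = r' * b + q'" using ext[of a] ext[of b] ab by blast
      have "m * m' = (r * r') * (a * b) + (r * a + q) * q' + (r' * b) * q"
        by (simp add: m algebra_simps)
      also have "\<dots> \<in> Q"
      proof -
        have "(r * r') * (a * b) \<in> Q" "(r * a + q) * q' \<in> Q" "(r' * b) * q \<in> Q"
          using m ab ideal_inD(1)[OF Q(1)] by (auto intro!: ideal_inD(4)[OF Q(1)] subdomD(3,4)[OF S])
        then show ?thesis by (intro ideal_inD(3)[OF Q(1)])
      qed
      finally show False using M(3)[OF m(1,5)] Q(3) by blast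
    qed
  qed fact
  then show ?thesis using Q by blast
qed

text \<open>Gaussian elimination without divisions.\<close>

lemma underdetermined_system:
  fixes a :: "'y \<Rightarrow> 'x \<Rightarrow> 'a::idom"
  assumes D: "subdom D" and "finite W" "finite U" "card W < card U"
    "\<And>y x. y \<in> W \<Longrightarrow> x \<in> U \<Longrightarrow> a y x \<in> D"
  shows "\<exists>d. (\<forall>x\<in>U. d x \<in> D) \<and> (\<exists>x\<in>U. d x \<noteq> 0) \<and> (\<forall>y\<in>W. (\<Sum>x\<in>U. d x * a y x) = 0)"
  using assms(2-)
proof (induction W arbitrary: U a rule: finite_induct)
  case empty
  then have "U \<noteq> {}" by auto
  then show ?case using subdomD(2)[OF D] by (auto intro!: exI[of _ "\<lambda>_. 1"])
next
  case (insert y W)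
  show ?case
  proof (cases "\<exists>x0\<in>U. a y x0 \<noteq> 0")
    case False
    have "\<exists>d. (\<forall>x\<in>U. d x \<in> D) \<and> (\<exists>x\<in>U. d x \<noteq> 0) \<and> (\<forall>y\<in>W. (\<Sum>x\<in>U. d x * a y x) = 0)"
      using insert by (intro insert.IH) auto
    then show ?thesis using False by auto
  next
    case True
    then obtain x0 where x0: "x0 \<in> U" "a y x0 \<noteq> 0" by blast
    let ?U = "U - {x0}"
    \<comment> \<open>Row \<open>y'\<close> cross-multiplied with the pivot \<open>a y x0\<close>,
      which removes the unknown \<open>x0\<close> without division.\<close>
    define b where "b y' x = a y x0 * a y' x - a y x * a y' x0" for y' x
    have "\<exists>d. (\<forall>x\<in>?U. d x \<in> D) \<and> (\<exists>x\<in>?U. d x \<noteq> 0) \<and> (\<forall>y\<in>W. (\<Sum>x\<in>?U. d x * b y x) = 0)"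
    proof (rule insert.IH)
      show "card W < card ?U" using insert x0 by simp
    qed (use insert.prems x0 in \<open>auto simp: b_def intro!: subdomD[OF D]\<close>)
    then obtain d x1 where d: "\<And>x. x \<in> ?U \<Longrightarrow> d x \<in> D" "x1 \<in> ?U" "d x1 \<noteq> 0"
      "\<And>y. y \<in> W \<Longrightarrow> (\<Sum>x\<in>?U. d x * b y x) = 0" by blast
    define s where "s = (\<Sum>x\<in>?U. d x * a y x)"
    define e where "e x = (if x = x0 then - s else a y x0 * d x)" for x
    have sumE: "(\<Sum>x\<in>U. e x * a y' x) = a y x0 * (\<Sum>x\<in>?U. d x * a y' x) - s * a y' x0" for y'
    proof -
      have "(\<Sum>x\<in>U. e x * a y' x) = e x0 * a y' x0 + (\<Sum>x\<in>?U. e x * a y' x)"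
        using insert x0 by (intro sum.remove) auto
      also have "(\<Sum>x\<in>?U. e x * a y' x) = a y x0 * (\<Sum>x\<in>?U. d x * a y' x)"
        unfolding sum_distrib_left by (intro sum.cong) (auto simp: e_def)
      finally show ?thesis by (simp add: e_def)
    qed
    have "(\<Sum>x\<in>U. e x * a y' x) = 0" if y': "y' \<in> insert y W" for y'
    proof (cases "y' = y")
      case True then show ?thesis by (simp add: sumE s_def mult.commute)
    next
      case False
      then have "0 = (\<Sum>x\<in>?U. d x * b y' x)" using d(4) y' by simp
      also have "\<dots> = a y x0 * (\<Sum>x\<in>?U. d x * a y' x) - s * a y' x0"
        unfolding s_def sum_distrib_left sum_distrib_right sum_subtractf[symmetric]
        by (intro sum.cong) (auto simp: b_def algebra_simps)
      finally show ?thesis by (simp add: sumE)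
    qed
    moreover have "e x1 \<noteq> 0" using d x0 by (auto simp: e_def)
    moreover have "\<forall>x\<in>U. e x \<in> D"
      using d(1) insert.prems x0 by (auto simp: e_def s_def intro!: subdomD[OF D] subdom_sum[OF D])
    ultimately show ?thesis using d(2) by blast
  qed
qed

section \<open>Polynomials in a set of variables\<close>

type_synonym ('v, 'k) mpoly = "('v \<Rightarrow>\<^sub>0 nat) \<Rightarrow>\<^sub>0 'k"

definition Cst :: "'k::field \<Rightarrow> ('v, 'k) mpoly" where
  "Cst c = Poly_Mapping.single 0 c"

definition Var :: "'v \<Rightarrow> ('v, 'k::field) mpoly" where
  "Var v = Poly_Mapping.single (Poly_Mapping.single v 1) 1"

definition polys :: "'v set \<Rightarrow> ('v, 'k::field) mpoly set" where
  "polys V = {f. \<forall>m\<in>Poly_Mapping.keys f. Poly_Mapping.keys m \<subseteq> V}"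

definition is_hom :: "('a::comm_ring_1 \<Rightarrow> 'b::comm_ring_1) \<Rightarrow> bool" where
  "is_hom h \<longleftrightarrow> h 1 = 1 \<and> (\<forall>a b. h (a + b) = h a + h b) \<and> (\<forall>a b. h (a * b) = h a * h b)"

text \<open>Coefficients are mapped as well, so that one definition covers evaluation in the field,
  substitution of polynomials, and maps into a univariate polynomial ring.\<close>

definition subst :: "('k::field \<Rightarrow> 'b::comm_ring_1) \<Rightarrow> ('v \<Rightarrow> 'b) \<Rightarrow> ('v, 'k) mpoly \<Rightarrow> 'b" where
  "subst \<alpha> \<beta> f = (\<Sum>m\<in>Poly_Mapping.keys f. \<alpha> (Poly_Mapping.lookup f m) *
      (\<Prod>v\<in>Poly_Mapping.keys m. \<beta> v ^ Poly_Mapping.lookup m v))"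

lemma is_homD:
  assumes "is_hom h"
  shows "h 1 = 1" "h (a + b) = h a + h b" "h (a * b) = h a * h b" "h 0 = 0" "h (- a) = - h a"
    "h (a - b) = h a - h b" "h (a ^ k) = h a ^ k"
proof -
  have one: "h 1 = 1" and add: "\<And>a b. h (a + b) = h a + h b"
    and mul: "\<And>a b. h (a * b) = h a * h b"
    using assms by (auto simp: is_hom_def)
  show "h 1 = 1" "h (a + b) = h a + h b" "h (a * b) = h a * h b" by (fact one add mul)+
  show z: "h 0 = 0" using add[of 0 0] by simp
  have um: "h (- a) = - h a" for a using add[of a "- a"] z by (simp add: eq_neg_iff_add_eq_0 add.commute)
  then show "h (- a) = - h a" .
  show "h (a - b) = h a - h b" using add[of a "- b"] um by simp
  show "h (a ^ k) = h a ^ k" by (induction k) (simp_all add: mul one)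
qed

lemma is_hom_prod: "is_hom h \<Longrightarrow> h (prod f A) = (\<Prod>i\<in>A. h (f i))"
  by (induction A rule: infinite_finite_induct) (auto simp: is_homD)

lemma is_hom_Cst: "is_hom Cst"
  by (auto simp: is_hom_def Cst_def single_add mult_single)

lemma Cst_simps [simp]: "Cst 0 = 0" "Cst 1 = 1" "Cst (a + b) = Cst a + Cst b"
  "Cst (a * b) = Cst a * Cst b" "Cst (- a) = - Cst a" "Cst (a - b) = Cst a - Cst b"
  using is_homD[OF is_hom_Cst] by simp_all

lemma lookup_Cst_mult: "Poly_Mapping.lookup (Cst c * f) m = c * Poly_Mapping.lookup f m"
  by (simp add: Cst_def mult_map_scale_conv_mult[symmetric] Poly_Mapping.map.rep_eq when_def)

lemma is_hom_const_poly: "is_hom (\<lambda>c. [:h c:])" if "is_hom h"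
  using that by (auto simp: is_hom_def)

lemma is_hom_poly_eval: "is_hom (\<lambda>p. poly p c)"
  by (auto simp: is_hom_def)

lemma is_hom_comp: "is_hom g \<Longrightarrow> is_hom h \<Longrightarrow> is_hom (\<lambda>x. g (h x))"
  by (auto simp: is_hom_def)

lemma is_hom_id: "is_hom (\<lambda>x. x)"
  by (auto simp: is_hom_def)

lemma Var_power: "Var v ^ k = Poly_Mapping.single (Poly_Mapping.single v k) 1"
  by (induction k) (auto simp: Var_def mult_single single_add[symmetric])

lemma prod_Var: "finite A \<Longrightarrow>
  (\<Prod>v\<in>A. Var v ^ e v) = Poly_Mapping.single (\<Sum>v\<in>A. Poly_Mapping.single v (e v)) 1"
  by (induction A rule: finite_induct) (auto simp: Var_power mult_single)

lemma poly_mapping_sum_single: "(\<Sum>m\<in>Poly_Mapping.keys f. Poly_Mapping.single m (Poly_Mapping.lookup f m)) = f"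
  by (rule poly_mapping_eqI) (auto simp: lookup_sum lookup_single when_def in_keys_iff)

lemma single_conv: "Poly_Mapping.single m c = Cst c * (\<Prod>v\<in>Poly_Mapping.keys m. Var v ^ Poly_Mapping.lookup m v)"
  by (simp add: prod_Var poly_mapping_sum_single Cst_def mult_single)

section \<open>Substitution as a ring homomorphism\<close>

lemma subst_superset:
  assumes "finite B" "Poly_Mapping.keys f \<subseteq> B" "\<alpha> 0 = 0"
  shows "subst \<alpha> \<beta> f = (\<Sum>m\<in>B. \<alpha> (Poly_Mapping.lookup f m) *
      (\<Prod>v\<in>Poly_Mapping.keys m. \<beta> v ^ Poly_Mapping.lookup m v))"
  unfolding subst_def using assms by (intro sum.mono_neutral_left) (auto simp: in_keys_iff)

lemma subst_add:
  assumes "is_hom \<alpha>" shows "subst \<alpha> \<beta> (f + g) = subst \<alpha> \<beta> f + subst \<alpha> \<beta> g"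
proof -
  let ?B = "Poly_Mapping.keys f \<union> Poly_Mapping.keys g"
  have "Poly_Mapping.keys (f + g) \<subseteq> ?B" by (rule keys_add)
  then show ?thesis
    using assms by (simp add: subst_superset[where B = ?B] is_homD lookup_add distrib_right sum.distrib)
qed

lemma subst_single: "is_hom \<alpha> \<Longrightarrow> subst \<alpha> \<beta> (Poly_Mapping.single m c) =
    \<alpha> c * (\<Prod>v\<in>Poly_Mapping.keys m. \<beta> v ^ Poly_Mapping.lookup m v)"
  by (auto simp: subst_def is_homD)

lemma subst_sum: "is_hom \<alpha> \<Longrightarrow> subst \<alpha> \<beta> (sum f A) = (\<Sum>i\<in>A. subst \<alpha> \<beta> (f i))"
  by (induction A rule: infinite_finite_induct) (auto simp: subst_add, simp_all add: subst_def)

lemma monomial_value_add: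
  fixes \<beta> :: "'v \<Rightarrow> 'b::comm_ring_1"
  shows "(\<Prod>v\<in>Poly_Mapping.keys (m + m'). \<beta> v ^ Poly_Mapping.lookup (m + m') v) =
    (\<Prod>v\<in>Poly_Mapping.keys m. \<beta> v ^ Poly_Mapping.lookup m v) *
    (\<Prod>v\<in>Poly_Mapping.keys m'. \<beta> v ^ Poly_Mapping.lookup m' v)"
proof -
  let ?B = "Poly_Mapping.keys m \<union> Poly_Mapping.keys m'"
  have *: "(\<Prod>v\<in>Poly_Mapping.keys k. \<beta> v ^ Poly_Mapping.lookup k v) =
      (\<Prod>v\<in>?B. \<beta> v ^ Poly_Mapping.lookup k v)" if "Poly_Mapping.keys k \<subseteq> ?B" for k :: "'v \<Rightarrow>\<^sub>0 nat"
    using that by (intro prod.mono_neutral_left) (auto simp: in_keys_iff)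
  have "Poly_Mapping.keys (m + m') \<subseteq> ?B" by (rule keys_add)
  from *[OF this] *[of m] *[of m'] show ?thesis by (simp add: lookup_add power_add prod.distrib)
qed

lemma is_hom_subst:
  fixes \<beta> :: "'v \<Rightarrow> 'b::comm_ring_1"
  assumes "is_hom \<alpha>" shows "is_hom (subst \<alpha> \<beta>)"
  unfolding is_hom_def
proof (intro conjI allI)
  show "subst \<alpha> \<beta> 1 = 1"
    using subst_single[OF assms, of \<beta> 0 1] assms by (simp add: is_homD)
  show "subst \<alpha> \<beta> (f + g) = subst \<alpha> \<beta> f + subst \<alpha> \<beta> g" for f g
    by (rule subst_add[OF assms])
  show "subst \<alpha> \<beta> (f * g) = subst \<alpha> \<beta> f * subst \<alpha> \<beta> g" for f g
  proof -
    let ?s = "Poly_Mapping.single" and ?l = "Poly_Mapping.lookup"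
    have "subst \<alpha> \<beta> (?s m a * ?s m' b) = subst \<alpha> \<beta> (?s m a) * subst \<alpha> \<beta> (?s m' b)" for m m' a b
      by (simp add: mult_single subst_single[OF assms] monomial_value_add is_homD(3)[OF assms] mult_ac)
    then have "subst \<alpha> \<beta> ((\<Sum>m\<in>Poly_Mapping.keys f. ?s m (?l f m)) * (\<Sum>m\<in>Poly_Mapping.keys g. ?s m (?l g m))) =
      subst \<alpha> \<beta> (\<Sum>m\<in>Poly_Mapping.keys f. ?s m (?l f m)) * subst \<alpha> \<beta> (\<Sum>m\<in>Poly_Mapping.keys g. ?s m (?l g m))"
      by (simp add: sum_product subst_sum[OF assms])
    then show ?thesis by (simp only: poly_mapping_sum_single)
  qed
qed

lemma subst_Cst: "is_hom \<alpha> \<Longrightarrow> subst \<alpha> \<beta> (Cst c) = \<alpha> c"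
  by (simp add: Cst_def subst_single)

lemma subst_Var: "is_hom \<alpha> \<Longrightarrow> subst \<alpha> \<beta> (Var v) = \<beta> v"
  by (simp add: Var_def subst_single is_homD)

section \<open>The subring of polynomials in a given set of variables\<close>

lemma polys_Cst [simp]: "Cst c \<in> polys V"
  by (auto simp: polys_def Cst_def)

lemma polys_0 [simp]: "0 \<in> polys V" and polys_1 [simp]: "1 \<in> polys V"
  by (auto simp: polys_def)

lemma polys_Var [simp]: "Var v \<in> polys V \<longleftrightarrow> v \<in> V"
  by (auto simp: polys_def Var_def)

lemma subdom_polys: "subdom (polys V :: ('v::linorder, 'k::field) mpoly set)"
  unfolding subdom_def
proof (intro conjI ballI)
  fix f g :: "('v, 'k) mpoly" assume fg: "f \<in> polys V" "g \<in> polys V"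
  show "f + g \<in> polys V" using fg keys_add[of f g] by (auto simp: polys_def)
  show "f * g \<in> polys V"
    unfolding polys_def
  proof (intro CollectI ballI)
    fix m assume "m \<in> Poly_Mapping.keys (f * g)"
    then obtain a b where ab: "m = a + b" "a \<in> Poly_Mapping.keys f" "b \<in> Poly_Mapping.keys g"
      using keys_mult[of f g] by blast
    moreover have "Poly_Mapping.keys a \<subseteq> V" "Poly_Mapping.keys b \<subseteq> V"
      using fg ab by (auto simp: polys_def)
    ultimately show "Poly_Mapping.keys m \<subseteq> V" using keys_add[of a b] by auto
  qed
next
  fix f :: "('v, 'k) mpoly" assume "f \<in> polys V"
  then show "- f \<in> polys V" by (auto simp: polys_def in_keys_iff)
qed simp_all

lemmas polys_simps [simp] = subdomD(3-6)[OF subdom_polys]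

lemma polys_mono: "V \<subseteq> W \<Longrightarrow> polys V \<subseteq> polys W"
  by (auto simp: polys_def)

lemma polys_induct [consumes 1, case_names Cst Var add mult]:
  fixes f :: "('v::linorder, 'k::field) mpoly"
  assumes "f \<in> polys V" and C: "\<And>c. P (Cst c)" and V: "\<And>v. v \<in> V \<Longrightarrow> P (Var v)"
    and A: "\<And>f g. f \<in> polys V \<Longrightarrow> g \<in> polys V \<Longrightarrow> P f \<Longrightarrow> P g \<Longrightarrow> P (f + g)"
    and M: "\<And>f g. f \<in> polys V \<Longrightarrow> g \<in> polys V \<Longrightarrow> P f \<Longrightarrow> P g \<Longrightarrow> P (f * g)"
  shows "P f"
proof -
  define Q where "Q f \<longleftrightarrow> f \<in> polys V \<and> P f" for f
  have Q1: "Q 1" "Q 0" using C[of 1] C[of 0] by (auto simp: Q_def)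
  have Qp: "Q (Var v ^ k)" if "v \<in> V" for v k
    using Q1 by (induction k) (auto simp: Q_def V that M subdom_power[OF subdom_polys])
  have Qprod: "Q (\<Prod>v\<in>A. Var v ^ e v)" if "A \<subseteq> V" for A e
    using that Q1 Qp by (induction A rule: infinite_finite_induct) (auto simp: Q_def M)
  have Qs: "Q (Poly_Mapping.single m c)" if "Poly_Mapping.keys m \<subseteq> V" for m c
    unfolding single_conv using Qprod[OF that] M[of "Cst c"] C by (auto simp: Q_def)
  have "Q (\<Sum>m\<in>B. Poly_Mapping.single m (Poly_Mapping.lookup f m))"
    if "B \<subseteq> Poly_Mapping.keys f" for B
    using that
  proof (induction B rule: infinite_finite_induct)
    case (insert m B)
    then have "Q (Poly_Mapping.single m (Poly_Mapping.lookup f m))"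
      using \<open>f \<in> polys V\<close> by (intro Qs) (auto simp: polys_def)
    with insert show ?case by (simp add: Q_def A)
  qed (use Q1 in simp_all)
  from this[OF order_refl] show ?thesis by (simp add: poly_mapping_sum_single Q_def)
qed

lemma is_hom_eqI:
  fixes h h' :: "('v::linorder, 'k::field) mpoly \<Rightarrow> 'b::comm_ring_1"
  assumes "is_hom h" "is_hom h'" "\<And>c. h (Cst c) = h' (Cst c)" "\<And>v. v \<in> V \<Longrightarrow> h (Var v) = h' (Var v)"
    "f \<in> polys V"
  shows "h f = h' f"
  using assms(5) by (induction rule: polys_induct) (simp_all add: assms is_homD)

lemma is_hom_closed:
  fixes h :: "('v::linorder, 'k::field) mpoly \<Rightarrow> 'b::idom"
  assumes "is_hom h" "subdom T" "\<And>c. h (Cst c) \<in> T" "\<And>v. v \<in> V \<Longrightarrow> h (Var v) \<in> T" "f \<in> polys V"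
  shows "h f \<in> T"
  using assms(5) by (induction rule: polys_induct) (simp_all add: assms is_homD subdomD[OF assms(2)])

section \<open>Pulling back primes along maps into a univariate polynomial ring\<close>

definition coeffs_in :: "'a::zero set \<Rightarrow> 'a poly set" where
  "coeffs_in S = {p. \<forall>i. coeff p i \<in> S}"

lemma subdom_coeffs_in: assumes S: "subdom S" shows "subdom (coeffs_in S)"
  unfolding subdom_def coeffs_in_def
  using subdomD[OF S] by (auto simp: coeff_mult coeff_1 intro!: subdom_sum[OF S])

lemma ideal_coeffs_in: assumes S: "subdom S" and I: "ideal_in S I" shows "ideal_in (coeffs_in S) (coeffs_in I)"
  unfolding ideal_in_def coeffs_in_def
  using ideal_inD[OF I] by (auto simp: coeff_mult intro!: ideal_in_sum[OF I])

text \<open>Gauss's argument: take the first coefficients of \<open>p\<close> and \<open>q\<close>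
  outside \<open>P\<close>, at \<open>i\<close> and \<open>j\<close>. In the coefficient of
  \<open>p * q\<close> at \<open>i + j\<close> every other term has a factor in \<open>P\<close>, so
  the product of these two would lie in \<open>P\<close>.\<close>

lemma prime_coeffs_in:
  assumes S: "subdom S" and P: "prime_in S P" shows "prime_in (coeffs_in S) (coeffs_in P)"
  unfolding prime_in_def
proof (intro conjI ballI impI)
  note I = prime_inD(1)[OF P]
  show "ideal_in (coeffs_in S) (coeffs_in P)" by (rule ideal_coeffs_in[OF S I])
  show "1 \<notin> coeffs_in P" using prime_inD(2)[OF P] by (auto simp: coeffs_in_def dest: spec[of _ 0])
  fix p q assume pq: "p \<in> coeffs_in S" "q \<in> coeffs_in S" "p * q \<in> coeffs_in P"
  show "p \<in> coeffs_in P \<or> q \<in> coeffs_in P"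
  proof (rule ccontr)
    assume "\<not> ?thesis"
    then have ex: "\<exists>i. coeff p i \<notin> P" "\<exists>i. coeff q i \<notin> P" by (auto simp: coeffs_in_def)
    define i where "i = (LEAST i. coeff p i \<notin> P)"
    define j where "j = (LEAST i. coeff q i \<notin> P)"
    have ij: "coeff p i \<notin> P" "coeff q j \<notin> P" "\<And>k. k < i \<Longrightarrow> coeff p k \<in> P" "\<And>k. k < j \<Longrightarrow> coeff q k \<in> P"
      using LeastI_ex[OF ex(1)] LeastI_ex[OF ex(2)] not_less_Least by (auto simp: i_def j_def)
    have S': "coeff p k \<in> S" "coeff q k \<in> S" for k using pq by (auto simp: coeffs_in_def)
    have "coeff (p * q) (i + j) = coeff p i * coeff q j + (\<Sum>k\<in>{..i+j} - {i}. coeff p k * coeff q (i + j - k))"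
      by (simp add: coeff_mult sum.remove[of _ i])
    moreover have "(\<Sum>k\<in>{..i+j} - {i}. coeff p k * coeff q (i + j - k)) \<in> P"
    proof (rule ideal_in_sum[OF I])
      fix k assume "k \<in> {..i+j} - {i}"
      then have "k < i \<or> i + j - k < j" by auto
      then show "coeff p k * coeff q (i + j - k) \<in> P"
        using ij(3,4) S' ideal_inD(4,5)[OF I] by blast
    qed
    moreover have "coeff (p * q) (i + j) \<in> P" using pq(3) by (auto simp: coeffs_in_def)
    ultimately have "coeff p i * coeff q j \<in> P" using ideal_in_add_cancel[OF S I] by simp
    then show False using prime_inD(3)[OF P S'] ij by blast
  qed
qed

lemma prime_vimage:
  assumes S: "subdom S" and T: "subdom T" and h: "is_hom h" "\<And>f. f \<in> S \<Longrightarrow> h f \<in> T" and Q: "prime_in T Q"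
  shows "prime_in S {f \<in> S. h f \<in> Q}"
  using subdomD[OF S] h(2) ideal_inD[OF prime_inD(1)[OF Q]] prime_inD(2,3)[OF Q]
  by (auto simp: prime_in_def ideal_in_def is_homD[OF h(1)])

lemma prime_zero: "subdom S \<Longrightarrow> prime_in S {0}"
  by (auto simp: prime_in_def ideal_in_def subdomD)

lemma is_hom_into_poly: "is_hom (subst (\<lambda>c. [:Cst c:]) \<beta>)"
  by (intro is_hom_subst is_hom_const_poly is_hom_Cst)

text \<open>A homomorphism into polynomials in a new variable \<open>t\<close> is a one-parameter
  family of points. Expansion in one variable, Taylor expansion, the grading and the deformations
  are all of this form.\<close>

abbreviation into_poly :: "('v \<Rightarrow> ('v, 'k::field) mpoly poly) \<Rightarrow> ('v, 'k) mpoly \<Rightarrow> ('v, 'k) mpoly poly" where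
  "into_poly \<beta> \<equiv> subst (\<lambda>c. [:Cst c:]) \<beta>"

lemma into_poly_Cst [simp]: "into_poly \<beta> (Cst c) = [:Cst c:]"
  by (intro subst_Cst is_hom_const_poly is_hom_Cst)

lemma into_poly_Var [simp]: "into_poly \<beta> (Var v) = \<beta> v"
  by (intro subst_Var is_hom_const_poly is_hom_Cst)

lemmas into_poly_hom = is_homD[OF is_hom_into_poly]

lemma const_in_coeffs_in: "0 \<in> S \<Longrightarrow> c \<in> S \<Longrightarrow> [:c:] \<in> coeffs_in S"
  by (auto simp: coeffs_in_def coeff_pCons split: nat.split)

lemma into_poly_closed:
  fixes \<beta> :: "'v::linorder \<Rightarrow> ('v, 'k::field) mpoly poly"
  assumes "\<And>v. v \<in> V \<Longrightarrow> \<beta> v \<in> coeffs_in (polys W)" "f \<in> polys V"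
  shows "into_poly \<beta> f \<in> coeffs_in (polys W)"
  by (rule is_hom_closed[OF is_hom_into_poly subdom_coeffs_in[OF subdom_polys] _ _ assms(2)])
    (auto simp: assms intro!: const_in_coeffs_in)

text \<open>The pullback is the prime ideal of the family that \<open>\<beta>\<close> traces out
  from the generic point of \<open>P\<close>. Both the lower height bound and the deformations
  obtain smaller primes in this way.\<close>

lemma prime_pull:
  fixes \<beta> :: "'v::linorder \<Rightarrow> ('v, 'k::field) mpoly poly"
  assumes "prime_in (polys V) P" "\<And>v. v \<in> V \<Longrightarrow> \<beta> v \<in> coeffs_in (polys V)"
  shows "prime_in (polys V) {f \<in> polys V. into_poly \<beta> f \<in> coeffs_in P}"
  by (rule prime_vimage[OF subdom_polys subdom_coeffs_in[OF subdom_polys] is_hom_into_poly _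
        prime_coeffs_in[OF subdom_polys assms(1)]])
    (rule into_poly_closed[OF assms(2)])

section \<open>Heights of primes in a polynomial ring\<close>

definition prime_chain :: "'a::idom set \<Rightarrow> 'a set \<Rightarrow> nat \<Rightarrow> bool" where
  "prime_chain S P k \<longleftrightarrow> (\<exists>Q :: nat \<Rightarrow> 'a set.
     (\<forall>i\<le>k. prime_in S (Q i)) \<and> (\<forall>i<k. Q i \<subset> Q (Suc i)) \<and> Q k = P)"

lemma prime_height_ring_of:
  "subdom S \<Longrightarrow> prime_height (ring_of S) P = Sup {enat k | k. prime_chain S P k}"
  by (simp add: prime_height_def prime_chain_def primeideal_ring_of)

lemma prime_height_ge_iff:
  assumes "subdom S"
  shows "enat k \<le> prime_height (ring_of S) P \<longleftrightarrow> (k = 0 \<or> (\<exists>k'\<ge>k. prime_chain S P k'))"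
proof
  assume "k = 0 \<or> (\<exists>k'\<ge>k. prime_chain S P k')"
  then show "enat k \<le> prime_height (ring_of S) P"
    unfolding prime_height_ring_of[OF assms]
    by (metis (mono_tags, lifting) Sup_upper enat_ord_simps(1) mem_Collect_eq order_trans zero_enat_def zero_le)
next
  assume le: "enat k \<le> prime_height (ring_of S) P"
  show "k = 0 \<or> (\<exists>k'\<ge>k. prime_chain S P k')"
  proof (rule ccontr)
    assume "\<not> ?thesis"
    then have k: "k \<noteq> 0" "\<And>k'. prime_chain S P k' \<Longrightarrow> k' \<le> k - 1" by fastforce+
    have "prime_height (ring_of S) P \<le> enat (k - 1)"
      unfolding prime_height_ring_of[OF assms] by (rule Sup_least) (auto dest: k(2))
    then have "enat k \<le> enat (k - 1)" using le by (rule order_trans[rotated])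
    then show False using k(1) by simp
  qed
qed

lemma prime_chain_0: "prime_in S P \<Longrightarrow> prime_chain S P 0"
  by (auto simp: prime_chain_def intro!: exI[of _ "\<lambda>_. P"])

lemma prime_chain_Suc:
  assumes "prime_chain S Q k" "prime_in S P" "Q \<subset> P" shows "prime_chain S P (Suc k)"
proof -
  obtain c where "\<forall>i\<le>k. prime_in S (c i)" "\<forall>i<k. c i \<subset> c (Suc i)" "c k = Q"
    using assms(1) by (auto simp: prime_chain_def)
  then show ?thesis unfolding prime_chain_def using assms(2,3)
    by (intro exI[of _ "\<lambda>i. if i \<le> k then c i else P"]) (auto simp: less_Suc_eq le_Suc_eq)
qed

lemma prime_height_Suc_le:
  assumes S: "subdom S" and "prime_in S P" "prime_in S Q" "Q \<subset> P" "enat k \<le> prime_height (ring_of S) Q"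
  shows "enat (Suc k) \<le> prime_height (ring_of S) P"
proof -
  obtain k' where "k' \<ge> k" "prime_chain S Q k'"
    using assms(5) prime_chain_0[OF assms(3)] unfolding prime_height_ge_iff[OF S] by auto
  then show ?thesis
    using prime_chain_Suc[OF _ assms(2,4)] unfolding prime_height_ge_iff[OF S] by (metis Suc_le_mono)
qed

section \<open>Height bounds from independent sets of variables\<close>

lemma poly_in_ideal:
  assumes S: "subdom S" and I: "ideal_in S I" and "p \<in> coeffs_in I" "x \<in> S"
  shows "poly p x \<in> I"
  unfolding poly_altdef using assms(3,4)
  by (intro ideal_in_sum[OF I] ideal_inD(5)[OF I] subdom_power[OF S]) (auto simp: coeffs_in_def)

text \<open>\<open>separate z\<close> expands a polynomial in powers of the variable \<open>z\<close>.\<close>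

definition separate :: "'v \<Rightarrow> ('v, 'k::field) mpoly \<Rightarrow> ('v, 'k) mpoly poly" where
  "separate z = into_poly (\<lambda>v. if v = z then [:0, 1:] else [:Var v:])"

lemma separate_eval:
  fixes f :: "('v::linorder, 'k::field) mpoly"
  assumes "f \<in> polys V" shows "poly (separate z f) (Var z) = f"
proof (rule is_hom_eqI[OF _ is_hom_id _ _ assms])
  show "is_hom (\<lambda>f. poly (separate z f) (Var z))"
    unfolding separate_def by (rule is_hom_comp[OF is_hom_poly_eval is_hom_into_poly])
qed (simp_all add: separate_def)

lemma separate_const:
  fixes f :: "('v::linorder, 'k::field) mpoly"
  assumes "f \<in> polys V" "z \<notin> V" shows "separate z f = [:f:]"
proof (rule is_hom_eqI[OF _ _ _ _ assms(1)])
  show "is_hom (separate z)" unfolding separate_def by (rule is_hom_into_poly)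
  show "is_hom (\<lambda>f :: ('v, 'k) mpoly. [:f:])" using is_hom_const_poly[OF is_hom_id] .
qed (use assms in \<open>auto simp: separate_def\<close>)

lemma separate_closed:
  fixes f :: "('v::linorder, 'k::field) mpoly"
  assumes "f \<in> polys V" "V \<subseteq> insert z W" shows "separate z f \<in> coeffs_in (polys W)"
  unfolding separate_def
  by (rule into_poly_closed[OF _ assms(1)])
    (use assms(2) in \<open>auto simp: coeffs_in_def coeff_pCons split: nat.split\<close>)

text \<open>One variable at a time: \<open>Q\<close> consists of the polynomials whose coefficients
  with respect to \<open>z\<close> all lie in \<open>P\<close>. It forgets the relation that makes
  \<open>z\<close> algebraic over \<open>A\<close> and keeps those of the other variables of
  \<open>Z\<close>, which do not involve \<open>z\<close>. Hence each \<open>z\<close> contributes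
  one strict inclusion.\<close>

lemma prime_height_lower:
  fixes P :: "('v::linorder, 'k::field) mpoly set"
  assumes "finite Z" "Z \<subseteq> V" "A \<subseteq> V" "A \<inter> Z = {}" "prime_in (polys V) P" "P \<inter> polys A \<subseteq> {0}"
    "\<And>z. z \<in> Z \<Longrightarrow> \<not> P \<inter> polys (insert z A) \<subseteq> {0}"
  shows "enat (card Z) \<le> prime_height (ring_of (polys V)) P"
  using assms
proof (induction Z arbitrary: P rule: finite_induct)
  case empty
  then show ?case by (simp add: zero_enat_def[symmetric])
next
  case (insert z Z)
  let ?S = "polys V :: ('v, 'k) mpoly set"
  note P = insert.prems(4) and I = prime_inD(1)[OF insert.prems(4)]
  define Q where "Q = {f \<in> ?S. separate z f \<in> coeffs_in P}"
  have "prime_in ?S Q"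
    unfolding Q_def separate_def using insert.prems(1)
    by (intro prime_pull[OF P]) (auto simp: coeffs_in_def coeff_pCons split: nat.split)
  have "Q \<subseteq> P"
  proof
    fix f assume f: "f \<in> Q"
    then have "poly (separate z f) (Var z) \<in> P"
      using insert.prems(1) by (intro poly_in_ideal[OF subdom_polys I]) (auto simp: Q_def)
    moreover have "poly (separate z f) (Var z) = f"
      using f by (intro separate_eval) (auto simp: Q_def)
    ultimately show "f \<in> P" by simp
  qed
  obtain h where h: "h \<in> P" "h \<in> polys (insert z A)" "h \<noteq> 0" using insert.prems(6)[of z] by auto
  \<comment> \<open>Membership in \<open>Q\<close> would put the coefficients of \<open>h\<close>,
    which only involve \<open>A\<close>, into \<open>P\<close>; independence makes them all
    zero.\<close>
  have "h \<notin> Q"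
  proof
    assume "h \<in> Q"
    then have "coeff (separate z h) i \<in> P" for i by (auto simp: Q_def coeffs_in_def)
    moreover have "coeff (separate z h) i \<in> polys A" for i
      using separate_closed[OF h(2) order_refl] by (auto simp: coeffs_in_def)
    ultimately have "separate z h = 0" using insert.prems(5) by (auto simp: poly_eq_iff)
    then show False using separate_eval[OF h(2), of z] h(3) by simp
  qed
  have "enat (card Z) \<le> prime_height (ring_of ?S) Q"
  proof (rule insert.IH)
    show "prime_in ?S Q" by fact
    show "Q \<inter> polys A \<subseteq> {0}" using \<open>Q \<subseteq> P\<close> insert.prems(5) by blast
    fix y assume y: "y \<in> Z"
    then obtain g where g: "g \<in> P" "g \<in> polys (insert y A)" "g \<noteq> 0" using insert.prems(6)[of y] by auto
    have "z \<notin> insert y A" using y insert.hyps(2) insert.prems(3) by auto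
    then have "separate z g = [:g:]" by (rule separate_const[OF g(2)])
    then have "g \<in> Q"
      using g(1) ideal_inD(1)[OF I] const_in_coeffs_in[OF ideal_inD(2)[OF I] g(1)] by (auto simp: Q_def)
    then show "\<not> Q \<inter> polys (insert y A) \<subseteq> {0}" using g by auto
  qed (use insert.prems in auto)
  then have "enat (Suc (card Z)) \<le> prime_height (ring_of ?S) P"
    using \<open>Q \<subseteq> P\<close> \<open>h \<notin> Q\<close> h(1)
    by (intro prime_height_Suc_le[OF subdom_polys P \<open>prime_in ?S Q\<close>]) auto
  then show ?case using insert.hyps by simp
qed

subsection \<open>Algebraic independence modulo a prime\<close>

definition exponents :: "nat \<Rightarrow> nat \<Rightarrow> nat list set" where
  "exponents d N = {l. set l \<subseteq> {..N} \<and> length l = d}"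

definition power_list :: "'a::comm_ring_1 list \<Rightarrow> nat list \<Rightarrow> 'a" where
  "power_list as l = prod_list (map2 (^) as l)"

text \<open>The elements form a list because each smaller prime of a chain adds one in front.
  Bounding every exponent by \<open>N\<close> fits the later count of monomials in boxes.\<close>

definition alg_indep :: "('v, 'k::field) mpoly set \<Rightarrow> ('v, 'k) mpoly list \<Rightarrow> bool" where
  "alg_indep P as \<longleftrightarrow> (\<forall>N c. (\<Sum>l\<in>exponents (length as) N. Cst (c l) * power_list as l) \<in> P \<longrightarrow>
     (\<forall>l\<in>exponents (length as) N. c l = 0))"

lemma finite_exponents [simp]: "finite (exponents d N)"
  and card_exponents: "card (exponents d N) = (N + 1) ^ d"
  using finite_lists_length_eq[of "{..N}" d] card_lists_length_eq[of "{..N}" d] by (auto simp: exponents_def)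

lemma exponents_Suc: "exponents (Suc d) N = (\<lambda>(j, l). j # l) ` ({..N} \<times> exponents d N)"
  by (force simp: exponents_def length_Suc_conv)

lemma power_list_Cons [simp]: "power_list (a # as) (j # l) = a ^ j * power_list as l"
  by (simp add: power_list_def)

lemma power_list_Nil [simp]: "power_list [] l = 1"
  by (simp add: power_list_def)

lemma power_list_closed:
  "subdom S \<Longrightarrow> set as \<subseteq> S \<Longrightarrow> power_list as l \<in> S"
proof (induction as arbitrary: l)
  case (Cons a as)
  then show ?case
    by (cases l) (auto simp: subdomD subdom_power, auto simp: power_list_def subdomD)
qed (simp add: subdomD)

text \<open>Factors out the lowest power of \<open>f\<close> that occurs, so that it can be
  cancelled modulo a prime that does not contain \<open>f\<close>.\<close>

lemma sum_split_least:
  fixes f :: "'a::comm_ring_1"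
  assumes "\<And>j. j < i \<Longrightarrow> g j = 0" "i \<le> N"
  shows "(\<Sum>j\<le>N. f ^ j * g j) = f ^ i * (g i + f * (\<Sum>j\<in>{i<..N}. f ^ (j - i - 1) * g j))"
proof -
  have "(\<Sum>j\<le>N. f ^ j * g j) = (\<Sum>j\<in>insert i {i<..N}. f ^ j * g j)"
  proof (rule sum.mono_neutral_right)
    show "\<forall>j\<in>{..N} - insert i {i<..N}. f ^ j * g j = 0"
    proof
      fix j assume "j \<in> {..N} - insert i {i<..N}"
      then have "j < i" by auto
      then show "f ^ j * g j = 0" by (simp add: assms(1))
    qed
  qed (use assms(2) in auto)
  also have "\<dots> = f ^ i * g i + (\<Sum>j\<in>{i<..N}. f ^ j * g j)" by simp
  also have "(\<Sum>j\<in>{i<..N}. f ^ j * g j) = f ^ i * (f * (\<Sum>j\<in>{i<..N}. f ^ (j - i - 1) * g j))"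
    unfolding sum_distrib_left
  proof (rule sum.cong)
    fix j assume "j \<in> {i<..N}"
    then have "j = i + Suc (j - i - 1)" by auto
    then have "f ^ j = f ^ i * (f * f ^ (j - i - 1))" by (metis power_Suc power_add)
    then show "f ^ j * g j = f ^ i * (f * (f ^ (j - i - 1) * g j))" by (simp add: mult.assoc)
  qed simp
  finally show ?thesis by (simp add: distrib_left)
qed

text \<open>In a relation modulo \<open>Q\<close>, written in powers of \<open>f\<close>, the lowest
  power of \<open>f\<close> cancels because \<open>f\<close> is not in the prime \<open>Q\<close>.
  Modulo \<open>P\<close>, which contains \<open>f\<close>, only the lowest coefficient is left, and
  this is a relation of the shorter list.\<close>

lemma alg_indep_Cons:
  fixes P Q :: "('v::linorder, 'k::field) mpoly set"
  assumes "prime_in (polys V) P" "prime_in (polys V) Q" "Q \<subseteq> P" "f \<in> P" "f \<notin> Q"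
    and as: "set as \<subseteq> polys V" and indep: "alg_indep P as"
  shows "alg_indep Q (f # as)"
  unfolding alg_indep_def
proof (intro allI impI)
  note S = subdom_polys[of V] and IP = prime_inD(1)[OF assms(1)] and IQ = prime_inD(1)[OF assms(2)]
  fix N and c :: "nat list \<Rightarrow> 'k"
  let ?L = "exponents (length as) N"
  define g where "g j = (\<Sum>l\<in>?L. Cst (c (j # l)) * power_list as l)" for j
  assume "(\<Sum>l\<in>exponents (length (f # as)) N. Cst (c l) * power_list (f # as) l) \<in> Q"
  also have "(\<Sum>l\<in>exponents (length (f # as)) N. Cst (c l) * power_list (f # as) l) = (\<Sum>j\<le>N. f ^ j * g j)"
    unfolding length_Cons exponents_Suc g_def
    by (subst sum.reindex) (auto simp: inj_on_def sum.cartesian_product sum_distrib_left mult_ac intro!: sum.cong)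
  finally have Q: "(\<Sum>j\<le>N. f ^ j * g j) \<in> Q" .
  have f: "f \<in> polys V" using ideal_inD(1)[OF IP assms(4)] .
  have gS: "g j \<in> polys V" for j
    unfolding g_def using power_list_closed[OF S as] by (auto intro!: subdom_sum[OF S])
  have "c (j # l) = 0" if "j \<le> N" "l \<in> ?L" for j l
    using that
  proof (induction j arbitrary: l rule: less_induct)
    case (less i)
    have g0: "g j = 0" if "j < i" for j using less that by (auto simp: g_def)
    define r where "r = (\<Sum>j\<in>{i<..N}. f ^ (j - i - 1) * g j)"
    have r: "r \<in> polys V" unfolding r_def using f gS by (intro subdom_sum[OF S] polys_simps subdom_power[OF S])
    have "f ^ i * (g i + f * r) \<in> Q"
      using Q sum_split_least[of i g N f] g0 less.prems(1) by (simp add: r_def)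
    moreover have "f ^ i \<notin> Q" using prime_in_power[OF S assms(2) f] assms(5) by blast
    ultimately have "g i + f * r \<in> Q"
      using prime_inD(3)[OF assms(2), of "f ^ i" "g i + f * r"] f gS r by (auto simp: subdom_power[OF S])
    then have "g i + f * r \<in> P" using assms(3) by blast
    then have "g i \<in> P" using ideal_in_add_cancel[OF S IP] ideal_inD(5)[OF IP r assms(4)] by blast
    then show ?case
      using indep[unfolded alg_indep_def, rule_format, of "\<lambda>l. c (i # l)" N] less.prems(2) by (auto simp: g_def)
  qed
  then show "\<forall>l\<in>exponents (length (f # as)) N. c l = 0" by (auto simp: exponents_Suc)
qed

text \<open>Counting monomials of bounded degree in each variable bounds the length of an
  algebraically independent list.\<close>

definition box :: "'v set \<Rightarrow> nat \<Rightarrow> ('v \<Rightarrow>\<^sub>0 nat) set" where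
  "box V M = {m. Poly_Mapping.keys m \<subseteq> V \<and> (\<forall>v. Poly_Mapping.lookup m v \<le> M)}"

definition polys_box :: "'v set \<Rightarrow> nat \<Rightarrow> ('v, 'k::field) mpoly set" where
  "polys_box V M = {f. Poly_Mapping.keys f \<subseteq> box V M}"

lemma
  assumes "finite V"
  shows finite_box: "finite (box V M)" and card_box: "card (box V M) \<le> (M + 1) ^ card V"
proof -
  let ?r = "\<lambda>m. restrict (Poly_Mapping.lookup m) V"
  have inj: "inj_on ?r (box V M)"
  proof (rule inj_onI, rule poly_mapping_eqI)
    fix m m' v assume m: "m \<in> box V M" "m' \<in> box V M" and eq: "?r m = ?r m'"
    show "Poly_Mapping.lookup m v = Poly_Mapping.lookup m' v"
    proof (cases "v \<in> V")
      case True then show ?thesis using fun_cong[OF eq, of v] by simp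
    next
      case False
      then have "v \<notin> Poly_Mapping.keys m" "v \<notin> Poly_Mapping.keys m'" using m by (auto simp: box_def)
      then show ?thesis by (simp add: in_keys_iff)
    qed
  qed
  have sub: "?r ` box V M \<subseteq> V \<rightarrow>\<^sub>E {..M}" by (auto simp: box_def)
  have fin: "finite (V \<rightarrow>\<^sub>E {..M})" using assms by (intro finite_PiE) auto
  show "finite (box V M)" using inj sub fin by (rule inj_on_finite)
  have "card (box V M) \<le> card (V \<rightarrow>\<^sub>E {..M})" using inj sub fin by (rule card_inj_on_le)
  also have "\<dots> = (M + 1) ^ card V" using assms by (simp add: card_PiE)
  finally show "card (box V M) \<le> (M + 1) ^ card V" .
qed

lemma polys_box_mult: "f \<in> polys_box V M \<Longrightarrow> g \<in> polys_box V N \<Longrightarrow> f * g \<in> polys_box V (M + N)"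
proof -
  assume fg: "f \<in> polys_box V M" "g \<in> polys_box V N"
  have "a + b \<in> box V (M + N)" if "a \<in> box V M" "b \<in> box V N" for a b
    using that keys_add[of a b] by (auto simp: box_def lookup_add intro!: add_mono)
  then show ?thesis using fg keys_mult[of f g] by (fastforce simp: polys_box_def)
qed

lemma polys_box_1: "1 \<in> polys_box V M"
  by (auto simp: polys_box_def box_def)

lemma polys_box_power: "f \<in> polys_box V M \<Longrightarrow> f ^ k \<in> polys_box V (k * M)"
  by (induction k) (auto simp: polys_box_1 polys_box_mult)

lemma polys_box_mono: "M \<le> N \<Longrightarrow> polys_box V M \<subseteq> polys_box V N"
proof -
  assume "M \<le> N"
  then have "box V M \<subseteq> box V N" by (auto simp: box_def intro: order_trans)
  then show ?thesis by (auto simp: polys_box_def)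
qed

lemma polys_box_exists: "f \<in> polys V \<Longrightarrow> \<exists>M. f \<in> polys_box V M"
proof -
  assume f: "f \<in> polys V"
  define B where "B = (\<Union>m\<in>Poly_Mapping.keys f. Poly_Mapping.range m)"
  have B: "finite B" by (auto simp: B_def)
  have "Poly_Mapping.lookup m v \<le> Max (insert 0 B)" if "m \<in> Poly_Mapping.keys f" for m v
  proof (cases "v \<in> Poly_Mapping.keys m")
    case True
    then have "Poly_Mapping.lookup m v \<in> B" using that by (auto simp: B_def Poly_Mapping.in_keys_lookup_in_range intro!: bexI[of _ m])
    then show ?thesis using B by (intro Max_ge) auto
  qed (simp add: in_keys_iff)
  then have "f \<in> polys_box V (Max (insert 0 B))" using f by (auto simp: polys_box_def box_def polys_def)
  then show ?thesis by blast
qed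

lemma polys_box_power_list:
  "set as \<subseteq> polys_box V e \<Longrightarrow> set l \<subseteq> {..N} \<Longrightarrow> length l = length as \<Longrightarrow>
   power_list as l \<in> polys_box V (length as * (e * N))"
proof (induction as arbitrary: l)
  case (Cons a as)
  then obtain j l' where l: "l = j # l'" "length l' = length as" by (cases l) auto
  have "j * e \<le> e * N" using Cons.prems l by (simp add: mult.commute)
  then have "a ^ j \<in> polys_box V (e * N)"
    using polys_box_power[of a V e j] polys_box_mono[of "j * e" "e * N" V] Cons.prems by auto
  moreover have "power_list as l' \<in> polys_box V (length as * (e * N))" using Cons l by auto
  ultimately show ?case using l polys_box_mult by fastforce
qed (simp add: polys_box_1)

text \<open>Growth of degree \<open>d\<close> cannot be bounded by growth of a smaller degree. This
  comparison yields both the bound on independent lists and Krull's theorem.\<close>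

lemma growth_exponent_le:
  fixes C K d v :: nat
  assumes "\<And>N. (N + 1) ^ d \<le> C * (K * N + 1) ^ v" shows "d \<le> v"
proof (rule ccontr)
  assume "\<not> d \<le> v"
  then have d: "d = v + (d - v)" "d - v \<ge> 1" by auto
  \<comment> \<open>With this \<open>N\<close> the constant \<open>C * (K + 1) ^ v\<close> of the
    upper bound equals \<open>N\<close>, just below the factor \<open>N + 1\<close> gained from
    \<open>v < d\<close>.\<close>
  define N where "N = C * (K + 1) ^ v"
  have "(N + 1) ^ v * (N + 1) \<le> (N + 1) ^ v * (N + 1) ^ (d - v)"
    using d(2) by (intro mult_left_mono self_le_power) auto
  also have "\<dots> = (N + 1) ^ d" using d(1) by (metis power_add)
  also have "\<dots> \<le> C * (K * N + 1) ^ v" by (rule assms)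
  also have "\<dots> \<le> C * ((K + 1) * (N + 1)) ^ v" by (intro mult_left_mono power_mono) auto
  also have "\<dots> = (N + 1) ^ v * N" unfolding power_mult_distrib N_def by (simp only: mult_ac)
  finally show False by simp
qed

text \<open>The \<open>(N + 1) ^ d\<close> power products of a list of length \<open>d\<close> lie
  in a box whose number of monomials grows like \<open>N ^ card V\<close>. Whenever there are more
  products than monomials, linear algebra over the field gives a relation.\<close>

lemma alg_indep_length_le:
  fixes as :: "('v, 'k::field) mpoly list"
  assumes V: "finite V" and as: "set as \<subseteq> polys V" and indep: "alg_indep P as" and "0 \<in> P"
  shows "length as \<le> card V"
proof -
  obtain M where M: "\<And>a. a \<in> set as \<Longrightarrow> a \<in> polys_box V (M a)"
    using polys_box_exists as by (metis subset_iff)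
  define e where "e = Max (insert 0 (M ` set as))"
  have "M a \<le> e" if "a \<in> set as" for a unfolding e_def using that by (intro Max_ge) auto
  then have e: "set as \<subseteq> polys_box V e" using M polys_box_mono by blast
  let ?d = "length as"
  have "(N + 1) ^ ?d \<le> 1 * ((?d * e) * N + 1) ^ card V" for N
  proof (rule ccontr)
    assume neg: "\<not> ?thesis"
    let ?B = "box V (?d * (e * N))" and ?L = "exponents ?d N"
    have "card ?B < card ?L"
      using neg card_box[OF V, of "?d * (e * N)"] unfolding card_exponents by (simp add: mult.assoc)
    then have "\<exists>c. (\<forall>l\<in>?L. c l \<in> (UNIV :: 'k set)) \<and> (\<exists>l\<in>?L. c l \<noteq> 0) \<and>
      (\<forall>m\<in>?B. (\<Sum>l\<in>?L. c l * Poly_Mapping.lookup (power_list as l) m) = 0)"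
      by (intro underdetermined_system) (auto simp: subdom_def finite_box[OF V])
    then obtain c where c: "\<exists>l\<in>?L. c l \<noteq> 0"
      "\<And>m. m \<in> ?B \<Longrightarrow> (\<Sum>l\<in>?L. c l * Poly_Mapping.lookup (power_list as l) m) = 0" by blast
    have "(\<Sum>l\<in>?L. Cst (c l) * power_list as l) = 0"
    proof (rule poly_mapping_eqI)
      fix m
      have *: "Poly_Mapping.lookup (power_list as l) m = 0" if "m \<notin> ?B" "l \<in> ?L" for l
        using polys_box_power_list[OF e, of l N] that by (auto simp: exponents_def polys_box_def in_keys_iff)
      show "Poly_Mapping.lookup (\<Sum>l\<in>?L. Cst (c l) * power_list as l) m = Poly_Mapping.lookup 0 m"
        by (cases "m \<in> ?B") (simp_all add: lookup_sum lookup_Cst_mult c(2) *)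
    qed
    then show False using indep[unfolded alg_indep_def, rule_format, of c N] \<open>0 \<in> P\<close> c(1) by auto
  qed
  then show ?thesis by (rule growth_exponent_le)
qed

lemma alg_indep_Vars:
  fixes P :: "('v::linorder, 'k::field) mpoly set"
  assumes "distinct vs" "P \<inter> polys (set vs) \<subseteq> {0}"
  shows "alg_indep P (map Var vs)"
  unfolding alg_indep_def
proof (intro allI impI ballI)
  \<comment> \<open>The exponent vector of the monomial with exponents \<open>l\<close>; over
    distinct variables it determines \<open>l\<close>, so different monomials cannot cancel.\<close>
  define e where "e vs l = sum_list (map2 Poly_Mapping.single vs l)" for vs :: "'v list" and l :: "nat list"
  have pl: "power_list (map Var vs) l = (Poly_Mapping.single (e vs l) 1 :: ('v, 'k) mpoly)" if "length l = length vs" for l vs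
    using that by (induction l vs rule: list_induct2) (auto simp: e_def Var_power mult_single)
  have e0: "Poly_Mapping.lookup (e vs l) v = 0" if "length l = length vs" "v \<notin> set vs" for l vs v
    using that by (induction l vs rule: list_induct2) (auto simp: e_def lookup_add lookup_single)
  have inj: "l = l'" if "length l = length vs" "length l' = length vs" "distinct vs" "e vs l = e vs l'" for l l' vs
    using that
  proof (induction vs arbitrary: l l')
    case (Cons v vs)
    obtain j k j' k' where l: "l = j # k" "l' = j' # k'" "length k = length vs" "length k' = length vs"
      using Cons.prems by (cases l; cases l') auto
    have E: "Poly_Mapping.single v j + e vs k = Poly_Mapping.single v j' + e vs k'" using Cons.prems l by (simp add: e_def)
    from arg_cong[OF this, of "\<lambda>m. Poly_Mapping.lookup m v"] have "j = j'"
      using Cons.prems l by (simp add: lookup_add e0)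
    then show ?case using E Cons l by simp
  qed simp
  fix N l and c :: "nat list \<Rightarrow> 'k"
  let ?L = "exponents (length (map Var vs :: ('v, 'k) mpoly list)) N"
  let ?f = "\<Sum>l\<in>?L. Cst (c l) * power_list (map Var vs) l"
  assume f: "?f \<in> P" and l: "l \<in> ?L"
  have "?f \<in> polys (set vs)"
    by (intro subdom_sum[OF subdom_polys] polys_simps polys_Cst power_list_closed[OF subdom_polys]) auto
  with f have "?f = 0" using assms(2) by blast
  then have "0 = Poly_Mapping.lookup ?f (e vs l)" by simp
  also have "\<dots> = (\<Sum>l'\<in>?L. if l' = l then c l else 0)"
    unfolding lookup_sum lookup_Cst_mult
    by (intro sum.cong) (use inj[OF _ _ assms(1)] l in \<open>auto simp: pl exponents_def lookup_single when_def\<close>)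
  also have "\<dots> = c l" using l by simp
  finally show "c l = 0" by simp
qed

text \<open>Walking down a chain from \<open>P\<close>, each strict inclusion adds one element to an
  independent list that starts with the variables in \<open>A\<close>. At the bottom prime the list
  still has at most \<open>card V\<close> members.\<close>

lemma prime_height_upper:
  fixes P :: "('v::linorder, 'k::field) mpoly set"
  assumes V: "finite V" and P: "prime_in (polys V) P" and A: "A \<subseteq> V" "P \<inter> polys A \<subseteq> {0}"
  shows "prime_height (ring_of (polys V)) P \<le> enat (card V - card A)"
  unfolding prime_height_ring_of[OF subdom_polys]
proof (rule Sup_least, clarify)
  fix k assume "prime_chain (polys V) P k"
  then obtain Q where Q: "\<And>i. i \<le> k \<Longrightarrow> prime_in (polys V) (Q i)" "\<And>i. i < k \<Longrightarrow> Q i \<subset> Q (Suc i)" "Q k = P"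
    by (auto simp: prime_chain_def)
  have finA: "finite A" using A V finite_subset by blast
  then obtain vs where vs: "set vs = A" "distinct vs" using finite_distinct_list by blast
  have "\<exists>as. set as \<subseteq> polys V \<and> alg_indep (Q (k - i)) as \<and> length as = card A + i" if "i \<le> k" for i
    using that
  proof (induction i)
    case 0
    have "alg_indep (Q k) (map Var vs)" using alg_indep_Vars[OF vs(2)] vs(1) A Q(3) by simp
    then show ?case
      using vs A distinct_card[OF vs(2)] by (intro exI[of _ "map Var vs"]) auto
  next
    case (Suc i)
    then obtain as where as: "set as \<subseteq> polys V" "alg_indep (Q (k - i)) as" "length as = card A + i" by auto
    have "Q (k - Suc i) \<subset> Q (k - i)" using Q(2)[of "k - Suc i"] Suc.prems by (simp add: Suc_diff_Suc)
    then obtain f where f: "f \<in> Q (k - i)" "f \<notin> Q (k - Suc i)" "Q (k - Suc i) \<subseteq> Q (k - i)" by blast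
    have p: "prime_in (polys V) (Q (k - i))" "prime_in (polys V) (Q (k - Suc i))" using Q(1) by auto
    have "alg_indep (Q (k - Suc i)) (f # as)" by (rule alg_indep_Cons[OF p f(3,1,2) as(1,2)])
    then show ?case using as f ideal_inD(1)[OF prime_inD(1)[OF p(1)]] by (intro exI[of _ "f # as"]) auto
  qed
  from this[of k] obtain as where "set as \<subseteq> polys V" "alg_indep (Q 0) as" "length as = card A + k" by auto
  then have "card A + k \<le> card V"
    using alg_indep_length_le[OF V, of as "Q 0"] ideal_inD(2)[OF prime_inD(1)[OF Q(1)]] by simp
  then show "enat k \<le> enat (card V - card A)" by simp
qed

text \<open>For a maximal \<open>A\<close> every other variable is algebraic over \<open>A\<close>
  modulo \<open>P\<close>, so the lower and the upper bound meet.\<close>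

lemma prime_height_eq:
  fixes P :: "('v::linorder, 'k::field) mpoly set"
  assumes V: "finite V" and P: "prime_in (polys V) P"
  obtains A where "A \<subseteq> V" "P \<inter> polys A \<subseteq> {0}" "\<And>z. z \<in> V - A \<Longrightarrow> \<not> P \<inter> polys (insert z A) \<subseteq> {0}"
    "prime_height (ring_of (polys V)) P = enat (card V - card A)"
proof -
  let ?F = "{A. A \<subseteq> V \<and> P \<inter> polys A \<subseteq> {0}}"
  \<comment> \<open>The empty set is a candidate because a nonzero constant is invertible and so not
    in \<open>P\<close>.\<close>
  have "P \<inter> polys {} \<subseteq> {0}"
  proof
    fix f assume f: "f \<in> P \<inter> polys {}"
    have "f = 0 \<or> (\<exists>g\<in>polys V. g * f = 1)"
    proof -
      have "f = Cst (Poly_Mapping.lookup f 0)"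
        using f by (intro poly_mapping_eqI) (auto simp: Cst_def lookup_single when_def polys_def in_keys_iff)
      moreover have "Cst (inverse c) * Cst c = (1 :: ('v, 'k) mpoly)" if "c \<noteq> 0" for c
        using that by (metis Cst_simps(2,4) left_inverse)
      ultimately show ?thesis by (metis Cst_simps(1) polys_Cst)
    qed
    then show "f \<in> {0}" using f ideal_inD(4)[OF prime_inD(1)[OF P]] prime_inD(2)[OF P] by (metis IntD1 singletonI)
  qed
  then have "{} \<in> ?F" by simp
  moreover have fin: "finite ?F" by (rule finite_subset[of _ "Pow V"]) (use V in auto)
  ultimately have "\<exists>A\<in>?F. \<forall>B\<in>?F. A \<subseteq> B \<longrightarrow> A = B"
    by (intro finite_has_maximal) (simp, metis empty_iff)
  then obtain A where A: "A \<in> ?F" "\<forall>B\<in>?F. A \<subseteq> B \<longrightarrow> A = B" by (rule bexE)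
  have max: "\<not> P \<inter> polys (insert z A) \<subseteq> {0}" if z: "z \<in> V - A" for z
  proof
    assume "P \<inter> polys (insert z A) \<subseteq> {0}"
    then have "insert z A \<in> ?F" using A(1) z by simp
    with A(2) have "A \<subseteq> insert z A \<longrightarrow> A = insert z A" by (rule bspec)
    then show False using z by auto
  qed
  have "enat (card (V - A)) \<le> prime_height (ring_of (polys V)) P"
    using A(1) V max by (intro prime_height_lower[where A = A] P) auto
  moreover have "card (V - A) = card V - card A" using A(1) V by (auto intro: card_Diff_subset finite_subset)
  ultimately have "prime_height (ring_of (polys V)) P = enat (card V - card A)"
    using prime_height_upper[OF V P, of A] A(1) by (intro antisym) auto
  then show ?thesis using that A(1) max by blast
qed

section \<open>Krull's height theorem in a polynomial ring\<close>

fun ipow :: "'a::idom set \<Rightarrow> 'a set \<Rightarrow> nat \<Rightarrow> 'a set" where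
  "ipow S J 0 = S"
| "ipow S J (Suc j) = gen_in S {a * b | a b. a \<in> J \<and> b \<in> ipow S J j}"

context
  fixes S J :: "'a::idom set"
  assumes S: "subdom S" and J: "ideal_in S J"
begin

lemma ipow_ideal: "ideal_in S (ipow S J j)"
proof (induction j)
  case 0
  then show ?case using subdomD[OF S] by (auto simp: ideal_in_def)
next
  case (Suc j)
  then show ?case using ideal_inD(1) J
    by (auto intro!: gen_in_ideal[OF S] subdomD(4)[OF S])
qed

lemma ipow_gen_sub: "{a * b | a b. a \<in> J \<and> b \<in> ipow S J j} \<subseteq> S"
  using ideal_inD(1)[OF J] ideal_inD(1)[OF ipow_ideal] by (auto intro!: subdomD(4)[OF S])

lemma ipow_mult: "a \<in> J \<Longrightarrow> b \<in> ipow S J j \<Longrightarrow> a * b \<in> ipow S J (Suc j)"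
  using gen_in_incl[OF S ipow_gen_sub] by auto

lemma ipow_Suc_subset: "ipow S J (Suc j) \<subseteq> ipow S J j"
  using ideal_inD(1)[OF J] ideal_inD(4)[OF ipow_ideal]
  by (simp, intro gen_in_least[OF S ipow_gen_sub ipow_ideal]) auto

lemma ipow_antimono: "i \<le> j \<Longrightarrow> ipow S J j \<subseteq> ipow S J i"
  by (rule lift_Suc_antimono_le[of "ipow S J"]) (rule ipow_Suc_subset)

lemma ipow_1: "ipow S J (Suc 0) = J"
proof
  show "J \<subseteq> ipow S J (Suc 0)" using ipow_mult[of _ 1 0] subdomD(2)[OF S] by auto
  show "ipow S J (Suc 0) \<subseteq> J"
    using ideal_inD(5)[OF J] by (simp, intro gen_in_least[OF S ipow_gen_sub[of 0, simplified] J]) auto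
qed

end

text \<open>Coefficients of \<open>taylor z f\<close> are the Hasse derivatives of \<open>f\<close> in direction \<open>z\<close>.\<close>

definition taylor :: "'v \<Rightarrow> ('v, 'k::field) mpoly \<Rightarrow> ('v, 'k) mpoly poly" where
  "taylor z = into_poly (\<lambda>v. if v = z then [:Var z, 1:] else [:Var v:])"

lemma taylor_hom: "is_hom (taylor z)"
  unfolding taylor_def by (rule is_hom_into_poly)

lemma taylor_closed:
  fixes f :: "('v::linorder, 'k::field) mpoly"
  assumes "f \<in> polys V" shows "coeff (taylor z f) i \<in> polys V"
proof (cases "z \<in> V")
  case True
  have "taylor z f \<in> coeffs_in (polys V)"
    unfolding taylor_def by (rule into_poly_closed[OF _ assms])
      (use True in \<open>auto simp: coeffs_in_def coeff_pCons split: nat.split\<close>)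
  then show ?thesis by (simp add: coeffs_in_def)
next
  case False
  have "taylor z f = [:f:]"
    by (rule is_hom_eqI[OF taylor_hom is_hom_const_poly[OF is_hom_id] _ _ assms])
      (use False in \<open>auto simp: taylor_def\<close>)
  then show ?thesis using assms by (auto simp: coeff_pCons split: nat.split)
qed

lemma taylor_0:
  fixes f :: "('v::linorder, 'k::field) mpoly"
  assumes "f \<in> polys V" shows "coeff (taylor z f) 0 = f"
proof -
  have "poly (taylor z f) 0 = f"
    by (rule is_hom_eqI[OF is_hom_comp[OF is_hom_poly_eval taylor_hom] is_hom_id _ _ assms])
      (auto simp: taylor_def)
  then show ?thesis by (simp add: poly_0_coeff_0)
qed

text \<open>Replacing \<open>z\<close> by \<open>z + t\<close> keeps the top coefficient, so the
  leading coefficient in \<open>z\<close> is itself a Hasse derivative. This holds in every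
  characteristic, whereas iterated ordinary derivatives would bring in factorials.\<close>

lemma taylor_lead:
  fixes f :: "('v::linorder, 'k::field) mpoly"
  assumes "f \<in> polys V"
  shows "coeff (taylor z f) (degree (separate z f)) = lead_coeff (separate z f)"
proof -
  have hom: "is_hom (\<lambda>f :: ('v, 'k) mpoly. pcompose (separate z f) [:Var z, 1:])"
    unfolding separate_def
    by (auto simp: is_hom_def into_poly_hom pcompose_add pcompose_mult pcompose_1)
  have "taylor z f = pcompose (separate z f) [:Var z, 1:]"
    by (rule is_hom_eqI[OF taylor_hom hom _ _ assms])
      (auto simp: taylor_def separate_def pcompose_pCons)
  moreover have "degree (pcompose (separate z f) [:Var z, 1:]) = degree (separate z f)"
    by (simp add: degree_pcompose)
  moreover have "lead_coeff (pcompose (separate z f) [:Var z, 1:]) = lead_coeff (separate z f)"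
    by (subst lead_coeff_comp) simp_all
  ultimately show ?thesis by simp
qed

text \<open>Leibniz: \<open>i\<close> differentiations can destroy at most \<open>i\<close> of the
  \<open>j\<close> factors from \<open>J\<close>. With truncated subtraction the case
  \<open>j \<le> i\<close> only claims membership in the ring.\<close>

lemma hasse_ipow:
  fixes J :: "('v::linorder, 'k::field) mpoly set"
  assumes J: "ideal_in (polys V) J" and f: "f \<in> ipow (polys V) J j"
  shows "coeff (taylor z f) i \<in> ipow (polys V) J (j - i)"
  using f
proof (induction j arbitrary: f i)
  case 0
  then show ?case using taylor_closed by simp
next
  case (Suc j)
  let ?S = "polys V :: ('v, 'k) mpoly set"
  note S = subdom_polys[of V] and Ii = ipow_ideal[OF subdom_polys J] and anti = subsetD[OF ipow_antimono[OF subdom_polys J]]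
  \<comment> \<open>The elements satisfying the bound for all \<open>i\<close> form an ideal, so
    only the products generating the next power have to be checked.\<close>
  let ?I = "{f \<in> ?S. \<forall>i. coeff (taylor z f) i \<in> ipow ?S J (Suc j - i)}"
  have "ideal_in ?S ?I"
    unfolding ideal_in_def
  proof (intro conjI ballI)
    show "0 \<in> ?I" using ideal_inD(2)[OF Ii] by (auto simp: is_homD[OF taylor_hom])
    show "a + b \<in> ?I" if "a \<in> ?I" "b \<in> ?I" for a b
      using that ideal_inD(3)[OF Ii] by (auto simp: is_homD[OF taylor_hom])
    show "r * a \<in> ?I" if r: "r \<in> ?S" and a: "a \<in> ?I" for r a
    proof -
      have "coeff (taylor z r * taylor z a) i \<in> ipow ?S J (Suc j - i)" for i
        unfolding coeff_mult
      proof (rule ideal_in_sum[OF Ii])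
        fix k assume "k \<in> {..i}"
        have "coeff (taylor z a) (i - k) \<in> ipow ?S J (Suc j - (i - k))" using a by blast
        then have "coeff (taylor z a) (i - k) \<in> ipow ?S J (Suc j - i)" by (rule anti[rotated]) auto
        then show "coeff (taylor z r) k * coeff (taylor z a) (i - k) \<in> ipow ?S J (Suc j - i)"
          using ideal_inD(4)[OF Ii] taylor_closed[OF r] by blast
      qed
      then show ?thesis using r a by (auto simp: is_homD[OF taylor_hom])
    qed
  qed auto
  moreover have "{a * b | a b. a \<in> J \<and> b \<in> ipow ?S J j} \<subseteq> ?I"
  proof
    fix x assume "x \<in> {a * b | a b. a \<in> J \<and> b \<in> ipow ?S J j}"
    then obtain a b where x: "x = a * b" and a: "a \<in> J" and b: "b \<in> ipow ?S J j" by blast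
    have aS: "a \<in> ?S" and bS: "b \<in> ?S" using ideal_inD(1)[OF J a] ideal_inD(1)[OF Ii b] by auto
    have "coeff (taylor z a * taylor z b) i \<in> ipow ?S J (Suc j - i)" for i
      unfolding coeff_mult
    proof (rule ideal_in_sum[OF Ii])
      fix k assume k: "k \<in> {..i}"
      have bk: "coeff (taylor z b) (i - k) \<in> ipow ?S J (j - (i - k))" by (rule Suc.IH[OF b])
      show "coeff (taylor z a) k * coeff (taylor z b) (i - k) \<in> ipow ?S J (Suc j - i)"
      \<comment> \<open>For \<open>k = 0\<close> the factor \<open>a\<close> is undifferentiated and
        supplies its power of \<open>J\<close>; for \<open>k > 0\<close> a differentiation has been
        spent on \<open>a\<close>, which pays for the loss of that power.\<close>
      proof (cases "k = 0")
        case True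
        then have "coeff (taylor z a) k * coeff (taylor z b) (i - k) \<in> ipow ?S J (Suc (j - i))"
          using bk a taylor_0[OF aS] ipow_mult[OF S J] by auto
        then show ?thesis by (rule anti[rotated]) auto
      next
        case False
        then have "coeff (taylor z b) (i - k) \<in> ipow ?S J (Suc j - i)"
          using k by (intro anti[OF _ bk]) auto
        then show ?thesis using ideal_inD(4)[OF Ii] taylor_closed[OF aS] by blast
      qed
    qed
    then show "x \<in> ?I" using aS bS unfolding x by (auto simp: is_homD[OF taylor_hom])
  qed
  ultimately have "gen_in ?S {a * b | a b. a \<in> J \<and> b \<in> ipow ?S J j} \<subseteq> ?I"
    by (rule gen_in_least[OF S ipow_gen_sub[OF S J]])
  then show ?case using Suc.prems by auto
qed

section \<open>Monomial shifts and bounds on partial degrees\<close>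

lemma lookup_mult_single_shift:
  fixes f :: "('v, 'k::field) mpoly"
  shows "Poly_Mapping.lookup (f * Poly_Mapping.single \<mu> c) (a + \<mu>) = Poly_Mapping.lookup f a * c"
proof -
  have "f * Poly_Mapping.single \<mu> c =
      (\<Sum>m\<in>Poly_Mapping.keys f. Poly_Mapping.single m (Poly_Mapping.lookup f m)) * Poly_Mapping.single \<mu> c"
    by (simp only: poly_mapping_sum_single)
  also have "\<dots> = (\<Sum>m\<in>Poly_Mapping.keys f. Poly_Mapping.single (m + \<mu>) (Poly_Mapping.lookup f m * c))"
    by (simp add: sum_distrib_right mult_single)
  finally show ?thesis by (simp add: lookup_sum lookup_single when_def in_keys_iff)
qed

definition degree_bounded :: "'v set \<Rightarrow> nat \<Rightarrow> ('v, 'k::field) mpoly set" where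
  "degree_bounded W q = {f. \<forall>m\<in>Poly_Mapping.keys f. \<forall>v\<in>W. Poly_Mapping.lookup m v \<le> q}"

lemma degree_bounded_add: "f \<in> degree_bounded W q \<Longrightarrow> g \<in> degree_bounded W q \<Longrightarrow> f + g \<in> degree_bounded W q"
  using keys_add[of f g] by (auto simp: degree_bounded_def)

lemma degree_bounded_sum: "(\<And>i. i \<in> A \<Longrightarrow> f i \<in> degree_bounded W q) \<Longrightarrow> sum f A \<in> degree_bounded W q"
  by (induction A rule: infinite_finite_induct) (auto simp: degree_bounded_add, simp_all add: degree_bounded_def)

lemma separate_degree_bounded:
  fixes f :: "('v, 'k::field) mpoly"
  assumes "f \<in> degree_bounded W q"
  shows "coeff (separate z f) i \<in> degree_bounded W q"
    and "z \<in> W \<Longrightarrow> degree (separate z f) \<le> q"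
proof -
  define T where "T m = [:Cst (Poly_Mapping.lookup f m):] * (\<Prod>v\<in>Poly_Mapping.keys m.
      (if v = z then [:0, 1:] else [:Var v:]) ^ Poly_Mapping.lookup m v)" for m
  have sep: "separate z f = (\<Sum>m\<in>Poly_Mapping.keys f. T m)"
    by (simp add: separate_def subst_def T_def)
  have T: "T m = monom (Poly_Mapping.single (\<Sum>v\<in>Poly_Mapping.keys m - {z}. Poly_Mapping.single v (Poly_Mapping.lookup m v))
      (Poly_Mapping.lookup f m)) (Poly_Mapping.lookup m z)" for m
  proof -
    let ?g = "\<Prod>v\<in>Poly_Mapping.keys m - {z}. Var v ^ Poly_Mapping.lookup m v :: ('v, 'k) mpoly"
    let ?h = "\<lambda>v. (if v = z then [:0, 1:] else [:Var v:]) ^ Poly_Mapping.lookup m v :: ('v, 'k) mpoly poly"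
    have "(\<Prod>v\<in>Poly_Mapping.keys m. ?h v) = (\<Prod>v\<in>insert z (Poly_Mapping.keys m - {z}). ?h v)"
      by (rule prod.mono_neutral_left) (auto simp: in_keys_iff)
    also have "\<dots> = [:0, 1:] ^ Poly_Mapping.lookup m z * (\<Prod>v\<in>Poly_Mapping.keys m - {z}. [:Var v:] ^ Poly_Mapping.lookup m v)"
      by (subst prod.insert) auto
    also have "(\<Prod>v\<in>Poly_Mapping.keys m - {z}. [:Var v:] ^ Poly_Mapping.lookup m v) = [:?g:]"
      by (simp only: is_hom_prod[OF is_hom_const_poly[OF is_hom_id], symmetric]
          is_homD(7)[OF is_hom_const_poly[OF is_hom_id], symmetric])
    also have "[:0, 1:] ^ Poly_Mapping.lookup m z = monom (1 :: ('v, 'k) mpoly) (Poly_Mapping.lookup m z)"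
      by (simp add: monom_altdef)
    finally show ?thesis
      by (simp add: T_def smult_monom prod_Var Cst_def mult_single mult.commute)
  qed
  have b: "\<mu> = (\<Sum>v\<in>Poly_Mapping.keys m - {z}. Poly_Mapping.single v (Poly_Mapping.lookup m v)) \<Longrightarrow>
     Poly_Mapping.lookup \<mu> w \<le> Poly_Mapping.lookup m w" for m \<mu> :: "'v \<Rightarrow>\<^sub>0 nat" and w
    by (auto simp: lookup_sum lookup_single when_def)
  have Tb: "coeff (T m) i \<in> degree_bounded W q" if "m \<in> Poly_Mapping.keys f" for m i
    using assms that b[OF refl] unfolding T by (auto simp: degree_bounded_def intro: order_trans)
  show "coeff (separate z f) i \<in> degree_bounded W q"
    unfolding sep coeff_sum by (rule degree_bounded_sum) (rule Tb)
  show "degree (separate z f) \<le> q" if "z \<in> W"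
    unfolding sep
  proof (rule degree_sum_le)
    show "degree (T m) \<le> q" if "m \<in> Poly_Mapping.keys f" for m
      using assms that \<open>z \<in> W\<close> degree_monom_le[of _ "Poly_Mapping.lookup m z"] unfolding T
      by (auto simp: degree_bounded_def intro: order_trans)
  qed simp
qed

text \<open>By \<open>nilp\<close>, \<open>P\<close> is nil modulo \<open>F\<close> in the local
  ring at \<open>P\<close>, and \<open>indepA\<close> makes the nonzero elements of
  \<open>polys A\<close> units there. The aim is \<open>card (V - A) \<le> card F\<close>, by
  counting over the fraction field of \<open>polys A\<close>: monomials in \<open>V - A\<close> with
  exponents at most \<open>q\<close> stay independent modulo the power
  \<open>q * card (V - A) + 1\<close> of the local ideal, but the dimension modulo that power grows
  at most like \<open>q ^ card F\<close>.\<close>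

locale krull_setup =
  fixes V A :: "'v::linorder set" and P F :: "('v, 'k::field) mpoly set"
  assumes finV: "finite V" and P: "prime_in (polys V) P" and AV: "A \<subseteq> V"
    and indepA: "P \<inter> polys A \<subseteq> {0}"
    and maxA: "\<And>z. z \<in> V - A \<Longrightarrow> \<not> P \<inter> polys (insert z A) \<subseteq> {0}"
    and F: "finite F" "F \<subseteq> P"
    and nilp: "\<And>h. h \<in> P \<Longrightarrow> \<exists>s\<in>polys V - P. \<exists>N. s * h ^ N \<in> gen_in (polys V) F"
begin

abbreviation "S \<equiv> polys V :: ('v, 'k) mpoly set"
abbreviation "KA \<equiv> polys A - {0} :: ('v, 'k) mpoly set"

lemma S: "subdom S" by (rule subdom_polys)
lemma IP: "ideal_in S P" by (rule prime_inD(1)[OF P])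
lemma PS: "f \<in> P \<Longrightarrow> f \<in> S" by (rule ideal_inD(1)[OF IP])
lemma FS: "F \<subseteq> S" using F PS by blast
lemma AS: "f \<in> polys A \<Longrightarrow> f \<in> S" using polys_mono[OF AV] by blast

definition "J = gen_in S F"

lemma J: "ideal_in S J" unfolding J_def by (rule gen_in_ideal[OF S FS])
lemma FJ: "F \<subseteq> J" unfolding J_def by (rule gen_in_incl[OF S FS])
lemma JP: "J \<subseteq> P" unfolding J_def by (rule gen_in_least[OF S FS IP F(2)])

lemma unit_mult: "s \<in> S - P \<Longrightarrow> t \<in> S - P \<Longrightarrow> s * t \<in> S - P"
  using prime_inD(3)[OF P] by (auto simp: subdomD(4)[OF S])

lemma unit_1: "1 \<in> S - P"
  using prime_inD(2)[OF P] by simp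

text \<open>The contraction to \<open>S\<close> of the \<open>j\<close>-th power of \<open>J\<close> in the local ring at \<open>P\<close>.\<close>

definition locpow :: "nat \<Rightarrow> ('v, 'k) mpoly set" where
  "locpow j = {f \<in> S. \<exists>s\<in>S - P. s * f \<in> ipow S J j}"

lemma ipow_locpow: "ipow S J j \<subseteq> locpow j"
proof
  fix f assume f: "f \<in> ipow S J j"
  then have "1 * f \<in> ipow S J j" "f \<in> S" using ideal_inD(1)[OF ipow_ideal[OF S J]] by auto
  then show "f \<in> locpow j" unfolding locpow_def using unit_1 by blast
qed

lemma locpow_ideal: "ideal_in S (locpow j)"
  unfolding ideal_in_def
proof (intro conjI ballI)
  note Ii = ipow_ideal[OF S J, of j]
  show "0 \<in> locpow j" using ideal_inD(2)[OF Ii] ipow_locpow by blast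
  fix f g assume "f \<in> locpow j" "g \<in> locpow j"
  then obtain s t where fg: "f \<in> S" "g \<in> S" and st: "s \<in> S - P" "t \<in> S - P" "s * f \<in> ipow S J j" "t * g \<in> ipow S J j"
    by (auto simp: locpow_def)
  have "t * (s * f) + s * (t * g) \<in> ipow S J j"
    using st(1,2) by (intro ideal_inD(3)[OF Ii] ideal_inD(4)[OF Ii _ st(3)] ideal_inD(4)[OF Ii _ st(4)]) auto
  then have "(s * t) * (f + g) \<in> ipow S J j" by (simp add: algebra_simps)
  then show "f + g \<in> locpow j" using unit_mult[OF st(1,2)] fg by (auto simp: locpow_def)
next
  note Ii = ipow_ideal[OF S J, of j]
  fix r f assume r: "r \<in> S" "f \<in> locpow j"
  then obtain s where s: "f \<in> S" "s \<in> S - P" "s * f \<in> ipow S J j" by (auto simp: locpow_def)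
  then have "s * (r * f) \<in> ipow S J j" using ideal_inD(4)[OF Ii r(1) s(3)] by (simp add: mult_ac)
  then show "r * f \<in> locpow j" using s r by (auto simp: locpow_def)
qed (auto simp: locpow_def)

lemma locpow_S: "f \<in> locpow j \<Longrightarrow> f \<in> S"
  by (simp add: locpow_def)

lemma locpow_cancel:
  assumes "t \<in> S - P" "f \<in> S" "t * f \<in> locpow j" shows "f \<in> locpow j"
proof -
  obtain s where s: "s \<in> S - P" "s * (t * f) \<in> ipow S J j" using assms(3) by (auto simp: locpow_def)
  then have "(s * t) * f \<in> ipow S J j" by (simp add: mult.assoc)
  then show ?thesis using unit_mult[OF s(1) assms(1)] assms(2) unfolding locpow_def by blast
qed

lemma locpow_antimono: "i \<le> j \<Longrightarrow> f \<in> locpow j \<Longrightarrow> f \<in> locpow i"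
  unfolding locpow_def using ipow_antimono[OF S J, of i j] by blast

lemma locpow_0: "locpow 0 = S"
proof
  show "S \<subseteq> locpow 0" using ipow_locpow[of 0] by simp
qed (auto simp: locpow_def)

lemma locpow_1_iff: "f \<in> locpow (Suc 0) \<longleftrightarrow> f \<in> S \<and> (\<exists>s\<in>S - P. s * f \<in> J)"
  unfolding locpow_def ipow_1[OF S J] by simp

lemma locpow_1_P: "f \<in> locpow (Suc 0) \<Longrightarrow> f \<in> P"
  unfolding locpow_1_iff using JP prime_inD(3)[OF P] by blast

lemma locpow_mult: "f \<in> locpow (Suc 0) \<Longrightarrow> g \<in> locpow j \<Longrightarrow> f * g \<in> locpow (Suc j)"
proof -
  assume "f \<in> locpow (Suc 0)" "g \<in> locpow j"
  then obtain s t where st: "s \<in> S - P" "s * f \<in> J" "t \<in> S - P" "t * g \<in> ipow S J j" and fg: "f \<in> S" "g \<in> S"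
    unfolding locpow_1_iff by (auto simp: locpow_def)
  have "(s * f) * (t * g) \<in> ipow S J (Suc j)" by (rule ipow_mult[OF S J st(2,4)])
  then have "(s * t) * (f * g) \<in> ipow S J (Suc j)" by (simp add: mult_ac)
  then show ?thesis
    unfolding locpow_def using unit_mult[OF st(1,3)] fg by (auto simp del: ipow.simps)
qed

lemma J_locpow: "J \<subseteq> locpow (Suc 0)"
  using ipow_locpow[of "Suc 0"] unfolding ipow_1[OF S J] .

text \<open>Apply Leibniz to \<open>s * f\<close>: up to terms with lower derivatives of
  \<open>f\<close>, already known to be in \<open>locpow\<close>, its \<open>i\<close>-th derivative
  is \<open>s\<close> times that of \<open>f\<close>, and \<open>s\<close> cancels.\<close>

lemma hasse_locpow:
  assumes "f \<in> locpow j" shows "coeff (taylor z f) i \<in> locpow (j - i)"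
proof -
  obtain s where s: "s \<in> S" "s \<notin> P" "s * f \<in> ipow S J j" and f: "f \<in> S" using assms by (auto simp: locpow_def)
  show ?thesis
  proof (induction i rule: less_induct)
    case (less i)
    note I = locpow_ideal[of "j - i"]
    have "coeff (taylor z s * taylor z f) i =
        s * coeff (taylor z f) i + (\<Sum>k\<in>{..i} - {0}. coeff (taylor z s) k * coeff (taylor z f) (i - k))"
      using taylor_0[OF s(1)] by (simp add: coeff_mult sum.remove[of _ 0])
    moreover have "(\<Sum>k\<in>{..i} - {0}. coeff (taylor z s) k * coeff (taylor z f) (i - k)) \<in> locpow (j - i)"
    proof (rule ideal_in_sum[OF I], rule ideal_inD(4)[OF I])
      fix k assume "k \<in> {..i} - {0}"
      then have "coeff (taylor z f) (i - k) \<in> locpow (j - (i - k))" by (intro less) auto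
      then show "coeff (taylor z f) (i - k) \<in> locpow (j - i)" by (rule locpow_antimono[rotated]) auto
    qed (rule taylor_closed[OF s(1)])
    moreover have "coeff (taylor z s * taylor z f) i \<in> locpow (j - i)"
      using hasse_ipow[OF J s(3)] ipow_locpow by (auto simp: is_homD[OF taylor_hom])
    ultimately have "s * coeff (taylor z f) i \<in> locpow (j - i)"
      using ideal_in_add_cancel[OF S I] by simp
    then show ?case using locpow_cancel[of s] s taylor_closed[OF f] by blast
  qed
qed

text \<open>Passing to leading coefficients one variable at a time loses at most \<open>q\<close> in the
  order at \<open>P\<close> and ends in \<open>polys A\<close>, which meets \<open>P\<close> trivially.\<close>

lemma order_bound:
  assumes "finite Z" "Z \<subseteq> V" "f \<in> polys (A \<union> Z)" "f \<in> degree_bounded Z q" "f \<in> locpow j" "q * card Z < j"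
  shows "f = 0"
  using assms
proof (induction Z arbitrary: f j rule: finite_induct)
  case empty
  then have "f \<in> locpow (Suc 0)" by (intro locpow_antimono[of "Suc 0" j]) auto
  then show ?case using empty.prems(2) locpow_1_P indepA by auto
next
  case (insert z Z)
  define e where "e = degree (separate z f)"
  define g where "g = lead_coeff (separate z f)"
  have fS: "f \<in> S" by (rule locpow_S[OF insert.prems(4)])
  have e: "e \<le> q" unfolding e_def by (rule separate_degree_bounded(2)[OF insert.prems(3)]) simp
  \<comment> \<open>Removing \<open>z\<close> costs \<open>e \<le> q\<close> in the order, at most
    what the hypothesis reserves for one variable.\<close>
  have jj: "q * card Z < j - e"
  proof -
    have "q * card Z + q < j" using insert by simp
    then show ?thesis using e by linarith
  qed
  have "g = 0"
  proof (rule insert.IH)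
    show "g \<in> polys (A \<union> Z)"
      using separate_closed[OF insert.prems(2), of z "A \<union> Z"] by (auto simp: g_def coeffs_in_def)
    have "g \<in> degree_bounded (insert z Z) q"
      unfolding g_def by (rule separate_degree_bounded(1)[OF insert.prems(3)])
    then show "g \<in> degree_bounded Z q" by (auto simp: degree_bounded_def)
    show "g \<in> locpow (j - e)"
      using hasse_locpow[OF insert.prems(4), of z e] taylor_lead[OF fS, of z] by (simp add: g_def e_def)
  qed (use insert.prems jj in auto)
  then have "separate z f = 0" by (simp add: g_def)
  then show ?case using separate_eval[OF fS, of z] by simp
qed

subsection \<open>Reduction to finitely many elements over the independent variables\<close>

text \<open>Span of \<open>G\<close> over the fraction field of \<open>polys A\<close>, modulo the
  contracted power \<open>locpow j\<close>; the factor \<open>c\<close> clears denominators, so that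
  everything stays inside the polynomial ring.\<close>

definition reach :: "('v, 'k) mpoly set \<Rightarrow> nat \<Rightarrow> ('v, 'k) mpoly set" where
  "reach G j = {f \<in> S. \<exists>c\<in>KA. \<exists>a b. (\<forall>g\<in>G. a g \<in> polys A) \<and> b \<in> locpow j \<and> c * f = (\<Sum>g\<in>G. a g * g) + b}"

lemma KA_mult: "c \<in> KA \<Longrightarrow> d \<in> KA \<Longrightarrow> c * d \<in> KA"
  by simp

lemma reachI: "f \<in> S \<Longrightarrow> c \<in> KA \<Longrightarrow> (\<And>g. g \<in> G \<Longrightarrow> a g \<in> polys A) \<Longrightarrow> b \<in> locpow j \<Longrightarrow>
    c * f = (\<Sum>g\<in>G. a g * g) + b \<Longrightarrow> f \<in> reach G j"
  unfolding reach_def by blast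

lemma reachE:
  assumes "f \<in> reach G j"
  obtains c a b where "f \<in> S" "c \<in> KA" "\<And>g. g \<in> G \<Longrightarrow> a g \<in> polys A" "b \<in> locpow j"
    "c * f = (\<Sum>g\<in>G. a g * g) + b"
  using assms unfolding reach_def by blast

lemma reach_add: assumes "f \<in> reach G j" "f' \<in> reach G j" shows "f + f' \<in> reach G j"
proof -
  from assms(1) obtain c a b where 1: "f \<in> S" "c \<in> KA" "\<And>g. g \<in> G \<Longrightarrow> a g \<in> polys A" "b \<in> locpow j"
    "c * f = (\<Sum>g\<in>G. a g * g) + b" by (rule reachE) blast
  from assms(2) obtain c' a' b' where 2: "f' \<in> S" "c' \<in> KA" "\<And>g. g \<in> G \<Longrightarrow> a' g \<in> polys A" "b' \<in> locpow j"
    "c' * f' = (\<Sum>g\<in>G. a' g * g) + b'" by (rule reachE) blast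
  have "(c * c') * (f + f') = c' * (c * f) + c * (c' * f')" by (simp add: algebra_simps)
  also have "\<dots> = (\<Sum>g\<in>G. (c' * a g + c * a' g) * g) + (c' * b + c * b')"
    unfolding 1(5) 2(5) by (simp add: algebra_simps sum.distrib sum_distrib_left)
  finally show ?thesis
    using 1 2 AS by (intro reachI[where c = "c * c'" and b = "c' * b + c * b'"])
      (auto intro!: ideal_inD(3,4)[OF locpow_ideal])
qed

lemma reach_scale: assumes "f \<in> reach G j" "d \<in> polys A" shows "d * f \<in> reach G j"
proof -
  from assms(1) obtain c a b where 1: "f \<in> S" "c \<in> KA" "\<And>g. g \<in> G \<Longrightarrow> a g \<in> polys A" "b \<in> locpow j"
    "c * f = (\<Sum>g\<in>G. a g * g) + b" by (rule reachE) blast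
  have "c * (d * f) = d * (c * f)" by (simp add: mult_ac)
  also have "\<dots> = (\<Sum>g\<in>G. (d * a g) * g) + d * b"
    unfolding 1(5) by (simp add: algebra_simps sum_distrib_left)
  finally show ?thesis
    using 1 assms(2) AS by (intro reachI[where c = c and b = "d * b"])
      (auto intro!: ideal_inD(4)[OF locpow_ideal])
qed

lemma reach_cancel: assumes "f \<in> S" "d \<in> KA" "d * f \<in> reach G j" shows "f \<in> reach G j"
proof -
  from assms(3) obtain c a b where 1: "c \<in> KA" "\<And>g. g \<in> G \<Longrightarrow> a g \<in> polys A" "b \<in> locpow j"
    "c * (d * f) = (\<Sum>g\<in>G. a g * g) + b" by (rule reachE) blast
  then have "(c * d) * f = (\<Sum>g\<in>G. a g * g) + b" by (simp add: mult_ac)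
  then show ?thesis using KA_mult[OF 1(1) assms(2)] 1(2,3) assms(1) by (intro reachI)
qed

lemma reach_locpow: assumes "f \<in> locpow j" shows "f \<in> reach G j"
  using assms locpow_S by (intro reachI[where c = 1 and a = "\<lambda>_. 0" and b = f]) auto

lemma reach_gen: assumes "g \<in> G" "finite G" "G \<subseteq> S" shows "g \<in> reach G j"
proof -
  have "1 * g = (\<Sum>h\<in>G. (if h = g then 1 else 0) * h) + 0"
    using assms by (subst sum.remove[of _ g]) auto
  then show ?thesis
    using assms ideal_inD(2)[OF locpow_ideal] by (intro reachI[where c = 1 and b = 0]) auto
qed

lemma reach_sum: "(\<And>i. i \<in> B \<Longrightarrow> f i \<in> reach G j) \<Longrightarrow> sum f B \<in> reach G j"
  using ideal_inD(2)[OF locpow_ideal]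
  by (induction B rule: infinite_finite_induct) (auto simp: reach_add intro: reach_locpow)

text \<open>Spanning set and power may change together: multiplication by \<open>y\<close> need only
  be controlled on \<open>G\<close> and on the error term.\<close>

lemma reach_mult:
  assumes y: "y \<in> S" "\<And>g. g \<in> G \<Longrightarrow> y * g \<in> reach G' j'" "\<And>b. b \<in> locpow j \<Longrightarrow> y * b \<in> locpow j'"
    and f: "f \<in> reach G j"
  shows "y * f \<in> reach G' j'"
proof -
  from f obtain c a b where 1: "f \<in> S" "c \<in> KA" "\<And>g. g \<in> G \<Longrightarrow> a g \<in> polys A" "b \<in> locpow j"
    "c * f = (\<Sum>g\<in>G. a g * g) + b" by (rule reachE) blast
  have "c * (y * f) = y * (c * f)" by (simp add: mult_ac)
  also have "\<dots> = (\<Sum>g\<in>G. a g * (y * g)) + y * b"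
    unfolding 1(5) by (simp add: algebra_simps sum_distrib_left)
  also have "\<dots> \<in> reach G' j'"
  proof (rule reach_add)
    show "(\<Sum>g\<in>G. a g * (y * g)) \<in> reach G' j'" by (intro reach_sum reach_scale y(2) 1(3))
    show "y * b \<in> reach G' j'" using 1 y by (intro reach_locpow)
  qed
  finally show ?thesis using reach_cancel[of "y * f" c] 1(1,2) y(1) by auto
qed

section \<open>A finite spanning set over the independent variables\<close>

definition "Z = V - A"

lemma finZ: "finite Z" and ZV: "Z \<subseteq> V" and AZ: "A \<inter> Z = {}" and VZ: "V = A \<union> Z"
  using finV AV by (auto simp: Z_def)

text \<open>A relation of \<open>z\<close> over \<open>A\<close> modulo \<open>P\<close> is only
  nilpotent modulo \<open>J\<close> in the local ring; a power of it lies in the contracted local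
  ideal and is still a nonzero polynomial in \<open>z\<close> and \<open>A\<close>.\<close>

definition vanishing :: "'v \<Rightarrow> ('v, 'k) mpoly" where
  "vanishing z = (SOME H. H \<in> locpow (Suc 0) \<and> H \<in> polys (insert z A) \<and> H \<noteq> 0)"

lemma vanishing:
  assumes "z \<in> Z"
  shows "vanishing z \<in> locpow (Suc 0)" "vanishing z \<in> polys (insert z A)" "vanishing z \<noteq> 0"
proof -
  obtain h where h: "h \<in> P" "h \<in> polys (insert z A)" "h \<noteq> 0"
    using maxA[of z] assms by (auto simp: Z_def)
  obtain s N where s: "s \<in> S - P" "s * h ^ N \<in> J" using nilp[OF h(1)] by (auto simp: J_def)
  have "h ^ N \<in> locpow (Suc 0)"
    unfolding locpow_1_iff using s PS[OF h(1)] subdom_power[OF S] by blast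
  moreover have "h ^ N \<in> polys (insert z A)" by (rule subdom_power[OF subdom_polys h(2)])
  ultimately have "\<exists>H. H \<in> locpow (Suc 0) \<and> H \<in> polys (insert z A) \<and> H \<noteq> 0"
    using h(3) by (intro exI[of _ "h ^ N"]) auto
  from someI_ex[OF this] show "vanishing z \<in> locpow (Suc 0)" "vanishing z \<in> polys (insert z A)" "vanishing z \<noteq> 0"
    by (auto simp: vanishing_def)
qed

definition "deg z = degree (separate z (vanishing z))"

lemma vanishing_coeff: "z \<in> Z \<Longrightarrow> coeff (separate z (vanishing z)) i \<in> polys A"
  using separate_closed[OF vanishing(2) order_refl] by (auto simp: coeffs_in_def)

lemma vanishing_eq:
  assumes "z \<in> Z" shows "vanishing z = (\<Sum>i\<le>deg z. coeff (separate z (vanishing z)) i * Var z ^ i)"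
  using separate_eval[OF vanishing(2)[OF assms], of z] by (simp add: poly_altdef deg_def)

lemma deg_pos: assumes "z \<in> Z" shows "deg z > 0"
proof (rule ccontr)
  assume "\<not> ?thesis"
  then have "vanishing z = coeff (separate z (vanishing z)) 0" using vanishing_eq[OF assms] by simp
  then have "vanishing z \<in> polys A" using vanishing_coeff[OF assms] by metis
  then show False using vanishing[OF assms] locpow_1_P indepA by auto
qed

lemma vanishing_lead: "z \<in> Z \<Longrightarrow> coeff (separate z (vanishing z)) (deg z) \<in> KA"
  using vanishing_coeff[of z "deg z"] vanishing(3)[of z] separate_eval[OF vanishing(2), of z z]
  by (auto simp: deg_def)

definition zmon :: "('v \<Rightarrow> nat) \<Rightarrow> ('v, 'k) mpoly" where
  "zmon \<beta> = (\<Prod>z\<in>Z. Var z ^ \<beta> z)"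

lemma zmon_S: "zmon \<beta> \<in> S"
  unfolding zmon_def using ZV by (intro subdom_prod[OF S] subdom_power[OF S]) auto

text \<open>These monomials span everything modulo \<open>locpow (Suc 0)\<close>: a power of
  \<open>z\<close> from \<open>deg z\<close> on is reduced by the leading term of
  \<open>vanishing z\<close>, whose coefficient is in \<open>KA\<close>.\<close>

definition "G0 = zmon ` (\<Pi>\<^sub>E z\<in>Z. {..<deg z})"

lemma G0: "finite G0" "G0 \<subseteq> S"
  unfolding G0_def using finZ zmon_S by (auto intro!: finite_PiE)

lemma zmon_restrict: "zmon (restrict \<beta> Z) = zmon \<beta>"
  by (simp add: zmon_def)

lemma zmon_G0: "(\<And>z. z \<in> Z \<Longrightarrow> \<beta> z < deg z) \<Longrightarrow> zmon \<beta> \<in> G0"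
  unfolding G0_def zmon_restrict[symmetric, of \<beta>] by (intro imageI) auto

lemma zmon_upd: "z \<in> Z \<Longrightarrow> zmon (\<beta>(z := i)) = Var z ^ i * zmon (\<beta>(z := 0))"
  using finZ by (simp add: zmon_def prod.remove)

lemma one_G0: "1 \<in> G0"
  using zmon_G0[of "\<lambda>_. 0"] deg_pos by (simp add: zmon_def)

lemma Var_G0:
  assumes z: "z \<in> Z" and g: "g \<in> G0" shows "Var z * g \<in> reach G0 (Suc 0)"
proof -
  obtain \<beta> where b: "g = zmon \<beta>" "\<And>z. z \<in> Z \<Longrightarrow> \<beta> z < deg z" using g unfolding G0_def by (auto simp: PiE_iff)
  define y where "y = zmon (\<beta>(z := 0))"
  have g': "g = Var z ^ \<beta> z * y" using zmon_upd[OF z, of \<beta> "\<beta> z"] by (simp add: b(1) y_def)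
  have low: "Var z ^ i * y \<in> G0" if "i < deg z" for i
    using zmon_G0[of "\<beta>(z := i)"] zmon_upd[OF z, of \<beta> i] b(2) that by (auto simp: y_def)
  have gen: "Var z ^ i * y \<in> reach G0 (Suc 0)" if "i < deg z" for i
    using reach_gen[OF low[OF that] G0] .
  show ?thesis
  proof (cases "Suc (\<beta> z) < deg z")
    case True
    then show ?thesis using gen[of "Suc (\<beta> z)"] by (simp add: g' mult.assoc)
  next
    case False
    \<comment> \<open>The exponent has just reached \<open>deg z\<close>: \<open>vanishing z\<close>
      times the remaining monomial \<open>y\<close> expresses the new product by lower powers of
      \<open>z\<close>, all in \<open>G0\<close>.\<close>
    then have d: "deg z = Suc (\<beta> z)" using b(2)[OF z] by simp
    let ?a = "coeff (separate z (vanishing z))"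
    have lin: "?a (deg z) * (Var z * g) = y * vanishing z - (\<Sum>i<deg z. ?a i * (Var z ^ i * y))"
    proof -
      have "vanishing z = (\<Sum>i<deg z. ?a i * Var z ^ i) + ?a (deg z) * Var z ^ deg z"
        using vanishing_eq[OF z] by (simp add: lessThan_Suc_atMost[symmetric])
      from arg_cong[OF this, of "(*) y"]
      have "y * vanishing z = (\<Sum>i<deg z. ?a i * (Var z ^ i * y)) + ?a (deg z) * (Var z ^ deg z * y)"
        by (simp only: distrib_left sum_distrib_left mult_ac)
      moreover have "Var z ^ deg z * y = Var z * g" unfolding g' d by (simp add: mult.assoc)
      ultimately show ?thesis by simp
    qed
    also have "\<dots> = y * vanishing z + (\<Sum>i<deg z. (- ?a i) * (Var z ^ i * y))"
      by (simp add: sum_negf)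
    finally have "?a (deg z) * (Var z * g) = y * vanishing z + (\<Sum>i<deg z. (- ?a i) * (Var z ^ i * y))" .
    also have "\<dots> \<in> reach G0 (Suc 0)"
    proof (rule reach_add)
      show "y * vanishing z \<in> reach G0 (Suc 0)"
        unfolding y_def by (rule reach_locpow, rule ideal_inD(4)[OF locpow_ideal zmon_S vanishing(1)[OF z]])
      show "(\<Sum>i<deg z. (- ?a i) * (Var z ^ i * y)) \<in> reach G0 (Suc 0)"
        using vanishing_coeff[OF z] by (intro reach_sum reach_scale gen) auto
    qed
    finally have lead: "?a (deg z) * (Var z * g) \<in> reach G0 (Suc 0)" .
    have "Var z * g \<in> S" using G0(2) g z ZV by (intro subdomD(4)[OF S]) auto
    then show ?thesis by (rule reach_cancel[OF _ vanishing_lead[OF z] lead])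
  qed
qed

text \<open>The span is stable under multiplication by every variable, hence by every polynomial,
  and it contains 1.\<close>

lemma reach_all: assumes "f \<in> S" shows "f \<in> reach G0 (Suc 0)"
proof -
  have "\<forall>g\<in>reach G0 (Suc 0). f * g \<in> reach G0 (Suc 0)"
    using assms
  proof (induction rule: polys_induct)
    case (Cst c)
    then show ?case by (simp add: reach_scale)
  next
    case (Var v)
    show ?case
    proof (cases "v \<in> A")
      case True then show ?thesis by (simp add: reach_scale)
    next
      case False
      then have v: "v \<in> Z" using Var by (simp add: Z_def)
      show ?thesis
      proof (intro ballI, rule reach_mult[where G = G0 and j = "Suc 0"])
        show "Var v * b \<in> locpow (Suc 0)" if "b \<in> locpow (Suc 0)" for b
          using ideal_inD(4)[OF locpow_ideal _ that] Var by simp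
      qed (use Var Var_G0[OF v] in auto)
    qed
  next
    case (add f g)
    then show ?case by (simp add: distrib_right reach_add)
  next
    case (mult f g)
    then show ?case by (simp add: mult.assoc)
  qed
  moreover have "1 \<in> reach G0 (Suc 0)" by (rule reach_gen[OF one_G0 G0])
  ultimately show ?thesis by fastforce
qed

text \<open>After clearing denominators, the coefficients on \<open>G\<close> form a linear system
  over \<open>polys A\<close> with more unknowns than equations. A solution kills the parts in
  \<open>G\<close> and leaves only the errors from \<open>locpow j\<close>.\<close>

lemma reach_relation:
  assumes "finite B" "finite G" "card G < card B" "\<And>i. i \<in> B \<Longrightarrow> x i \<in> reach G j"
  shows "\<exists>e. (\<forall>i\<in>B. e i \<in> polys A) \<and> (\<exists>i\<in>B. e i \<noteq> 0) \<and> (\<Sum>i\<in>B. e i * x i) \<in> locpow j"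
proof -
  have "\<forall>i\<in>B. \<exists>c a b. c \<in> KA \<and> (\<forall>g\<in>G. a g \<in> polys A) \<and> b \<in> locpow j \<and> c * x i = (\<Sum>g\<in>G. a g * g) + b"
    using assms(4) unfolding reach_def by blast
  from bchoice[OF this] obtain c where "\<forall>i\<in>B. \<exists>a b. c i \<in> KA \<and> (\<forall>g\<in>G. a g \<in> polys A) \<and>
    b \<in> locpow j \<and> c i * x i = (\<Sum>g\<in>G. a g * g) + b" by (rule exE)
  from bchoice[OF this] obtain a where "\<forall>i\<in>B. \<exists>b. c i \<in> KA \<and> (\<forall>g\<in>G. a i g \<in> polys A) \<and>
    b \<in> locpow j \<and> c i * x i = (\<Sum>g\<in>G. a i g * g) + b" by (rule exE)
  from bchoice[OF this] obtain b where "\<forall>i\<in>B. c i \<in> KA \<and> (\<forall>g\<in>G. a i g \<in> polys A) \<and>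
    b i \<in> locpow j \<and> c i * x i = (\<Sum>g\<in>G. a i g * g) + b i" by (rule exE)
  then have cab: "\<And>i. i \<in> B \<Longrightarrow> c i \<in> KA" "\<And>i g. i \<in> B \<Longrightarrow> g \<in> G \<Longrightarrow> a i g \<in> polys A"
    "\<And>i. i \<in> B \<Longrightarrow> b i \<in> locpow j" "\<And>i. i \<in> B \<Longrightarrow> c i * x i = (\<Sum>g\<in>G. a i g * g) + b i"
    by simp_all
  have "\<exists>d. (\<forall>i\<in>B. d i \<in> polys A) \<and> (\<exists>i\<in>B. d i \<noteq> 0) \<and> (\<forall>g\<in>G. (\<Sum>i\<in>B. d i * a i g) = 0)"
    by (rule underdetermined_system[OF subdom_polys assms(2,1,3)]) (rule cab(2))
  then obtain d where d: "\<And>i. i \<in> B \<Longrightarrow> d i \<in> polys A" "\<exists>i\<in>B. d i \<noteq> 0"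
    "\<And>g. g \<in> G \<Longrightarrow> (\<Sum>i\<in>B. d i * a i g) = 0" by blast
  have "(\<Sum>i\<in>B. (d i * c i) * x i) = (\<Sum>i\<in>B. (\<Sum>g\<in>G. d i * a i g * g) + d i * b i)"
    by (intro sum.cong) (auto simp: cab(4) mult.assoc distrib_left sum_distrib_left)
  also have "\<dots> = (\<Sum>g\<in>G. (\<Sum>i\<in>B. d i * a i g) * g) + (\<Sum>i\<in>B. d i * b i)"
    unfolding sum.distrib sum_distrib_right by (subst sum.swap) simp
  also have "\<dots> = (\<Sum>i\<in>B. d i * b i)" using d(3) by simp
  also have "\<dots> \<in> locpow j"
    using d(1) cab(3) AS by (intro ideal_in_sum[OF locpow_ideal] ideal_inD(4)[OF locpow_ideal]) auto
  finally have "(\<Sum>i\<in>B. (d i * c i) * x i) \<in> locpow j" .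
  moreover have "\<forall>i\<in>B. d i * c i \<in> polys A" "\<exists>i\<in>B. d i * c i \<noteq> 0" using cab(1) d(1,2) by auto
  ultimately show ?thesis by (intro exI[of _ "\<lambda>i. d i * c i"] conjI)
qed

text \<open>The powers of \<open>s\<close> satisfy a relation over \<open>polys A\<close>. Since
  \<open>s\<close> is outside \<open>P\<close>, the lowest power cancels, and the remaining constant
  term in \<open>KA\<close> is a multiple of \<open>s\<close> modulo
  \<open>locpow (Suc 0)\<close>.\<close>

lemma unit_inverse:
  assumes s: "s \<in> S - P" shows "\<exists>r\<in>S. \<exists>c\<in>KA. c - s * r \<in> locpow (Suc 0)"
proof -
  \<comment> \<open>One power of \<open>s\<close> more than the size of the spanning set.\<close>
  let ?B = "{..card G0} :: nat set"
  have "\<exists>e. (\<forall>i\<in>?B. e i \<in> polys A) \<and> (\<exists>i\<in>?B. e i \<noteq> 0) \<and> (\<Sum>i\<in>?B. e i * s ^ i) \<in> locpow (Suc 0)"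
    using s by (intro reach_relation[OF _ G0(1)] reach_all) (auto intro: subdom_power[OF S])
  then obtain e where e: "\<And>i. i \<in> ?B \<Longrightarrow> e i \<in> polys A" "\<exists>i\<in>?B. e i \<noteq> 0"
    "(\<Sum>i\<in>?B. e i * s ^ i) \<in> locpow (Suc 0)" by blast
  define i where "i = (LEAST i. i \<in> ?B \<and> e i \<noteq> 0)"
  have i: "i \<in> ?B" "e i \<noteq> 0" using LeastI_ex[of "\<lambda>i. i \<in> ?B \<and> e i \<noteq> 0"] e(2) by (auto simp: i_def)
  have least: "e k = 0" if "k < i" for k
    using not_less_Least[of k "\<lambda>i. i \<in> ?B \<and> e i \<noteq> 0"] that i(1) by (auto simp: i_def)
  define r where "r = (\<Sum>k\<in>{i<..card G0}. s ^ (k - i - 1) * e k)"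
  have rS: "r \<in> S"
    unfolding r_def using s e(1) AS by (intro subdom_sum[OF S] subdomD(4)[OF S] subdom_power[OF S]) auto
  have 1: "s ^ i * (e i + s * r) \<in> locpow (Suc 0)"
    using e(3) sum_split_least[of i e "card G0" s] least i(1) by (simp add: r_def mult.commute)
  have 2: "s ^ i \<in> S - P" using s prime_in_power[OF S P, of s i] by (auto intro: subdom_power[OF S])
  have 3: "e i + s * r \<in> S" using s rS AS[OF e(1)[OF i(1)]] by (intro subdomD(3,4)[OF S]) auto
  have "e i + s * r \<in> locpow (Suc 0)" by (rule locpow_cancel[OF 2 3 1])
  then have "e i - s * (- r) \<in> locpow (Suc 0)" by simp
  then show ?thesis using rS e(1) i by (intro bexI[of _ "- r"] bexI[of _ "e i"]) auto
qed

text \<open>A denominator \<open>s\<close> outside \<open>P\<close> is traded for one in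
  \<open>polys A\<close>: with \<open>w = c - s * r\<close>, the powers \<open>c ^ j\<close> and
  \<open>w ^ j\<close> agree modulo \<open>s\<close>, and \<open>w ^ j * g\<close> has order
  \<open>Suc j\<close>. The error can thus be pushed into any prescribed power.\<close>

lemma locpow_1_split:
  assumes g: "g \<in> locpow (Suc 0)"
  shows "\<exists>c\<in>KA. \<exists>x\<in>J. \<exists>b\<in>locpow (Suc j). c * g = x + b"
proof -
  obtain s where s: "s \<in> S - P" "s * g \<in> J" using g unfolding locpow_1_iff by blast
  obtain r c where r: "r \<in> S" "c \<in> KA" "c - s * r \<in> locpow (Suc 0)" using unit_inverse[OF s(1)] by blast
  define w where "w = c - s * r"
  have "\<exists>t\<in>S. c ^ j = s * t + w ^ j"
  proof (induction j)
    case 0 then show ?case by (auto intro!: bexI[of _ 0])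
  next
    case (Suc j)
    then obtain t where t: "t \<in> S" "c ^ j = s * t + w ^ j" by blast
    have c: "c \<in> S" using r(2) AS by blast
    have "c ^ Suc j = s * (c * t + r * w ^ j) + w ^ Suc j"
      unfolding power_Suc t(2) by (simp add: w_def algebra_simps)
    moreover have "c * t + r * w ^ j \<in> S"
      using c t r s by (intro subdomD(3,4)[OF S] subdom_power[OF S]) (auto simp: w_def)
    ultimately show ?case by blast
  qed
  then obtain t where t: "t \<in> S" "c ^ j = s * t + w ^ j" by blast
  have "w ^ j * g \<in> locpow (Suc j)" for j
    by (induction j) (use g r(3) locpow_mult in \<open>auto simp: w_def mult.assoc\<close>)
  moreover have "c ^ j * g = t * (s * g) + w ^ j * g" by (simp add: t(2) algebra_simps)
  moreover have "t * (s * g) \<in> J" by (rule ideal_inD(4)[OF J t(1) s(2)])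
  moreover have "c ^ j \<in> KA" using r(2) subdom_power[OF subdom_polys] by auto
  ultimately show ?thesis by blast
qed

text \<open>The analogue of \<open>G0\<close> for the \<open>j\<close>-th power, with monomials in
  \<open>F\<close> as additional factors. Bounding each exponent by \<open>j\<close>, rather than
  the total degree, keeps the count simple.\<close>

definition "Gen j = (\<lambda>(x, \<gamma>). x * (\<Prod>f\<in>F. f ^ \<gamma> f)) ` (G0 \<times> (\<Pi>\<^sub>E f\<in>F. {..<j}))"

lemma Gen: "finite (Gen j)" "Gen j \<subseteq> S" "card (Gen j) \<le> card G0 * j ^ card F"
proof -
  have fin: "finite (G0 \<times> (\<Pi>\<^sub>E f\<in>F. {..<j}))" using G0 F by (auto intro!: finite_PiE)
  then show "finite (Gen j)" unfolding Gen_def by (rule finite_imageI)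
  show "Gen j \<subseteq> S"
    unfolding Gen_def using G0 FS by (auto intro!: subdomD(4)[OF S] subdom_prod[OF S] subdom_power[OF S])
  have "card (Gen j) \<le> card (G0 \<times> (\<Pi>\<^sub>E f\<in>F. {..<j}))" unfolding Gen_def by (rule card_image_le[OF fin])
  also have "\<dots> = card G0 * j ^ card F" using F by (simp add: card_cartesian_product card_PiE)
  finally show "card (Gen j) \<le> card G0 * j ^ card F" .
qed

lemma GenI: "x \<in> G0 \<Longrightarrow> (\<And>f. f \<in> F \<Longrightarrow> \<gamma> f < j) \<Longrightarrow> x * (\<Prod>f\<in>F. f ^ \<gamma> f) \<in> Gen j"
  unfolding Gen_def by (intro image_eqI[of _ _ "(x, restrict \<gamma> F)"]) auto

lemma G0_Gen: "G0 \<subseteq> Gen (Suc j)"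
  using GenI[of _ "\<lambda>_. 0"] by auto

lemma mult_Gen: assumes "f \<in> F" "g \<in> Gen j" shows "f * g \<in> Gen (Suc j)"
proof -
  obtain x \<gamma> where g: "g = x * (\<Prod>f\<in>F. f ^ \<gamma> f)" "x \<in> G0" "\<And>f. f \<in> F \<Longrightarrow> \<gamma> f < j"
    using assms(2) by (auto simp: Gen_def PiE_iff)
  have "f * g = x * (\<Prod>h\<in>F. h ^ (\<gamma>(f := Suc (\<gamma> f))) h)"
    using F(1) assms(1) by (simp add: g(1) prod.remove[of F f] mult_ac)
  also have "\<dots> \<in> Gen (Suc j)"
  proof (rule GenI[OF g(2)])
    show "(\<gamma>(f := Suc (\<gamma> f))) h < Suc j" if "h \<in> F" for h using g(3)[OF that] g(3)[OF assms(1)] by simp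
  qed
  finally show ?thesis .
qed

text \<open>Modulo the span of \<open>G0\<close>, \<open>f\<close> is an element of order one, which
  up to a denominator and an error of order \<open>Suc j\<close> is a combination of the elements of
  \<open>F\<close>. Its coefficients are spanned by \<open>Gen j\<close>, and a factor from
  \<open>F\<close> moves \<open>Gen j\<close> into \<open>Gen (Suc j)\<close>.\<close>

lemma reach_Gen: "f \<in> S \<Longrightarrow> f \<in> reach (Gen j) j"
proof (induction j arbitrary: f)
  case 0
  then show ?case by (simp add: reach_locpow locpow_0)
next
  case (Suc j)
  from reach_all[OF Suc.prems] obtain c a g where 1: "c \<in> KA" "\<And>x. x \<in> G0 \<Longrightarrow> a x \<in> polys A" "g \<in> locpow (Suc 0)"
    "c * f = (\<Sum>x\<in>G0. a x * x) + g" by (rule reachE) blast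
  from locpow_1_split[OF 1(3), of j] obtain c' x b where 2: "c' \<in> KA" "x \<in> J" "b \<in> locpow (Suc j)" "c' * g = x + b"
    by blast
  from gen_in_finite[OF S F(1) FS 2(2)[unfolded J_def]] obtain r where r: "\<And>h. h \<in> F \<Longrightarrow> r h \<in> S" "x = (\<Sum>h\<in>F. r h * h)"
    by blast
  have "h * r h \<in> reach (Gen (Suc j)) (Suc j)" if h: "h \<in> F" for h
  proof (rule reach_mult[OF _ _ _ Suc.IH[OF r(1)[OF h]]])
    show "h \<in> S" using h FS by blast
    show "h * g \<in> reach (Gen (Suc j)) (Suc j)" if "g \<in> Gen j" for g
      by (rule reach_gen[OF mult_Gen[OF h that] Gen(1,2)])
    show "h * b \<in> locpow (Suc j)" if "b \<in> locpow j" for b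
      using locpow_mult[OF _ that] J_locpow FJ h by blast
  qed
  then have "x \<in> reach (Gen (Suc j)) (Suc j)" unfolding r(2) by (intro reach_sum) (simp add: mult.commute)
  then have "c' * g \<in> reach (Gen (Suc j)) (Suc j)" unfolding 2(4) by (rule reach_add[OF _ reach_locpow[OF 2(3)]])
  then have "g \<in> reach (Gen (Suc j)) (Suc j)" using reach_cancel[OF locpow_S[OF 1(3)] 2(1)] by blast
  moreover have "(\<Sum>x\<in>G0. a x * x) \<in> reach (Gen (Suc j)) (Suc j)"
    using 1(2) G0_Gen Gen by (intro reach_sum reach_scale reach_gen) auto
  ultimately have "c * f \<in> reach (Gen (Suc j)) (Suc j)" unfolding 1(4) by (intro reach_add)
  then show ?case by (rule reach_cancel[OF Suc.prems 1(1)])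
qed

section \<open>Counting monomials against generators\<close>

lemma zmon_conv: "zmon \<beta> = Poly_Mapping.single (\<Sum>z\<in>Z. Poly_Mapping.single z (\<beta> z)) 1"
  unfolding zmon_def by (rule prod_Var[OF finZ])

lemma zexp_lookup: "Poly_Mapping.lookup (\<Sum>z\<in>Z. Poly_Mapping.single z (\<beta> z)) v = (if v \<in> Z then \<beta> v else (0::nat))"
  using finZ by (simp add: lookup_sum lookup_single when_def)

lemma keys_polys_A: "e \<in> polys A \<Longrightarrow> m \<in> Poly_Mapping.keys e \<Longrightarrow> z \<in> Z \<Longrightarrow> Poly_Mapping.lookup m z = 0"
proof -
  assume "e \<in> polys A" "m \<in> Poly_Mapping.keys e" "z \<in> Z"
  then have "z \<notin> Poly_Mapping.keys m" using AZ by (auto simp: polys_def)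
  then show ?thesis by (simp add: in_keys_iff)
qed

text \<open>The coefficients do not involve \<open>Z\<close>, so the \<open>Z\<close>-part of a
  monomial tells which summand it comes from; extensionality makes different \<open>\<beta>\<close>
  differ on \<open>Z\<close>.\<close>

lemma zmon_independent:
  assumes B: "finite B" "B \<subseteq> extensional Z" and e: "\<And>\<beta>. \<beta> \<in> B \<Longrightarrow> e \<beta> \<in> polys A"
    and zero: "(\<Sum>\<beta>\<in>B. e \<beta> * zmon \<beta>) = 0" and b: "\<beta> \<in> B"
  shows "e \<beta> = 0"
proof (rule ccontr)
  assume "e \<beta> \<noteq> 0"
  then obtain a where a: "a \<in> Poly_Mapping.keys (e \<beta>)" by fastforce
  let ?\<mu> = "\<lambda>\<beta>. \<Sum>z\<in>Z. Poly_Mapping.single z (\<beta> z)"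
  have "Poly_Mapping.lookup (e \<beta>' * zmon \<beta>') (a + ?\<mu> \<beta>) = 0" if b': "\<beta>' \<in> B" "\<beta>' \<noteq> \<beta>" for \<beta>'
  proof (rule ccontr)
    assume "\<not> ?thesis"
    then have "a + ?\<mu> \<beta> \<in> Poly_Mapping.keys (e \<beta>' * zmon \<beta>')" by (simp add: in_keys_iff)
    then obtain a' where a': "a' \<in> Poly_Mapping.keys (e \<beta>')" "a + ?\<mu> \<beta> = a' + ?\<mu> \<beta>'"
      using keys_mult[of "e \<beta>'" "zmon \<beta>'"] unfolding zmon_conv by auto
    have "\<beta> z = \<beta>' z" for z
    proof (cases "z \<in> Z")
      case True
      then show ?thesis
        using arg_cong[OF a'(2), of "\<lambda>m. Poly_Mapping.lookup m z"] keys_polys_A[OF e[OF b] a]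
          keys_polys_A[OF e[OF b'(1)] a'(1)] by (simp add: lookup_add zexp_lookup)
    next
      case False
      then show ?thesis using B(2) b b'(1) by (metis extensional_arb subset_iff)
    qed
    then show False using b'(2) by auto
  qed
  then have "Poly_Mapping.lookup (\<Sum>\<beta>\<in>B. e \<beta> * zmon \<beta>) (a + ?\<mu> \<beta>) = Poly_Mapping.lookup (e \<beta> * zmon \<beta>) (a + ?\<mu> \<beta>)"
    unfolding lookup_sum using B(1) b by (subst sum.remove[of B \<beta>]) auto
  also have "\<dots> = Poly_Mapping.lookup (e \<beta>) a" unfolding zmon_conv by (simp add: lookup_mult_single_shift)
  finally show False using zero a by (simp add: in_keys_iff)
qed

lemma card_Z_le: "card Z \<le> card F"
proof (rule growth_exponent_le)
  fix q
  \<comment> \<open>\<open>?j\<close> is the least order to which \<open>order_bound\<close> applies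
    when exponents go up to \<open>q\<close>.\<close>
  let ?B = "\<Pi>\<^sub>E z\<in>Z. {..q}" and ?j = "card Z * q + 1"
  have B: "finite ?B" "card ?B = (q + 1) ^ card Z" "?B \<subseteq> extensional Z"
    using finZ by (simp_all add: card_PiE finite_PiE) (auto simp: PiE_def)
  show "(q + 1) ^ card Z \<le> card G0 * (card Z * q + 1) ^ card F"
  proof (rule ccontr)
    assume "\<not> ?thesis"
    then have "card (Gen ?j) < card ?B" using Gen(3)[of ?j] B(2) by simp
    then have "\<exists>e. (\<forall>i\<in>?B. e i \<in> polys A) \<and> (\<exists>i\<in>?B. e i \<noteq> 0) \<and> (\<Sum>i\<in>?B. e i * zmon i) \<in> locpow ?j"
      by (rule reach_relation[OF B(1) Gen(1) _ reach_Gen[OF zmon_S]])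
    then obtain e where e: "\<And>i. i \<in> ?B \<Longrightarrow> e i \<in> polys A" "\<exists>i\<in>?B. e i \<noteq> 0" "(\<Sum>i\<in>?B. e i * zmon i) \<in> locpow ?j"
      by blast
    have "e i * zmon i \<in> degree_bounded Z q" if i: "i \<in> ?B" for i
      unfolding degree_bounded_def
    proof (intro CollectI ballI)
      fix m v assume m: "m \<in> Poly_Mapping.keys (e i * zmon i)" and v: "v \<in> Z"
      then obtain a where "a \<in> Poly_Mapping.keys (e i)" "m = a + (\<Sum>z\<in>Z. Poly_Mapping.single z (i z))"
        using keys_mult[of "e i" "zmon i"] unfolding zmon_conv by auto
      then show "Poly_Mapping.lookup m v \<le> q"
        using keys_polys_A[OF e(1)[OF i]] v i by (auto simp: lookup_add zexp_lookup PiE_iff)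
    qed
    then have db: "(\<Sum>i\<in>?B. e i * zmon i) \<in> degree_bounded Z q" by (rule degree_bounded_sum)
    have "(\<Sum>i\<in>?B. e i * zmon i) = 0"
    proof (rule order_bound[OF finZ ZV _ db e(3)])
      show "(\<Sum>i\<in>?B. e i * zmon i) \<in> polys (A \<union> Z)"
        using locpow_S[OF e(3)] by (subst VZ[symmetric])
      show "q * card Z < card Z * q + 1" by (subst mult.commute) simp
    qed
    then have "e i = 0" if "i \<in> ?B" for i using zmon_independent[of ?B e i] B(1,3) e(1) that by blast
    then show False using e(2) by blast
  qed
qed

end

text \<open>\<open>F\<close> has to generate \<open>I\<close> only after localizing at
  \<open>P\<close>. Minimality of \<open>P\<close> enters as nilpotence: every \<open>h\<close> in
  \<open>P\<close> has some \<open>s * h ^ N\<close> in \<open>I\<close> with \<open>s\<close>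
  outside \<open>P\<close>.\<close>

theorem krull_height:
  fixes P I F :: "('v::linorder, 'k::field) mpoly set"
  assumes V: "finite V" and P: "prime_in (polys V) P" and I: "ideal_in (polys V) I" "I \<subseteq> P"
    and min: "\<And>Q. prime_in (polys V) Q \<Longrightarrow> I \<subseteq> Q \<Longrightarrow> Q \<subseteq> P \<Longrightarrow> Q = P"
    and F: "finite F" "F \<subseteq> I" "\<And>g. g \<in> I \<Longrightarrow> \<exists>s\<in>polys V - P. s * g \<in> gen_in (polys V) F"
  shows "prime_height (ring_of (polys V)) P \<le> enat (card F)"
proof -
  note S = subdom_polys[of V]
  have nilp: "\<exists>s\<in>polys V - P. \<exists>N. s * h ^ N \<in> gen_in (polys V) F" if h: "h \<in> P" for h
  proof -
    have hS: "h \<in> polys V" using ideal_inD(1)[OF prime_inD(1)[OF P] h] .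
    \<comment> \<open>If \<open>I\<close> missed this multiplicative set, a prime over
      \<open>I\<close> avoiding it would be contained in \<open>P\<close> but not contain
      \<open>h\<close>, against minimality.\<close>
    let ?M = "{s * h ^ N | s N. s \<in> polys V - P}"
    have unit: "s * t \<in> polys V - P" if "s \<in> polys V - P" "t \<in> polys V - P" for s t
      using that prime_inD(3)[OF P] by auto
    have memM: "s * h ^ N \<in> ?M" if "s \<in> polys V - P" for s N using that by blast
    have 1: "1 \<in> polys V - P" using prime_inD(2)[OF P] by simp
    have "I \<inter> ?M \<noteq> {}"
    proof
      assume "I \<inter> ?M = {}"
      moreover have "?M \<subseteq> polys V" using hS by (auto intro!: subdomD(4)[OF S] subdom_power[OF S])
      moreover have "1 \<in> ?M" using memM[OF 1, of 0] by simp
      moreover have "a * b \<in> ?M" if "a \<in> ?M" "b \<in> ?M" for a b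
      proof -
        obtain s N where "a = s * h ^ N" "s \<in> polys V - P" using \<open>a \<in> ?M\<close> by blast
        moreover obtain t N' where "b = t * h ^ N'" "t \<in> polys V - P" using \<open>b \<in> ?M\<close> by blast
        ultimately
        show ?thesis using memM[OF unit[of s t], of "N + N'"] by (simp add: power_add mult_ac)
      qed
      ultimately obtain Q where Q: "prime_in (polys V) Q" "I \<subseteq> Q" "Q \<inter> ?M = {}"
        using prime_ideal_avoiding[OF S I(1), of ?M] by blast
      have "Q \<subseteq> P"
      proof
        fix s assume s: "s \<in> Q"
        show "s \<in> P"
        proof (rule ccontr)
          assume "s \<notin> P"
          then have "s * h ^ 0 \<in> ?M" using memM ideal_inD(1)[OF prime_inD(1)[OF Q(1)] s] by blast
          then show False using s Q(3) by auto
        qed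
      qed
      then have "Q = P" using min Q by blast
      then show False using memM[OF 1, of 1] h Q(3) by auto
    qed
    then obtain s N where s: "s \<in> polys V - P" "s * h ^ N \<in> I" by blast
    obtain t where "t \<in> polys V - P" "t * (s * h ^ N) \<in> gen_in (polys V) F" using F(3)[OF s(2)] by blast
    then show ?thesis using unit[of t s] s(1) by (metis mult.assoc)
  qed
  obtain A where A: "A \<subseteq> V" "P \<inter> polys A \<subseteq> {0}" "\<And>z. z \<in> V - A \<Longrightarrow> \<not> P \<inter> polys (insert z A) \<subseteq> {0}"
    "prime_height (ring_of (polys V)) P = enat (card V - card A)"
    using prime_height_eq[OF V P] by blast
  interpret krull_setup V A P F
    by unfold_locales (use V P A F I nilp in auto)
  have "card Z = card V - card A"
    unfolding Z_def using A(1) V by (intro card_Diff_subset) (auto intro: finite_subset)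
  then show ?thesis using card_Z_le A(4) by simp
qed

section \<open>Localization of a subring of a domain at a prime\<close>

locale prime_localization =
  fixes S P :: "'a::idom set"
  assumes S: "subdom S" and P: "prime_in S P"
begin

abbreviation "M \<equiv> S - P"
abbreviation "L \<equiv> local_ring_at (ring_of S) P"
abbreviation "fr \<equiv> fraction (ring_of S) M"
abbreviation "ext I \<equiv> local_ideal_at (ring_of S) P I"

lemma IP: "ideal_in S P" by (rule prime_inD(1)[OF P])

lemma M_props: "1 \<in> M" "0 \<notin> M" "s \<in> M \<Longrightarrow> t \<in> M \<Longrightarrow> s * t \<in> M" "s \<in> M \<Longrightarrow> s \<in> S" "s \<in> M \<Longrightarrow> s \<noteq> 0"
  using prime_inD(2,3)[OF P] ideal_inD(2)[OF IP] subdomD[OF S] by auto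

text \<open>In a domain the factor \<open>w\<close> of \<open>loc_rel\<close> cancels, so a class is
  described by cross multiplication alone.\<close>

lemma frac_alt: "a \<in> S \<Longrightarrow> s \<in> M \<Longrightarrow> fr a s = {(b, t). b \<in> S \<and> t \<in> M \<and> a * t = b * s}"
proof -
  assume a: "a \<in> S" "s \<in> M"
  have "(\<exists>w\<in>M. w * (a * t - b * s) = 0) \<longleftrightarrow> a * t = b * s" if "b \<in> S" "t \<in> M" for b t
    using M_props(1,5) by (metis eq_iff_diff_eq_0 mult_eq_0_iff mult_zero_right)
  moreover have "a_minus (ring_of S) x y = x - y" if "x \<in> S" "y \<in> S" for x y
    using that by (simp add: a_minus_def ring_of_a_inv[OF S])
  ultimately show ?thesis
    using a subdomD(4)[OF S] M_props(4) unfolding fraction_def loc_rel_def by (auto simp: Image_def)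
qed

lemma frac_eq: "a \<in> S \<Longrightarrow> b \<in> S \<Longrightarrow> s \<in> M \<Longrightarrow> t \<in> M \<Longrightarrow> fr a s = fr b t \<longleftrightarrow> a * t = b * s"
proof
  assume a: "a \<in> S" "b \<in> S" "s \<in> M" "t \<in> M"
  { assume "fr a s = fr b t"
    moreover have "(b, t) \<in> fr b t" using a by (simp add: frac_alt)
    ultimately have "(b, t) \<in> fr a s" by simp
    then show "a * t = b * s" using a by (simp add: frac_alt) }
  assume e: "a * t = b * s"
  have "a * r = c * s \<longleftrightarrow> b * r = c * t" if "r \<in> M" for c r
  proof -
    have "t * (a * r - c * s) = s * (b * r - c * t)"
      using e by (simp add: algebra_simps)
    then show ?thesis using M_props(5) a(3,4) by (metis eq_iff_diff_eq_0 mult_eq_0_iff)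
  qed
  then show "fr a s = fr b t" using a by (auto simp: frac_alt)
qed

lemma carrier_L: "carrier L = {fr a s | a s. a \<in> S \<and> s \<in> M}"
  unfolding local_ring_at_def localization_def fraction_def by (auto simp: quotient_def)

lemma carrier_cases: assumes "x \<in> carrier L" obtains a s where "a \<in> S" "s \<in> M" "x = fr a s"
  using assms unfolding carrier_L by blast

lemma frac_carrier [simp]: "a \<in> S \<Longrightarrow> s \<in> M \<Longrightarrow> fr a s \<in> carrier L"
  unfolding carrier_L by blast

lemma mult_frac:
  assumes "a \<in> S" "b \<in> S" "s \<in> M" "t \<in> M" shows "fr a s \<otimes>\<^bsub>L\<^esub> fr b t = fr (a * b) (s * t)"
proof -
  have "fr (a' * b') (s' * t') = fr (a * b) (s * t)"
    if "(a', s') \<in> fr a s" "(b', t') \<in> fr b t" for a' s' b' t'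
  proof -
    have 1: "a' \<in> S" "s' \<in> M" "a * s' = a' * s" "b' \<in> S" "t' \<in> M" "b * t' = b' * t"
      using that assms by (auto simp: frac_alt)
    have "(a' * b') * (s * t) = (a * s') * (b * t')" unfolding 1(3,6) by (simp add: mult_ac)
    then have "(a' * b') * (s * t) = (a * b) * (s' * t')" by (simp add: mult_ac)
    then show ?thesis using 1 assms M_props(3) by (subst frac_eq) (auto intro: subdomD(4)[OF S])
  qed
  moreover have "(a, s) \<in> fr a s" "(b, t) \<in> fr b t" using assms by (auto simp: frac_alt)
  ultimately have "(\<Union>(a', s')\<in>fr a s. \<Union>(b', t')\<in>fr b t. fr (a' * b') (s' * t')) = fr (a * b) (s * t)"
    by blast
  then show ?thesis unfolding local_ring_at_def localization_def by simp
qed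

lemma add_frac:
  assumes "a \<in> S" "b \<in> S" "s \<in> M" "t \<in> M" shows "fr a s \<oplus>\<^bsub>L\<^esub> fr b t = fr (a * t + b * s) (s * t)"
proof -
  have "fr (a' * t' + b' * s') (s' * t') = fr (a * t + b * s) (s * t)"
    if "(a', s') \<in> fr a s" "(b', t') \<in> fr b t" for a' s' b' t'
  proof -
    have 1: "a' \<in> S" "s' \<in> M" "a * s' = a' * s" "b' \<in> S" "t' \<in> M" "b * t' = b' * t"
      using that assms by (auto simp: frac_alt)
    have "(a' * t' + b' * s') * (s * t) = (a' * s) * (t * t') + (b' * t) * (s * s')" by (simp add: algebra_simps)
    also have "\<dots> = (a * t + b * s) * (s' * t')" unfolding 1(3,6)[symmetric] by (simp add: algebra_simps)
    finally show ?thesis using 1 assms M_props(3,4) by (subst frac_eq) (auto intro!: subdomD(3,4)[OF S])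
  qed
  moreover have "(a, s) \<in> fr a s" "(b, t) \<in> fr b t" using assms by (auto simp: frac_alt)
  ultimately have "(\<Union>(a', s')\<in>fr a s. \<Union>(b', t')\<in>fr b t. fr (a' * t' + b' * s') (s' * t')) =
      fr (a * t + b * s) (s * t)"
    by blast
  then show ?thesis unfolding local_ring_at_def localization_def by simp
qed

lemma one_L: "\<one>\<^bsub>L\<^esub> = fr 1 1" and zero_L: "\<zero>\<^bsub>L\<^esub> = fr 0 1"
  unfolding local_ring_at_def localization_def by simp_all

lemma closed [simp, intro]:
  "0 \<in> S" "1 \<in> S" "1 \<in> M" "a \<in> S \<Longrightarrow> b \<in> S \<Longrightarrow> a + b \<in> S" "a \<in> S \<Longrightarrow> b \<in> S \<Longrightarrow> a * b \<in> S"
  "a \<in> S \<Longrightarrow> - a \<in> S" "s \<in> M \<Longrightarrow> t \<in> M \<Longrightarrow> s * t \<in> M"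
  by (fact subdomD(1-5)[OF S] M_props(1,3))+

lemma M_S: "s \<in> M \<Longrightarrow> s \<in> S" by simp

lemmas frac_simps = mult_frac add_frac one_L zero_L frac_eq M_S

lemma cring_L: "cring L"
proof (rule cringI)
  show "abelian_group L"
  proof (rule abelian_groupI)
    fix x y assume "x \<in> carrier L" "y \<in> carrier L"
    then obtain a s b t where "a \<in> S" "s \<in> M" "x = fr a s" "b \<in> S" "t \<in> M" "y = fr b t"
      by (metis carrier_cases)
    then show "x \<oplus>\<^bsub>L\<^esub> y \<in> carrier L" "x \<oplus>\<^bsub>L\<^esub> y = y \<oplus>\<^bsub>L\<^esub> x"
      by (simp_all add: frac_simps algebra_simps del: DiffE Diff_iff)
  next
    fix x y z assume "x \<in> carrier L" "y \<in> carrier L" "z \<in> carrier L"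
    then obtain a s b t c r where "a \<in> S" "s \<in> M" "x = fr a s" "b \<in> S" "t \<in> M" "y = fr b t"
      "c \<in> S" "r \<in> M" "z = fr c r"
      by (metis carrier_cases)
    then show "x \<oplus>\<^bsub>L\<^esub> y \<oplus>\<^bsub>L\<^esub> z = x \<oplus>\<^bsub>L\<^esub> (y \<oplus>\<^bsub>L\<^esub> z)"
      by (simp add: frac_simps algebra_simps del: Diff_iff)
  next
    show "\<zero>\<^bsub>L\<^esub> \<in> carrier L" by (simp add: zero_L del: Diff_iff)
    fix x assume "x \<in> carrier L"
    then obtain a s where x: "a \<in> S" "s \<in> M" "x = fr a s" by (metis carrier_cases)
    then show "\<zero>\<^bsub>L\<^esub> \<oplus>\<^bsub>L\<^esub> x = x" by (simp add: frac_simps del: Diff_iff)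
    have "fr (- a) s \<oplus>\<^bsub>L\<^esub> x = \<zero>\<^bsub>L\<^esub>" using x by (simp add: frac_simps del: Diff_iff)
    moreover have "fr (- a) s \<in> carrier L" using x by (simp del: Diff_iff)
    ultimately show "\<exists>y\<in>carrier L. y \<oplus>\<^bsub>L\<^esub> x = \<zero>\<^bsub>L\<^esub>" by blast
  qed
  show "comm_monoid L"
  proof (rule comm_monoidI)
    fix x y assume "x \<in> carrier L" "y \<in> carrier L"
    then obtain a s b t where "a \<in> S" "s \<in> M" "x = fr a s" "b \<in> S" "t \<in> M" "y = fr b t"
      by (metis carrier_cases)
    then show "x \<otimes>\<^bsub>L\<^esub> y \<in> carrier L" "x \<otimes>\<^bsub>L\<^esub> y = y \<otimes>\<^bsub>L\<^esub> x"
      by (simp_all add: frac_simps mult_ac del: Diff_iff)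
  next
    fix x y z assume "x \<in> carrier L" "y \<in> carrier L" "z \<in> carrier L"
    then obtain a s b t c r where "a \<in> S" "s \<in> M" "x = fr a s" "b \<in> S" "t \<in> M" "y = fr b t"
      "c \<in> S" "r \<in> M" "z = fr c r"
      by (metis carrier_cases)
    then show "x \<otimes>\<^bsub>L\<^esub> y \<otimes>\<^bsub>L\<^esub> z = x \<otimes>\<^bsub>L\<^esub> (y \<otimes>\<^bsub>L\<^esub> z)"
      by (simp add: frac_simps mult_ac del: Diff_iff)
  next
    show "\<one>\<^bsub>L\<^esub> \<in> carrier L" by (simp add: one_L del: Diff_iff)
    fix x assume "x \<in> carrier L"
    then obtain a s where x: "a \<in> S" "s \<in> M" "x = fr a s" by (metis carrier_cases)
    then show "\<one>\<^bsub>L\<^esub> \<otimes>\<^bsub>L\<^esub> x = x" by (simp add: frac_simps del: Diff_iff)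
  qed
  fix x y z assume "x \<in> carrier L" "y \<in> carrier L" "z \<in> carrier L"
  then obtain a s b t c r where "a \<in> S" "s \<in> M" "x = fr a s" "b \<in> S" "t \<in> M" "y = fr b t"
    "c \<in> S" "r \<in> M" "z = fr c r"
    by (metis carrier_cases)
  then show "(x \<oplus>\<^bsub>L\<^esub> y) \<otimes>\<^bsub>L\<^esub> z = x \<otimes>\<^bsub>L\<^esub> z \<oplus>\<^bsub>L\<^esub> y \<otimes>\<^bsub>L\<^esub> z"
    by (simp add: frac_simps algebra_simps del: Diff_iff)
qed

interpretation L: cring L by (rule cring_L)

section \<open>Extension and contraction of ideals\<close>

lemma ext_alt: "ext I = {fr a s | a s. a \<in> I \<and> s \<in> M}"
  by (simp add: local_ideal_at_def)

lemma frac_ext: "a \<in> I \<Longrightarrow> s \<in> M \<Longrightarrow> fr a s \<in> ext I"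
  unfolding ext_alt by blast

lemma frac_uminus: "a \<in> S \<Longrightarrow> s \<in> M \<Longrightarrow> \<ominus>\<^bsub>L\<^esub> fr a s = fr (- a) s"
  by (rule L.minus_equality) (simp_all add: frac_simps del: Diff_iff)

lemma ext_ideal:
  assumes I: "ideal_in S I" shows "ideal (ext I) L"
proof (rule idealI)
  show "ring L" by (rule L.ring_axioms)
  note IS = ideal_inD(1)[OF I]
  show "subgroup (ext I) (add_monoid L)"
  proof (rule group.subgroupI)
    show "group (add_monoid L)" by (rule L.a_group)
    show "ext I \<subseteq> carrier (add_monoid L)"
    proof
      fix x assume "x \<in> ext I"
      then obtain a s where x: "a \<in> I" "s \<in> M" "x = fr a s" unfolding ext_alt by blast
      then show "x \<in> carrier (add_monoid L)" using frac_carrier[OF IS x(2)] by simp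
    qed
    show "ext I \<noteq> {}" using frac_ext[OF ideal_inD(2)[OF I] M_props(1)] by (metis empty_iff)
    fix x assume "x \<in> ext I"
    then obtain a s where x: "a \<in> I" "s \<in> M" "x = fr a s" unfolding ext_alt by blast
    then have "inv\<^bsub>add_monoid L\<^esub> x = fr (- a) s" using frac_uminus IS by (simp add: a_inv_def del: Diff_iff)
    then show "inv\<^bsub>add_monoid L\<^esub> x \<in> ext I" using x frac_ext ideal_in_uminus[OF S I] by simp
    fix y assume "y \<in> ext I"
    then obtain b t where y: "b \<in> I" "t \<in> M" "y = fr b t" unfolding ext_alt by blast
    then have "x \<oplus>\<^bsub>L\<^esub> y = fr (a * t + b * s) (s * t)" using x IS by (simp add: add_frac del: Diff_iff)
    moreover have "a * t + b * s \<in> I" using x y by (intro ideal_inD(3,5)[OF I]) auto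
    ultimately show "x \<otimes>\<^bsub>add_monoid L\<^esub> y \<in> ext I" using x y by (simp add: frac_ext del: Diff_iff)
  qed
  fix x y assume xy: "x \<in> ext I" "y \<in> carrier L"
  obtain a s where a: "a \<in> I" "s \<in> M" "x = fr a s" using xy(1) unfolding ext_alt by blast
  obtain b t where b: "b \<in> S" "t \<in> M" "y = fr b t" using carrier_cases[OF xy(2)] by blast
  show "y \<otimes>\<^bsub>L\<^esub> x \<in> ext I"
    unfolding a(3) b(3) mult_frac[OF b(1) IS[OF a(1)] b(2) a(2)]
    by (rule frac_ext[OF ideal_inD(4)[OF I b(1) a(1)] M_props(3)[OF b(2) a(2)]])
  show "x \<otimes>\<^bsub>L\<^esub> y \<in> ext I"
    unfolding a(3) b(3) mult_frac[OF IS[OF a(1)] b(1) a(2) b(2)]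
    by (rule frac_ext[OF ideal_inD(5)[OF I b(1) a(1)] M_props(3)[OF a(2) b(2)]])
qed

definition contr :: "('a \<times> 'a) set set \<Rightarrow> 'a set" where
  "contr Q = {a \<in> S. fr a 1 \<in> Q}"

text \<open>Denominators are units of the local ring, so membership of a fraction depends on its
  numerator only.\<close>

lemma contr_frac:
  assumes Q: "ideal Q L" and "a \<in> S" "s \<in> M" shows "fr a s \<in> Q \<longleftrightarrow> a \<in> contr Q"
proof
  interpret Q: ideal Q L by fact
  { assume "fr a s \<in> Q"
    then have "fr s 1 \<otimes>\<^bsub>L\<^esub> fr a s \<in> Q" using assms by (intro Q.I_l_closed) (simp_all del: Diff_iff add: M_S)
    moreover have "fr s 1 \<otimes>\<^bsub>L\<^esub> fr a s = fr a 1" using assms by (simp add: frac_simps mult_ac del: Diff_iff)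
    ultimately show "a \<in> contr Q" using assms by (simp add: contr_def) }
  assume "a \<in> contr Q"
  then have "fr 1 s \<otimes>\<^bsub>L\<^esub> fr a 1 \<in> Q"
    using assms by (intro Q.I_l_closed) (auto simp: contr_def simp del: Diff_iff)
  moreover have "fr 1 s \<otimes>\<^bsub>L\<^esub> fr a 1 = fr a s" using assms by (simp add: frac_simps del: Diff_iff)
  ultimately show "fr a s \<in> Q" by simp
qed

lemma ext_contr: assumes "ideal Q L" shows "ext (contr Q) = Q"
proof
  show "ext (contr Q) \<subseteq> Q"
    unfolding ext_alt using contr_frac[OF assms] by (auto simp: contr_def simp del: Diff_iff)
  show "Q \<subseteq> ext (contr Q)"
  proof
    fix x assume x: "x \<in> Q"
    then have "x \<in> carrier L" using ideal.Icarr[OF assms] by blast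
    then obtain a s where "a \<in> S" "s \<in> M" "x = fr a s" by (rule carrier_cases)
    then show "x \<in> ext (contr Q)" using x contr_frac[OF assms] frac_ext by blast
  qed
qed

lemma contr_ideal: assumes "ideal Q L" shows "ideal_in S (contr Q)"
proof -
  interpret Q: ideal Q L by fact
  show ?thesis unfolding ideal_in_def
  proof (intro conjI ballI)
    show "contr Q \<subseteq> S" by (auto simp: contr_def)
    show "0 \<in> contr Q" using Q.zero_closed by (simp add: contr_def zero_L del: Diff_iff)
    show "a + b \<in> contr Q" if "a \<in> contr Q" "b \<in> contr Q" for a b
    proof -
      have "fr a 1 \<oplus>\<^bsub>L\<^esub> fr b 1 \<in> Q" using that by (intro Q.a_closed) (simp_all add: contr_def)
      moreover have "fr a 1 \<oplus>\<^bsub>L\<^esub> fr b 1 = fr (a + b) 1"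
        using that add_frac[of a b 1 1] M_props(1) by (simp add: contr_def)
      ultimately show ?thesis using that by (simp add: contr_def)
    qed
    show "r * a \<in> contr Q" if "r \<in> S" "a \<in> contr Q" for r a
      using Q.I_l_closed[of "fr a 1" "fr r 1"] that by (simp add: contr_def mult_frac del: Diff_iff)
  qed
qed

lemma contr_prime:
  assumes "primeideal Q L" shows "prime_in S (contr Q)" "contr Q \<subseteq> P"
proof -
  interpret Q: primeideal Q L by fact
  have id: "ideal Q L" by (rule Q.is_ideal)
  have one: "fr 1 1 \<notin> Q" using Q.one_imp_carrier Q.I_notcarr by (auto simp: one_L)
  show "prime_in S (contr Q)" unfolding prime_in_def
  proof (intro conjI ballI impI)
    show "ideal_in S (contr Q)" by (rule contr_ideal[OF id])
    show "1 \<notin> contr Q" using one by (simp add: contr_def)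
    fix a b assume "a \<in> S" "b \<in> S" "a * b \<in> contr Q"
    then show "a \<in> contr Q \<or> b \<in> contr Q"
      using Q.I_prime[of "fr a 1" "fr b 1"] by (auto simp: contr_def mult_frac simp del: Diff_iff)
  qed
  show "contr Q \<subseteq> P"
  proof
    fix a assume a: "a \<in> contr Q"
    then have aS: "a \<in> S" by (simp add: contr_def)
    show "a \<in> P"
    proof (rule ccontr)
      assume "a \<notin> P"
      then have m: "a \<in> M" using aS by simp
      then have "fr a a \<in> Q" using contr_frac[OF id aS m] a by simp
      then show False using one aS m frac_eq[of a 1 a 1] by (simp del: Diff_iff)
    qed
  qed
qed

lemma contr_ext: assumes q: "prime_in S q" "q \<subseteq> P" shows "contr (ext q) = q"
proof
  note qS = ideal_inD(1)[OF prime_inD(1)[OF q(1)]]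
  show "q \<subseteq> contr (ext q)" using qS frac_ext by (auto simp: contr_def simp del: Diff_iff)
  show "contr (ext q) \<subseteq> q"
  proof
    fix a assume "a \<in> contr (ext q)"
    then obtain b t where a: "a \<in> S" "b \<in> q" "t \<in> M" "fr a 1 = fr b t"
      unfolding contr_def ext_alt by blast
    then have "a * t = b" using frac_eq[of a b 1 t] qS by (simp del: Diff_iff)
    then have "a \<in> q \<or> t \<in> q" using prime_inD(3)[OF q(1), of a t] a by auto
    then show "a \<in> q" using a(3) q(2) by auto
  qed
qed

lemma ext_prime: assumes q: "prime_in S q" "q \<subseteq> P" shows "primeideal (ext q) L"
proof (rule primeidealI)
  note id = ext_ideal[OF prime_inD(1)[OF q(1)]]
  show "ideal (ext q) L" "cring L" by (fact id cring_L)+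
  have "\<one>\<^bsub>L\<^esub> \<notin> ext q" using contr_ext[OF q] contr_frac[OF id, of 1 1] prime_inD(2)[OF q(1)] by (simp add: one_L del: Diff_iff)
  then show "carrier L \<noteq> ext q" using L.one_closed by metis
  fix x y assume "x \<in> carrier L" "y \<in> carrier L" and xy: "x \<otimes>\<^bsub>L\<^esub> y \<in> ext q"
  then obtain a s b t where x: "a \<in> S" "s \<in> M" "x = fr a s" "b \<in> S" "t \<in> M" "y = fr b t"
    by (metis carrier_cases)
  then have "a * b \<in> q" using xy contr_frac[OF id, of "a * b" "s * t"] contr_ext[OF q]
    by (simp add: mult_frac del: Diff_iff)
  then have "a \<in> q \<or> b \<in> q" using prime_inD(3)[OF q(1)] x by blast
  then show "x \<in> ext q \<or> y \<in> ext q" using x frac_ext by blast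
qed

lemma ext_mono: "I \<subseteq> J \<Longrightarrow> ext I \<subseteq> ext J"
  unfolding ext_alt by blast

lemma contr_mono: "I \<subseteq> J \<Longrightarrow> contr I \<subseteq> contr J"
  unfolding contr_def by blast

text \<open>Extension and contraction are mutually inverse on the primes inside \<open>P\<close>, so
  strict chains correspond in both directions.\<close>

lemma height_ext: "prime_height L (ext P) = prime_height (ring_of S) P"
proof -
  have "(\<exists>Q. (\<forall>i\<le>k. primeideal (Q i) L) \<and> (\<forall>i<k. Q i \<subset> Q (Suc i)) \<and> Q k = ext P) \<longleftrightarrow> prime_chain S P k" for k
  proof
    assume "\<exists>Q. (\<forall>i\<le>k. primeideal (Q i) L) \<and> (\<forall>i<k. Q i \<subset> Q (Suc i)) \<and> Q k = ext P"
    then obtain Q where Q: "\<And>i. i \<le> k \<Longrightarrow> primeideal (Q i) L" "\<And>i. i < k \<Longrightarrow> Q i \<subset> Q (Suc i)" "Q k = ext P" by blast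
    have id: "ideal (Q i) L" if "i \<le> k" for i using Q(1)[OF that] by (rule primeideal.axioms(1))
    have "contr (Q i) \<subset> contr (Q (Suc i))" if "i < k" for i
    proof -
      have "contr (Q i) \<noteq> contr (Q (Suc i))"
      proof
        assume "contr (Q i) = contr (Q (Suc i))"
        then have "ext (contr (Q i)) = ext (contr (Q (Suc i)))" by simp
        moreover have "ext (contr (Q i)) = Q i" "ext (contr (Q (Suc i))) = Q (Suc i)"
          using that by (auto intro!: ext_contr id)
        ultimately show False using Q(2)[OF that] by simp
      qed
      then show ?thesis using contr_mono[of "Q i" "Q (Suc i)"] Q(2)[OF that] by blast
    qed
    then show "prime_chain S P k"
      unfolding prime_chain_def using contr_prime(1)[OF Q(1)] Q(3) contr_ext[OF P order_refl]
      by (intro exI[of _ "\<lambda>i. contr (Q i)"]) auto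
  next
    assume "prime_chain S P k"
    then obtain Q where Q: "\<And>i. i \<le> k \<Longrightarrow> prime_in S (Q i)" "\<And>i. i < k \<Longrightarrow> Q i \<subset> Q (Suc i)" "Q k = P"
      by (auto simp: prime_chain_def)
    have sub: "Q i \<subseteq> P" if "i \<le> k" for i
      using that
    proof (induction "k - i" arbitrary: i)
      case (Suc d)
      have "Q (Suc i) \<subseteq> P" using Suc.hyps(2) Suc.prems by (intro Suc.hyps(1)) auto
      moreover have "Q i \<subset> Q (Suc i)" using Suc.hyps(2) by (intro Q(2)) auto
      ultimately show ?case by blast
    qed (use Q(3) in simp)
    have "ext (Q i) \<subset> ext (Q (Suc i))" if "i < k" for i
    proof -
      have "ext (Q i) \<noteq> ext (Q (Suc i))"
      proof
        assume "ext (Q i) = ext (Q (Suc i))"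
        then have "contr (ext (Q i)) = contr (ext (Q (Suc i)))" by simp
        moreover have "contr (ext (Q i)) = Q i" "contr (ext (Q (Suc i))) = Q (Suc i)"
          using that by (auto intro!: contr_ext Q(1) sub)
        ultimately show False using Q(2)[OF that] by simp
      qed
      then show ?thesis using ext_mono[of "Q i" "Q (Suc i)"] Q(2)[OF that] by blast
    qed
    then show "\<exists>Q. (\<forall>i\<le>k. primeideal (Q i) L) \<and> (\<forall>i<k. Q i \<subset> Q (Suc i)) \<and> Q k = ext P"
      using ext_prime[OF Q(1) sub] Q(3) by (intro exI[of _ "\<lambda>i. ext (Q i)"]) auto
  qed
  then show ?thesis by (simp add: prime_height_def[of L] prime_height_ring_of[OF S])
qed

text \<open>Minimality of \<open>P\<close> leaves \<open>ext P\<close> as the only prime over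
  \<open>ext I\<close>, and the infimum has a single term.\<close>

lemma ideal_height_ext:
  assumes I: "ideal_in S I" "I \<subseteq> P"
    and min: "\<And>Q. prime_in S Q \<Longrightarrow> I \<subseteq> Q \<Longrightarrow> Q \<subseteq> P \<Longrightarrow> Q = P"
  shows "ideal_height L (ext I) = prime_height (ring_of S) P"
proof -
  have "{Q. primeideal Q L \<and> ext I \<subseteq> Q} = {ext P}"
  proof (intro equalityI subsetI)
    fix Q assume "Q \<in> {Q. primeideal Q L \<and> ext I \<subseteq> Q}"
    then have Q: "primeideal Q L" "ext I \<subseteq> Q" by auto
    have "I \<subseteq> contr Q" using Q(2) frac_ext ideal_inD(1)[OF I(1)] by (auto simp: contr_def simp del: Diff_iff)
    then have "contr Q = P" using min contr_prime[OF Q(1)] by blast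
    then show "Q \<in> {ext P}" using ext_contr[OF primeideal.axioms(1)[OF Q(1)]] by simp
  next
    fix Q assume "Q \<in> {ext P}"
    then show "Q \<in> {Q. primeideal Q L \<and> ext I \<subseteq> Q}" using ext_prime[OF P] ext_mono[OF I(2)] by simp
  qed
  then show ?thesis by (simp add: ideal_height_def height_ext)
qed

section \<open>Generators of the localized ideal\<close>

lemma local_gens:
  assumes I: "ideal_in S I" and F: "F \<subseteq> I" "\<And>g. g \<in> I \<Longrightarrow> \<exists>s\<in>M. s * g \<in> gen_in S F"
  shows "genideal L ((\<lambda>f. fr f 1) ` F) = ext I"
proof
  note IS = ideal_inD(1)[OF I]
  let ?A = "(\<lambda>f. fr f 1) ` F"
  have A: "?A \<subseteq> carrier L" using F IS by (auto simp del: Diff_iff)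
  show "genideal L ?A \<subseteq> ext I"
    by (rule L.genideal_minimal[OF ext_ideal[OF I]]) (use F frac_ext in \<open>auto simp del: Diff_iff\<close>)
  have id: "ideal (genideal L ?A) L" by (rule L.genideal_ideal[OF A])
  have "F \<subseteq> contr (genideal L ?A)"
    using L.genideal_self[OF A] F IS by (auto simp: contr_def simp del: Diff_iff)
  then have sub: "gen_in S F \<subseteq> contr (genideal L ?A)"
    using F IS by (intro gen_in_least[OF S _ contr_ideal[OF id]]) auto
  show "ext I \<subseteq> genideal L ?A"
  proof
    fix x assume "x \<in> ext I"
    then obtain a s where x: "a \<in> I" "s \<in> M" "x = fr a s" unfolding ext_alt by blast
    obtain t where t: "t \<in> M" "t * a \<in> gen_in S F" using F(2)[OF x(1)] by blast
    have "fr (t * a) (t * s) \<in> genideal L ?A"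
      using contr_frac[OF id, of "t * a" "t * s"] sub t x IS by (auto simp del: Diff_iff simp: M_S)
    moreover have "fr (t * a) (t * s) = x" using x t IS by (simp add: frac_eq M_S mult_ac del: Diff_iff)
    ultimately show "x \<in> genideal L ?A" by simp
  qed
qed

text \<open>A generator of the local ideal differs from its numerator by a unit, so the numerators
  generate \<open>I\<close> up to denominators outside \<open>P\<close>.\<close>

lemma local_gens_lift:
  assumes I: "ideal_in S I" and A: "finite A" "A \<subseteq> carrier L" "genideal L A = ext I"
  shows "\<exists>F. finite F \<and> F \<subseteq> I \<and> card F \<le> card A \<and> (\<forall>g\<in>I. \<exists>s\<in>M. s * g \<in> gen_in S F)"
proof -
  note IS = ideal_inD(1)[OF I]
  have "\<forall>x\<in>A. \<exists>b. b \<in> I \<and> (\<exists>s\<in>M. x = fr b s)"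
    using L.genideal_self[OF A(2)] A(3) unfolding ext_alt by blast
  from bchoice[OF this] obtain b where b: "\<And>x. x \<in> A \<Longrightarrow> b x \<in> I" "\<And>x. x \<in> A \<Longrightarrow> \<exists>s\<in>M. x = fr (b x) s" by blast
  let ?F = "b ` A"
  have FI: "?F \<subseteq> I" using b by auto
  have FS: "?F \<subseteq> S" using FI IS by auto
  note G = gen_in_ideal[OF S FS]
  have "A \<subseteq> ext (gen_in S ?F)"
  proof
    fix x assume x: "x \<in> A"
    then obtain s where "s \<in> M" "x = fr (b x) s" using b(2) by blast
    then show "x \<in> ext (gen_in S ?F)" using frac_ext[of "b x" "gen_in S ?F" s] gen_in_incl[OF S FS] x by auto
  qed
  then have sub: "ext I \<subseteq> ext (gen_in S ?F)"
    unfolding A(3)[symmetric] by (rule L.genideal_minimal[OF ext_ideal[OF G]])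
  have "\<exists>s\<in>M. s * g \<in> gen_in S ?F" if g: "g \<in> I" for g
  proof -
    have "fr g 1 \<in> ext (gen_in S ?F)" using frac_ext[OF g M_props(1)] sub by (rule rev_subsetD)
    then obtain a s where a: "a \<in> gen_in S ?F" "s \<in> M" "fr g 1 = fr a s" unfolding ext_alt by blast
    then have "g * s = a" using frac_eq[of g a 1 s] IS[OF g] ideal_inD(1)[OF G] by (simp del: Diff_iff)
    then show ?thesis using a by (metis mult.commute)
  qed
  then show ?thesis using A(1) FI card_image_le[OF A(1), of b] by (intro exI[of _ ?F]) auto
qed

text \<open>\<open>F\<close> guarantees that \<open>LEAST\<close> ranges over a nonempty set; its
  value is then attained by actual generators, which can be lifted to \<open>S\<close> and fed to
  Krull's theorem.\<close>

lemma min_gens_le: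
  assumes I: "ideal_in S I" and F: "finite F" "F \<subseteq> I" "\<And>g. g \<in> I \<Longrightarrow> \<exists>s\<in>M. s * g \<in> gen_in S F"
  shows "min_gens L (ext I) \<le> card F"
    and "\<exists>F'. finite F' \<and> F' \<subseteq> I \<and> card F' \<le> min_gens L (ext I) \<and> (\<forall>g\<in>I. \<exists>s\<in>M. s * g \<in> gen_in S F')"
proof -
  let ?A = "(\<lambda>f. fr f 1) ` F"
  let ?\<Phi> = "\<lambda>k. \<exists>A. A \<subseteq> carrier L \<and> finite A \<and> card A = k \<and> genideal L A = ext I"
  have \<Phi>: "?\<Phi> (card ?A)"
    using F local_gens[OF I F(2,3)] ideal_inD(1)[OF I] by (intro exI[of _ ?A]) (auto simp del: Diff_iff)
  have "min_gens L (ext I) \<le> card ?A" unfolding min_gens_def using \<Phi> by (rule Least_le)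
  also have "\<dots> \<le> card F" using F(1) by (rule card_image_le)
  finally show "min_gens L (ext I) \<le> card F" .
  have "?\<Phi> (min_gens L (ext I))" unfolding min_gens_def using \<Phi> by (rule LeastI)
  then obtain A where A: "A \<subseteq> carrier L" "finite A" "card A = min_gens L (ext I)" "genideal L A = ext I" by blast
  show "\<exists>F'. finite F' \<and> F' \<subseteq> I \<and> card F' \<le> min_gens L (ext I) \<and> (\<forall>g\<in>I. \<exists>s\<in>M. s * g \<in> gen_in S F')"
    using local_gens_lift[OF I A(2,1,4)] A(3) by auto
qed

end

section \<open>Edge ideals and their number of generators\<close>

text \<open>The order is auxiliary: ordered variables give ordered exponent vectors, from which the
  polynomial ring inherits the absence of zero divisors.\<close>

fun var_rank :: "xy_var \<Rightarrow> nat \<times> bool" where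
  "var_rank (X i) = (i, False)"
| "var_rank (Y i) = (i, True)"

lemma var_rank_inj: "var_rank v = var_rank w \<Longrightarrow> v = w"
  by (cases v; cases w) auto

instantiation xy_var :: linorder
begin

definition "v \<le> w \<longleftrightarrow> fst (var_rank v) < fst (var_rank w) \<or>
  fst (var_rank v) = fst (var_rank w) \<and> snd (var_rank v) \<le> snd (var_rank w)"

definition "v < w \<longleftrightarrow> v \<le> w \<and> v \<noteq> (w :: xy_var)"

instance
proof
  fix x y z :: xy_var
  show "x \<le> x" by (simp add: less_eq_xy_var_def)
  show "x \<le> y \<Longrightarrow> y \<le> z \<Longrightarrow> x \<le> z" by (auto simp: less_eq_xy_var_def)
  show anti: "x \<le> y \<Longrightarrow> y \<le> x \<Longrightarrow> x = y"
    by (rule var_rank_inj, rule prod_eqI) (auto simp: less_eq_xy_var_def)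
  show "x \<le> y \<or> y \<le> x" by (auto simp: less_eq_xy_var_def)
  show "x < y \<longleftrightarrow> x \<le> y \<and> \<not> y \<le> x"
    using anti \<open>x \<le> x\<close> by (auto simp: less_xy_var_def)
qed

end

lemma xy_ring_eq: "xy_ring n = ring_of (polys (xy_vars n))"
  by (simp add: xy_ring_def ring_of_def polys_def)

lemma finite_xy_vars [simp]: "finite (xy_vars n)" and card_xy_vars: "card (xy_vars n) = 2 * n"
proof -
  show "finite (xy_vars n)" by (simp add: xy_vars_def)
  have "card (xy_vars n) = card (X ` {1..n}) + card (Y ` {1..n})"
    unfolding xy_vars_def by (rule card_Un_disjoint) auto
  then show "card (xy_vars n) = 2 * n" by (simp add: card_image inj_on_def)
qed

lemma in_xy_vars [simp]: "X i \<in> xy_vars n \<longleftrightarrow> i \<in> {1..n}" "Y i \<in> xy_vars n \<longleftrightarrow> i \<in> {1..n}"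
  by (auto simp: xy_vars_def)

definition edge_poly :: "'k::field \<Rightarrow> nat \<Rightarrow> nat \<Rightarrow> 'k xy_poly" where
  "edge_poly \<epsilon> i j = Var (X i) * Var (X j) + Cst \<epsilon> * (Var (Y i) * Var (Y j))"

definition edge_polys :: "'k::field \<Rightarrow> nat set set \<Rightarrow> 'k xy_poly set" where
  "edge_polys \<epsilon> E = {edge_poly \<epsilon> i j | i j. {i, j} \<in> E}"

abbreviation xy_polys :: "nat \<Rightarrow> 'k::field xy_poly set" where
  "xy_polys n \<equiv> polys (xy_vars n)"

definition edge_ideal :: "nat \<Rightarrow> 'k::field \<Rightarrow> nat set set \<Rightarrow> 'k xy_poly set" where
  "edge_ideal n \<epsilon> E = gen_in (xy_polys n) (edge_polys \<epsilon> E)"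

lemma lss_ideal_eq: "lss_ideal n E = edge_ideal n 1 E"
  by (simp add: lss_ideal_def edge_ideal_def gen_in_def edge_polys_def edge_poly_def xy_ring_eq
      x_var_def y_var_def Var_def)

lemma parity_binomial_edge_ideal_eq: "parity_binomial_edge_ideal n E = edge_ideal n (- 1) E"
  by (simp add: parity_binomial_edge_ideal_def edge_ideal_def gen_in_def edge_polys_def edge_poly_def
      xy_ring_eq x_var_def y_var_def Var_def)

lemma simple_graphD:
  assumes "simple_graph V E" "{i, j} \<in> E" shows "i \<in> V" "j \<in> V" "i \<noteq> j"
  using assms by (auto simp: simple_graph_def card_2_iff doubleton_eq_iff)

lemma simple_graph_finite: "simple_graph V E \<Longrightarrow> finite E"
  unfolding simple_graph_def by (meson Pow_iff finite_Pow_iff finite_subset subsetI)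

lemma simple_graph_edge: "simple_graph V E \<Longrightarrow> e \<in> E \<Longrightarrow> \<exists>i j. e = {i, j} \<and> i \<noteq> j \<and> i \<in> V \<and> j \<in> V"
  unfolding simple_graph_def by (metis card_2_iff insert_subset)

lemma edge_poly_commute: "edge_poly \<epsilon> i j = edge_poly \<epsilon> j i"
  by (simp add: edge_poly_def mult.commute)

lemma edge_polys_sub: "simple_graph {1..n} E \<Longrightarrow> edge_polys \<epsilon> E \<subseteq> xy_polys n"
proof
  fix f assume E: "simple_graph {1..n} E" and "f \<in> edge_polys \<epsilon> E"
  then obtain i j where "f = edge_poly \<epsilon> i j" "{i, j} \<in> E" by (auto simp: edge_polys_def)
  then show "f \<in> xy_polys n" using simple_graphD(1,2)[OF E] by (auto simp: edge_poly_def)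
qed

lemma edge_ideal_ideal: "simple_graph {1..n} E \<Longrightarrow> ideal_in (xy_polys n) (edge_ideal n \<epsilon> E)"
  unfolding edge_ideal_def by (rule gen_in_ideal[OF subdom_polys edge_polys_sub])

lemma edge_ideal_gen: "simple_graph {1..n} E \<Longrightarrow> {i, j} \<in> E \<Longrightarrow> edge_poly \<epsilon> i j \<in> edge_ideal n \<epsilon> E"
  unfolding edge_ideal_def
  using gen_in_incl[OF subdom_polys edge_polys_sub, of n E \<epsilon>] by (auto simp: edge_polys_def)

lemma edge_ideal_least:
  "simple_graph {1..n} E \<Longrightarrow> ideal_in (xy_polys n) I \<Longrightarrow>
    (\<And>i j. {i, j} \<in> E \<Longrightarrow> edge_poly \<epsilon> i j \<in> I) \<Longrightarrow> edge_ideal n \<epsilon> E \<subseteq> I"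
  unfolding edge_ideal_def
  by (rule gen_in_least[OF subdom_polys edge_polys_sub]) (auto simp: edge_polys_def)

lemma edge_polys_finite_card:
  assumes "simple_graph {1..n} E" shows "finite (edge_polys \<epsilon> E)" "card (edge_polys \<epsilon> E) \<le> card E"
proof -
  \<comment> \<open>\<open>Min\<close> and \<open>Max\<close> choose one orientation of every edge;
    the other gives the same polynomial.\<close>
  have sub: "edge_polys \<epsilon> E \<subseteq> (\<lambda>e. edge_poly \<epsilon> (Min e) (Max e)) ` E"
  proof
    fix f assume "f \<in> edge_polys \<epsilon> E"
    then obtain i j where f: "f = edge_poly \<epsilon> i j" "{i, j} \<in> E" by (auto simp: edge_polys_def)
    have "f = edge_poly \<epsilon> (Min {i, j}) (Max {i, j})"
      using f edge_poly_commute[of \<epsilon> i j] by (auto simp: min_def max_def)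
    then show "f \<in> (\<lambda>e. edge_poly \<epsilon> (Min e) (Max e)) ` E" using f(2) by (rule image_eqI)
  qed
  have fin: "finite E" by (rule simple_graph_finite[OF assms])
  show "finite (edge_polys \<epsilon> E)" using sub fin finite_surj by blast
  show "card (edge_polys \<epsilon> E) \<le> card E" using sub fin by (rule surj_card_le[rotated])
qed

text \<open>Substituting \<open>t v\<close> for every variable \<open>v\<close> separates the homogeneous components
  as coefficients of powers of \<open>t\<close>.\<close>

definition grading :: "('v, 'k::field) mpoly \<Rightarrow> ('v, 'k) mpoly poly" where
  "grading = into_poly (\<lambda>v. [:0, Var v:])"

lemma grading_hom: "is_hom grading"
  unfolding grading_def by (rule is_hom_into_poly)

lemma grading_0:
  fixes f :: "('v::linorder, 'k::field) mpoly"
  assumes "f \<in> polys V" shows "\<exists>c. coeff (grading f) 0 = Cst c"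
  using assms
proof (induction rule: polys_induct)
  case (Cst c)
  then show ?case by (auto simp: grading_def)
next
  case (Var v)
  then show ?case by (auto simp: grading_def intro!: exI[of _ 0])
next
  case (add f g)
  then show ?case by (auto simp: is_homD[OF grading_hom] Cst_simps(3)[symmetric] simp del: Cst_simps(3))
next
  case (mult f g)
  then show ?case by (auto simp: is_homD[OF grading_hom] coeff_mult Cst_simps(4)[symmetric] simp del: Cst_simps(4))
qed

lemma grading_edge_poly: "grading (edge_poly \<epsilon> i j) = [:0, 0, edge_poly \<epsilon> i j:]"
  unfolding edge_poly_def is_homD[OF grading_hom] by (simp add: grading_def)

text \<open>For \<open>e = {i, j}\<close> the exponent of the product of \<open>X i\<close> and
  \<open>X j\<close>. Among the edge polynomials it occurs only in that of \<open>e\<close>, so its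
  coefficient separates the edges.\<close>

definition edge_exp :: "nat set \<Rightarrow> xy_var \<Rightarrow>\<^sub>0 nat" where
  "edge_exp e = (\<Sum>i\<in>e. Poly_Mapping.single (X i) 1)"

lemma edge_poly_conv: "edge_poly \<epsilon> i j =
    Poly_Mapping.single (Poly_Mapping.single (X i) 1 + Poly_Mapping.single (X j) 1) 1 +
    Poly_Mapping.single (Poly_Mapping.single (Y i) 1 + Poly_Mapping.single (Y j) 1) \<epsilon>"
  by (simp add: edge_poly_def Var_def Cst_def mult_single)

lemma edge_exp_lookup: "finite e \<Longrightarrow> Poly_Mapping.lookup (edge_exp e) (X i) = (if i \<in> e then 1 else 0)"
  by (simp add: edge_exp_def lookup_sum lookup_single when_def)

lemma edge_exp_inj: "finite e \<Longrightarrow> finite e' \<Longrightarrow> edge_exp e = edge_exp e' \<Longrightarrow> e = e'"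
  using edge_exp_lookup by (metis subsetI subset_antisym zero_neq_one)

lemma lookup_edge_poly:
  assumes "i \<noteq> j" "finite e"
  shows "Poly_Mapping.lookup (edge_poly \<epsilon> i j) (edge_exp e) = (if e = {i, j} then 1 else 0)"
proof -
  have "Poly_Mapping.single (X i) 1 + Poly_Mapping.single (X j) 1 = edge_exp {i, j}"
    using assms by (simp add: edge_exp_def)
  moreover have "Poly_Mapping.single (Y i) 1 + Poly_Mapping.single (Y j) 1 \<noteq> edge_exp e"
  proof
    assume "Poly_Mapping.single (Y i) 1 + Poly_Mapping.single (Y j) 1 = edge_exp e"
    from arg_cong[OF this, of "\<lambda>m. Poly_Mapping.lookup m (Y i)"] show False
      by (simp add: edge_exp_def lookup_sum lookup_add lookup_single when_def)
  qed
  ultimately show ?thesis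
    using edge_exp_inj[of e "{i, j}"] assms by (auto simp: edge_poly_conv lookup_add lookup_single when_def)
qed

text \<open>Fewer generators than edges would leave a nonzero linear functional \<open>D d\<close>
  on quadratic parts that kills them all. Since the ideal has no parts of degree 0 or 1, multiplying
  by \<open>r\<close> only scales the quadratic part by the constant term of \<open>r\<close>, so
  \<open>D d\<close> kills the whole ideal; on the edge polynomials this gives
  \<open>d = 0\<close>.\<close>

lemma card_generators_ge:
  fixes \<epsilon> :: "'k::field"
  assumes E: "simple_graph {1..n} E" and A: "finite A" "A \<subseteq> xy_polys n" "gen_in (xy_polys n) A = edge_ideal n \<epsilon> E"
  shows "card E \<le> card A"
proof (rule ccontr)
  let ?S = "xy_polys n :: 'k xy_poly set"
  assume "\<not> ?thesis"
  then have "\<exists>d. (\<forall>e\<in>E. d e \<in> (UNIV :: 'k set)) \<and> (\<exists>e\<in>E. d e \<noteq> 0) \<and>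
    (\<forall>a\<in>A. (\<Sum>e\<in>E. d e * Poly_Mapping.lookup (coeff (grading a) 2) (edge_exp e)) = 0)"
    using A simple_graph_finite[OF E] by (intro underdetermined_system) (auto simp: subdom_def)
  then obtain d where d: "\<exists>e\<in>E. d e \<noteq> (0::'k)"
    "\<And>a. a \<in> A \<Longrightarrow> (\<Sum>e\<in>E. d e * Poly_Mapping.lookup (coeff (grading a) 2) (edge_exp e)) = 0" by blast
  define D where "D c f = (\<Sum>e\<in>E. c e * Poly_Mapping.lookup (coeff (grading f) 2) (edge_exp e))"
    for c :: "nat set \<Rightarrow> 'k" and f
  define W where "W c = {f \<in> ?S. coeff (grading f) 0 = 0 \<and> coeff (grading f) 1 = 0 \<and> D c f = 0}" for c
  have W: "ideal_in ?S (W c)" for c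
    unfolding ideal_in_def
  proof (intro conjI ballI)
    show "W c \<subseteq> ?S" by (auto simp: W_def)
    show "0 \<in> W c" by (simp add: W_def D_def is_homD[OF grading_hom])
    show "f + g \<in> W c" if "f \<in> W c" "g \<in> W c" for f g
      using that by (simp add: W_def D_def is_homD[OF grading_hom] lookup_add distrib_left sum.distrib)
    show "r * f \<in> W c" if r: "r \<in> ?S" and f: "f \<in> W c" for r f
    proof -
      obtain a where a: "coeff (grading r) 0 = Cst a" using grading_0[OF r] by blast
      have f0: "coeff (grading f) 0 = 0" "coeff (grading f) (Suc 0) = 0" using f by (auto simp: W_def)
      have "coeff (grading (r * f)) 2 = Cst a * coeff (grading f) 2"
        by (simp add: is_homD[OF grading_hom] coeff_mult numeral_2_eq_2 f0 a)
      then have "D c (r * f) = a * D c f"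
        by (simp add: D_def lookup_Cst_mult sum_distrib_left mult_ac)
      then show ?thesis using r f f0
        by (simp add: W_def is_homD[OF grading_hom] coeff_mult)
    qed
  qed
  \<comment> \<open>With the zero functional, \<open>W\<close> only records that the parts of degree
    0 and 1 vanish; for the generators in \<open>A\<close> this is what \<open>W d\<close> demands
    besides \<open>D d\<close>.\<close>
  have "edge_ideal n \<epsilon> E \<subseteq> W (\<lambda>_. 0)"
    by (rule edge_ideal_least[OF E W])
      (use edge_polys_sub[OF E, of \<epsilon>] in \<open>auto simp: W_def D_def grading_edge_poly edge_polys_def\<close>)
  moreover have "A \<subseteq> edge_ideal n \<epsilon> E" using gen_in_incl[OF subdom_polys A(2)] A(3) by simp
  ultimately have "A \<subseteq> W d" using d(2) by (auto simp: W_def D_def[of d])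
  then have sub: "edge_ideal n \<epsilon> E \<subseteq> W d" using gen_in_least[OF subdom_polys A(2) W] A(3) by simp
  have "d e = 0" if e: "e \<in> E" for e
  proof -
    obtain i j where ij: "e = {i, j}" "i \<noteq> j" using simple_graph_edge[OF E e] by blast
    then have "D d (edge_poly \<epsilon> i j) = 0" using sub edge_ideal_gen[OF E, of i j \<epsilon>] e by (auto simp: W_def)
    moreover have "finite e'" if "e' \<in> E" for e' using simple_graph_edge[OF E that] by auto
    ultimately have "(\<Sum>e'\<in>E. if e' = e then d e' else 0) = 0"
      unfolding D_def using ij
      by (simp add: grading_edge_poly numeral_2_eq_2 lookup_edge_poly if_distrib[of "(*) _"] mult_1_right
          mult_zero_right cong: sum.cong if_cong)
    then show ?thesis using e simple_graph_finite[OF E] by simp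
  qed
  then show False using d(1) by blast
qed

lemma edge_poly_homogeneous: "homogeneous_poly (edge_poly \<epsilon> i j)"
  unfolding homogeneous_poly_def
proof (intro exI[of _ 2] ballI)
  fix m assume "m \<in> Poly_Mapping.keys (edge_poly \<epsilon> i j)"
  then obtain v w where "m = Poly_Mapping.single v 1 + Poly_Mapping.single w 1"
    unfolding edge_poly_conv using keys_add by (fastforce split: if_splits)
  moreover have "(\<Sum>u\<in>Poly_Mapping.keys m. Poly_Mapping.lookup m u) = (\<Sum>u\<in>{v, w}. Poly_Mapping.lookup m u)"
    using keys_add[of "Poly_Mapping.single v 1" "Poly_Mapping.single w (1::nat)"] calculation
    by (intro sum.mono_neutral_left) (auto simp: in_keys_iff)
  ultimately show "(\<Sum>u\<in>Poly_Mapping.keys m. Poly_Mapping.lookup m u) = 2"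
    by (cases "v = w") (auto simp: lookup_add lookup_single when_def)
qed

lemma
  assumes E: "simple_graph {1..n} E"
  shows mu_edge_ideal: "mu n (edge_ideal n \<epsilon> E) = card E"
    and homogeneous_edge_ideal: "homogeneous_ideal n (edge_ideal n \<epsilon> E)"
proof -
  let ?G = "edge_polys \<epsilon> E"
  note fin = edge_polys_finite_card[OF E, of \<epsilon>]
  have gen: "homogeneous_generating_set n (edge_ideal n \<epsilon> E) ?G"
    unfolding homogeneous_generating_set_def xy_ring_eq gen_in_def[symmetric]
    using edge_polys_sub[OF E] edge_poly_homogeneous by (auto simp: edge_polys_def edge_ideal_def)
  then show "homogeneous_ideal n (edge_ideal n \<epsilon> E)" by (auto simp: homogeneous_ideal_def)
  have ge: "card E \<le> card A" if "finite A" "homogeneous_generating_set n (edge_ideal n \<epsilon> E) A" for A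
    using that card_generators_ge[OF E that(1), of \<epsilon>]
    by (simp add: homogeneous_generating_set_def xy_ring_eq gen_in_def)
  have card: "card ?G = card E" using ge[OF fin(1) gen] fin(2) by simp
  have "minimal_homogeneous_generating_set n (edge_ideal n \<epsilon> E) ?G"
    unfolding minimal_homogeneous_generating_set_def
    using fin(1) gen card psubset_card_mono[OF fin(1)] ge finite_subset[OF _ fin(1)]
    by (metis leD psubset_imp_subset)
  then show "mu n (edge_ideal n \<epsilon> E) = card E"
    unfolding mu_def using card ge
    by (intro Least_equality) (auto simp: minimal_homogeneous_generating_set_def)
qed

section \<open>Primes of small height over an edge ideal\<close>

definition nscale :: "nat \<Rightarrow> ('v \<Rightarrow>\<^sub>0 nat) \<Rightarrow> 'v \<Rightarrow>\<^sub>0 nat" where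
  "nscale k \<mu> = Poly_Mapping.map ((*) k) \<mu>"

lemma lookup_nscale [simp]: "Poly_Mapping.lookup (nscale k \<mu>) v = k * Poly_Mapping.lookup \<mu> v"
  by (simp add: nscale_def Poly_Mapping.map.rep_eq when_def)

lemma single_power: "Poly_Mapping.single \<mu> 1 ^ k = Poly_Mapping.single (nscale k \<mu>) (1 :: 'k::field)"
proof (induction k)
  case 0
  have "nscale 0 \<mu> = 0" by (rule poly_mapping_eqI) simp
  then show ?case by simp
next
  case (Suc k)
  have "nscale (Suc k) \<mu> = \<mu> + nscale k \<mu>" by (rule poly_mapping_eqI) (simp add: lookup_add)
  then show ?case using Suc by (simp add: mult_single)
qed

text \<open>Distinct monomials in \<open>A\<close> go to distinct monomials with the same
  coefficients, so nothing cancels.\<close>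

lemma subst_monomials_inj:
  fixes f :: "('v, 'k::field) mpoly"
  assumes \<beta>: "\<And>v. v \<in> A \<Longrightarrow> \<beta> v = Poly_Mapping.single (\<mu> v) 1"
    and inj: "\<And>m m'. Poly_Mapping.keys m \<subseteq> A \<Longrightarrow> Poly_Mapping.keys m' \<subseteq> A \<Longrightarrow>
      (\<Sum>v\<in>Poly_Mapping.keys m. nscale (Poly_Mapping.lookup m v) (\<mu> v)) =
      (\<Sum>v\<in>Poly_Mapping.keys m'. nscale (Poly_Mapping.lookup m' v) (\<mu> v)) \<Longrightarrow> m = m'"
    and f: "f \<in> polys A" "subst Cst \<beta> f = 0"
  shows "f = 0"
proof -
  let ?\<theta> = "\<lambda>m. \<Sum>v\<in>Poly_Mapping.keys m. nscale (Poly_Mapping.lookup m v) (\<mu> v)"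
  have keys: "Poly_Mapping.keys m \<subseteq> A" if "m \<in> Poly_Mapping.keys f" for m
    using f(1) that by (auto simp: polys_def)
  have prod: "(\<Prod>v\<in>B. \<beta> v ^ e v) = Poly_Mapping.single (\<Sum>v\<in>B. nscale (e v) (\<mu> v)) 1"
    if "finite B" "B \<subseteq> A" for B e
    using that by (induction B rule: finite_induct) (auto simp: \<beta> single_power mult_single)
  have eq: "subst Cst \<beta> f = (\<Sum>m\<in>Poly_Mapping.keys f. Poly_Mapping.single (?\<theta> m) (Poly_Mapping.lookup f m))"
    unfolding subst_def by (intro sum.cong) (auto simp: prod keys Cst_def mult_single)
  have "Poly_Mapping.lookup f m = 0" for m
  proof (cases "m \<in> Poly_Mapping.keys f")
    case True
    have "0 = Poly_Mapping.lookup (subst Cst \<beta> f) (?\<theta> m)" using f(2) by simp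
    also have "\<dots> = (\<Sum>m'\<in>Poly_Mapping.keys f. if m' = m then Poly_Mapping.lookup f m else 0)"
      unfolding eq lookup_sum lookup_single when_def
      by (intro sum.cong) (auto dest: inj[OF keys keys[OF True]])
    also have "\<dots> = Poly_Mapping.lookup f m" using True by simp
    finally show ?thesis by simp
  qed (simp add: in_keys_iff)
  then show ?thesis by (intro poly_mapping_eqI) simp
qed

text \<open>The vertices in \<open>T\<close> are sent to the zero vector; in each component of the rest (labelled
  by its root \<open>\<rho> i\<close>) the vectors are multiples of a generic vector or of its orthogonal,
  according to the bipartition \<open>col\<close>.\<close>

lemma edge_ideal_height_le:
  fixes \<epsilon> :: "'k::field"
  assumes E: "simple_graph {1..n} E" and T: "T \<subseteq> {1..n}"
    and root: "\<And>i. i \<in> {1..n} - T \<Longrightarrow> \<rho> i \<in> {1..n} - T \<and> col (\<rho> i) \<and> \<rho> (\<rho> i) = \<rho> i"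
    and edge: "\<And>i j. {i, j} \<in> E \<Longrightarrow> i \<notin> T \<Longrightarrow> j \<notin> T \<Longrightarrow> \<rho> i = \<rho> j \<and> col i \<noteq> col j"
  shows "ideal_height (ring_of (xy_polys n)) (edge_ideal n \<epsilon> E) \<le>
    enat (2 * n - (card ({1..n} - T) + card (\<rho> ` ({1..n} - T))))"
proof -
  let ?W = "{1..n} - T"
  \<comment> \<open>With \<open>r\<close> the root of the component, a coloured vertex gets the
    vector \<open>x_i (1, y_r)\<close> and an uncoloured one
    \<open>x_i (- \<epsilon> y_r, 1)\<close>; these are orthogonal for the form with weight
    \<open>\<epsilon>\<close>.\<close>
  define \<beta> :: "xy_var \<Rightarrow> 'k xy_poly" where "\<beta> v = (case v of
      X i \<Rightarrow> if i \<in> T then 0 else if col i then Var (X i) else Cst (- \<epsilon>) * (Var (X i) * Var (Y (\<rho> i)))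
    | Y i \<Rightarrow> if i \<in> T then 0 else if col i then Var (X i) * Var (Y (\<rho> i)) else Var (X i))" for v
  define \<phi> where "\<phi> = subst Cst \<beta>"
  have hom: "is_hom \<phi>" unfolding \<phi>_def by (rule is_hom_subst[OF is_hom_Cst])
  have \<phi>V: "\<phi> (Var v) = \<beta> v" "\<phi> (Cst c) = Cst c" for v c
    unfolding \<phi>_def by (simp_all add: subst_Var[OF is_hom_Cst] subst_Cst[OF is_hom_Cst])
  define P where "P = {f \<in> xy_polys n. \<phi> f \<in> {0}}"
  have P: "prime_in (xy_polys n) P"
    unfolding P_def
    by (rule prime_vimage[OF subdom_polys _ hom, where T = UNIV])
      (auto simp: subdom_def intro!: prime_zero)
  have edge0: "\<phi> (edge_poly \<epsilon> i j) = 0" if "{i, j} \<in> E" for i j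
  proof (cases "i \<in> T \<or> j \<in> T")
    case True
    then show ?thesis by (auto simp: edge_poly_def is_homD[OF hom] \<phi>V \<beta>_def)
  next
    case False
    then show ?thesis
      using edge[OF that] by (cases "col i") (auto simp: edge_poly_def is_homD[OF hom] \<phi>V \<beta>_def algebra_simps)
  qed
  have IP: "edge_ideal n \<epsilon> E \<subseteq> P"
  proof (rule edge_ideal_least[OF E prime_inD(1)[OF P]])
    fix i j assume ij: "{i, j} \<in> E"
    then have "edge_poly \<epsilon> i j \<in> xy_polys n" using edge_polys_sub[OF E, of \<epsilon>] by (auto simp: edge_polys_def)
    then show "edge_poly \<epsilon> i j \<in> P" using edge0[OF ij] by (simp add: P_def)
  qed
  \<comment> \<open>One scale per remaining vertex and one direction per component. Uncoloured
    vertices show their scale in \<open>Y i\<close>, the direction sits in \<open>Y\<close> of the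
    root; roots are coloured, so the two do not collide.\<close>
  define A where "A = X ` {i \<in> ?W. col i} \<union> Y ` ({i \<in> ?W. \<not> col i} \<union> \<rho> ` ?W)"
  have AV: "A \<subseteq> xy_vars n" using T root by (auto simp: A_def)
  have "card A = card {i \<in> ?W. col i} + card ({i \<in> ?W. \<not> col i} \<union> \<rho> ` ?W)"
    unfolding A_def by (subst card_Un_disjoint) (auto simp: card_image inj_on_def)
  also have "card ({i \<in> ?W. \<not> col i} \<union> \<rho> ` ?W) = card {i \<in> ?W. \<not> col i} + card (\<rho> ` ?W)"
  proof (rule card_Un_disjoint)
    have fin: "finite ?W" by simp
    show "finite {i \<in> ?W. \<not> col i}" by (rule finite_subset[OF _ fin]) blast
    show "finite (\<rho> ` ?W)" using fin by (rule finite_imageI)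
    show "{i \<in> ?W. \<not> col i} \<inter> \<rho> ` ?W = {}" using root by blast
  qed
  also have "card {i \<in> ?W. col i} + (card {i \<in> ?W. \<not> col i} + card (\<rho> ` ?W)) =
      card ({i \<in> ?W. col i} \<union> {i \<in> ?W. \<not> col i}) + card (\<rho> ` ?W)"
    by (subst card_Un_disjoint) auto
  also have "{i \<in> ?W. col i} \<union> {i \<in> ?W. \<not> col i} = ?W" by auto
  finally have cardA: "card A = card ?W + card (\<rho> ` ?W)" .
  define \<mu> :: "xy_var \<Rightarrow> xy_var \<Rightarrow>\<^sub>0 nat" where "\<mu> v = (case v of
      X i \<Rightarrow> Poly_Mapping.single (X i) 1
    | Y i \<Rightarrow> Poly_Mapping.single (X i) 1 + (if col i then Poly_Mapping.single (Y i) 1 else 0))" for v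
  have \<mu>X: "Poly_Mapping.lookup (\<mu> v) (X i) = (if v = X i \<or> v = Y i then 1 else 0)" for v i
    by (cases v) (auto simp: \<mu>_def lookup_add lookup_single when_def)
  have \<mu>Y: "Poly_Mapping.lookup (\<mu> v) (Y i) = (if v = Y i \<and> col i then 1 else 0)" for v i
    by (cases v) (auto simp: \<mu>_def lookup_add lookup_single when_def)
  have indep: "P \<inter> polys A \<subseteq> {0}"
  proof
    fix f assume f: "f \<in> P \<inter> polys A"
    have "f = 0"
    proof (rule subst_monomials_inj[where \<beta> = \<beta> and \<mu> = \<mu> and A = A])
      show "\<beta> v = Poly_Mapping.single (\<mu> v) 1" if v: "v \<in> A" for v
      proof (cases v)
        case (X i)
        then have "i \<notin> T" "col i" using v by (auto simp: A_def)
        then show ?thesis using X by (simp add: \<beta>_def \<mu>_def Var_def)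
      next
        case (Y i)
        then have "(i \<in> ?W \<and> \<not> col i) \<or> i \<in> \<rho> ` ?W" using v by (auto simp: A_def)
        then show ?thesis
        proof
          assume "i \<in> ?W \<and> \<not> col i"
          then show ?thesis using Y by (simp add: \<beta>_def \<mu>_def Var_def)
        next
          assume "i \<in> \<rho> ` ?W"
          then have "i \<notin> T" "col i" "\<rho> i = i" using root by auto
          then show ?thesis using Y by (simp add: \<beta>_def \<mu>_def Var_def mult_single)
        qed
      qed
      fix m m' :: "xy_var \<Rightarrow>\<^sub>0 nat"
      assume k: "Poly_Mapping.keys m \<subseteq> A" "Poly_Mapping.keys m' \<subseteq> A"
        and eq: "(\<Sum>v\<in>Poly_Mapping.keys m. nscale (Poly_Mapping.lookup m v) (\<mu> v)) =
          (\<Sum>v\<in>Poly_Mapping.keys m'. nscale (Poly_Mapping.lookup m' v) (\<mu> v))"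
      \<comment> \<open>The image exponent of \<open>X i\<close> adds those of \<open>X i\<close>
        and \<open>Y i\<close>. For coloured \<open>i\<close> the exponent of \<open>Y i\<close>
        separates the two; for uncoloured \<open>i\<close> the variable \<open>X i\<close> is not in
        \<open>A\<close>. So \<open>m\<close> can be recovered.\<close>
      have sX: "(\<Sum>v\<in>Poly_Mapping.keys m. Poly_Mapping.lookup m v * Poly_Mapping.lookup (\<mu> v) (X i)) =
          Poly_Mapping.lookup m (X i) + Poly_Mapping.lookup m (Y i)" for m i
      proof -
        have "(\<Sum>v\<in>Poly_Mapping.keys m. Poly_Mapping.lookup m v * Poly_Mapping.lookup (\<mu> v) (X i)) =
          (\<Sum>v\<in>Poly_Mapping.keys m \<union> {X i, Y i}. Poly_Mapping.lookup m v * Poly_Mapping.lookup (\<mu> v) (X i))"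
          by (rule sum.mono_neutral_left) (auto simp: in_keys_iff)
        also have "\<dots> = (\<Sum>v\<in>{X i, Y i}. Poly_Mapping.lookup m v * Poly_Mapping.lookup (\<mu> v) (X i))"
          by (rule sum.mono_neutral_right) (auto simp: \<mu>X)
        finally show ?thesis by (simp add: \<mu>X)
      qed
      have sY: "(\<Sum>v\<in>Poly_Mapping.keys m. Poly_Mapping.lookup m v * Poly_Mapping.lookup (\<mu> v) (Y i)) =
          Poly_Mapping.lookup m (Y i)" if "col i" for m i
      proof -
        have "(\<Sum>v\<in>Poly_Mapping.keys m. Poly_Mapping.lookup m v * Poly_Mapping.lookup (\<mu> v) (Y i)) =
          (\<Sum>v\<in>Poly_Mapping.keys m \<union> {Y i}. Poly_Mapping.lookup m v * Poly_Mapping.lookup (\<mu> v) (Y i))"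
          by (rule sum.mono_neutral_left) (auto simp: in_keys_iff)
        also have "\<dots> = (\<Sum>v\<in>{Y i}. Poly_Mapping.lookup m v * Poly_Mapping.lookup (\<mu> v) (Y i))"
          by (rule sum.mono_neutral_right) (auto simp: \<mu>Y)
        finally show ?thesis using that by (simp add: \<mu>Y)
      qed
      have eX: "Poly_Mapping.lookup m (X i) + Poly_Mapping.lookup m (Y i) =
          Poly_Mapping.lookup m' (X i) + Poly_Mapping.lookup m' (Y i)" for i
        using arg_cong[OF eq, of "\<lambda>m. Poly_Mapping.lookup m (X i)"] by (simp add: lookup_sum sX)
      have eY: "Poly_Mapping.lookup m (Y i) = Poly_Mapping.lookup m' (Y i)" if "col i" for i
        using arg_cong[OF eq, of "\<lambda>m. Poly_Mapping.lookup m (Y i)"] by (simp add: lookup_sum sY that)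
      have nX: "Poly_Mapping.lookup m (X i) = 0 \<and> Poly_Mapping.lookup m' (X i) = 0" if "\<not> col i" for i
      proof -
        have "X i \<notin> A" using that by (auto simp: A_def)
        then show ?thesis using k by (auto simp: in_keys_iff subset_iff)
      qed
      show "m = m'"
      proof (rule poly_mapping_eqI)
        fix v show "Poly_Mapping.lookup m v = Poly_Mapping.lookup m' v"
        proof (cases v)
          case (X i) then show ?thesis using eX[of i] eY[of i] nX[of i] by (cases "col i") auto
        next
          case (Y i) then show ?thesis using eX[of i] eY[of i] nX[of i] by (cases "col i") auto
        qed
      qed
    qed (use f in \<open>auto simp: P_def \<phi>_def\<close>)
    then show "f \<in> {0}" by simp
  qed
  have "ideal_height (ring_of (xy_polys n)) (edge_ideal n \<epsilon> E) \<le> prime_height (ring_of (xy_polys n)) P"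
    unfolding ideal_height_def primeideal_ring_of[OF subdom_polys] using P IP by (intro INF_lower) simp
  also have "\<dots> \<le> enat (card (xy_vars n) - card A)" by (rule prime_height_upper[OF finite_xy_vars P AV indep])
  finally show ?thesis by (simp add: card_xy_vars cardA)
qed

section \<open>Cycles\<close>

text \<open>A periodic parametrization on all of \<open>nat\<close>, so that passing the last vertex
  or changing the starting point needs no case distinction.\<close>

definition cycle_param :: "(nat \<Rightarrow> 'v) \<Rightarrow> nat \<Rightarrow> 'v set set \<Rightarrow> bool" where
  "cycle_param p l C \<longleftrightarrow> 3 \<le> l \<and> inj_on p {..<l} \<and> (\<forall>i. p (i + l) = p i) \<and> C = range (\<lambda>i. {p i, p (Suc i)})"

lemma cycle_edges_param:
  assumes "cycle_edges C" obtains p l where "cycle_param p l C"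
proof -
  obtain vs where vs: "distinct vs" "3 \<le> length vs" "C = {{vs ! i, vs ! (Suc i mod length vs)} | i. i < length vs}"
    using assms by (auto simp: cycle_edges_def)
  let ?l = "length vs"
  define p where "p i = vs ! (i mod ?l)" for i
  have l: "?l > 0" using vs(2) by linarith
  have "C = range (\<lambda>i. {p i, p (Suc i)})"
  proof (intro equalityI subsetI)
    fix e assume "e \<in> C"
    then obtain i where "i < ?l" "e = {vs ! i, vs ! (Suc i mod ?l)}" using vs(3) by blast
    then have "e = {p i, p (Suc i)}" by (simp add: p_def)
    then show "e \<in> range (\<lambda>i. {p i, p (Suc i)})" by blast
  next
    fix e assume "e \<in> range (\<lambda>i. {p i, p (Suc i)})"
    then obtain i where "e = {p i, p (Suc i)}" by blast
    then have "e = {vs ! (i mod ?l), vs ! (Suc (i mod ?l) mod ?l)}" by (simp add: p_def mod_Suc_eq)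
    moreover have "i mod ?l < ?l" using l by simp
    ultimately show "e \<in> C" unfolding vs(3) by blast
  qed
  moreover have "inj_on p {..<?l}" using vs(1) by (auto simp: inj_on_def p_def nth_eq_iff_index_eq)
  ultimately have "cycle_param p ?l C" using vs(2) by (simp add: cycle_param_def p_def)
  then show ?thesis by (rule that)
qed

context
  fixes p :: "nat \<Rightarrow> 'v" and l :: nat and C :: "'v set set"
  assumes C: "cycle_param p l C"
begin

lemma cycle_param_basic: "3 \<le> l" "inj_on p {..<l}" "p (i + l) = p i" "{p i, p (Suc i)} \<in> C"
  using C by (auto simp: cycle_param_def)

lemma cycle_param_mod: "p (i mod l) = p i"
proof -
  have "p (i + k * l) = p i" for i k
    by (induction k) (use cycle_param_basic(3) in \<open>auto simp: add.assoc[symmetric] add.commute[of l]\<close>)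
  from this[of "i mod l" "i div l"] show ?thesis by (simp add: mult.commute)
qed

lemma cycle_param_eq_iff: "p i = p j \<longleftrightarrow> i mod l = j mod l"
proof
  have l: "l > 0" using cycle_param_basic(1) by linarith
  assume "p i = p j"
  then have "p (i mod l) = p (j mod l)" by (simp add: cycle_param_mod)
  then show "i mod l = j mod l" using inj_onD[OF cycle_param_basic(2)] l by simp
qed (metis cycle_param_mod)

lemma cycle_param_neq: "i < j \<Longrightarrow> j < i + l \<Longrightarrow> p i \<noteq> p j"
proof
  assume ij: "i < j" "j < i + l" and "p i = p j"
  then have "l dvd j - i" by (simp add: cycle_param_eq_iff mod_eq_dvd_iff_nat[symmetric] eq_commute)
  then show False using ij by (auto dest: dvd_imp_le)
qed

lemma cycle_param_Union: "\<Union>C = p ` {..<l}"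
proof -
  have l: "l > 0" using cycle_param_basic(1) by linarith
  have "\<Union>C = range p" using C by (auto simp: cycle_param_def)
  moreover have "p i \<in> p ` {..<l}" for i
    using cycle_param_mod[of i] l by (intro image_eqI[of _ _ "i mod l"]) auto
  ultimately show ?thesis by auto
qed

lemma cycle_param_shift: "cycle_param (\<lambda>i. p (i + a)) l C"
  unfolding cycle_param_def
proof (intro conjI allI)
  show "3 \<le> l" by (rule cycle_param_basic(1))
  show "inj_on (\<lambda>i. p (i + a)) {..<l}"
  proof (rule inj_onI, rule ccontr)
    fix i j assume ij: "i \<in> {..<l}" "j \<in> {..<l}" "p (i + a) = p (j + a)" "i \<noteq> j"
    then show False
      using cycle_param_neq[of "i + a" "j + a"] cycle_param_neq[of "j + a" "i + a"] by (cases "i < j") auto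
  qed
  show "p (i + l + a) = p (i + a)" for i using cycle_param_basic(3)[of "i + a"] by (simp add: add_ac)
  show "C = range (\<lambda>i. {p (i + a), p (Suc i + a)})"
  proof (intro equalityI subsetI)
    fix e assume "e \<in> C"
    then obtain i where e: "e = {p i, p (Suc i)}" using C by (auto simp: cycle_param_def)
    \<comment> \<open>Adding \<open>a\<close> full periods first makes the subtraction of the shift
      safe on \<open>nat\<close>.\<close>
    have l: "a \<le> i + a * l" using cycle_param_basic(1) by (cases l) auto
    have shift: "p (i + a * l) = p i" for i by (simp add: cycle_param_eq_iff)
    have "e = {p (i + a * l), p (Suc i + a * l)}" using e shift by metis
    then have "e = {p ((i + a * l - a) + a), p (Suc (i + a * l - a) + a)}" using l by (simp add: Suc_diff_le)
    then show "e \<in> range (\<lambda>i. {p (i + a), p (Suc i + a)})" by blast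
  next
    fix e assume "e \<in> range (\<lambda>i. {p (i + a), p (Suc i + a)})"
    then show "e \<in> C" using C by (auto simp: cycle_param_def)
  qed
qed

lemma cycle_param_edge_at: "e \<in> C \<Longrightarrow> p (Suc i) \<in> e \<Longrightarrow> e = {p i, p (Suc i)} \<or> e = {p (Suc i), p (Suc (Suc i))}"
proof -
  assume e: "e \<in> C" "p (Suc i) \<in> e"
  then obtain j where j: "e = {p j, p (Suc j)}" using C by (auto simp: cycle_param_def)
  have suc: "p (Suc a) = p (Suc b)" if "p a = p b" for a b
    using that by (metis cycle_param_eq_iff mod_Suc_eq)
  have pred: "p a = p b" if "p (Suc a) = p (Suc b)" for a b
  proof -
    have "Suc (a + (l - 1)) = a + l" "Suc (b + (l - 1)) = b + l" using cycle_param_basic(1) by auto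
    moreover have "Suc a mod l = Suc b mod l" using that by (simp add: cycle_param_eq_iff)
    then have "(Suc a + (l - 1)) mod l = (Suc b + (l - 1)) mod l" by (metis mod_add_left_eq)
    ultimately have "p (a + l) = p (b + l)" by (simp add: cycle_param_eq_iff)
    then show ?thesis by (simp add: cycle_param_basic(3))
  qed
  show ?thesis
  proof (cases "p (Suc i) = p j")
    case True then show ?thesis using j suc[of "Suc i" j] by simp
  next
    case False
    then have "p (Suc i) = p (Suc j)" using e j by auto
    then show ?thesis using j pred[of i j] by simp
  qed
qed

lemma cycle_param_card: "card C = l" "card (\<Union>C) = l" "finite C"
proof -
  have l: "l > 0" using cycle_param_basic(1) by linarith
  show "card (\<Union>C) = l" unfolding cycle_param_Union using cycle_param_basic(2) by (simp add: card_image)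
  let ?e = "\<lambda>i. {p i, p (Suc i)}"
  have "C = ?e ` {..<l}"
  proof (intro equalityI subsetI)
    fix e assume "e \<in> C"
    then obtain i where "e = ?e i" using C by (auto simp: cycle_param_def)
    moreover have "?e i = ?e (i mod l)" by (metis cycle_param_eq_iff mod_Suc_eq mod_mod_trivial)
    ultimately show "e \<in> ?e ` {..<l}" using l by auto
  qed (use cycle_param_basic(4) in auto)
  moreover have "inj_on ?e {..<l}"
  proof (rule inj_onI, rule ccontr)
    fix i j assume ij: "i \<in> {..<l}" "j \<in> {..<l}" "?e i = ?e j" "i \<noteq> j"
    then have "p i \<noteq> p j" using inj_onD[OF cycle_param_basic(2)] by blast
    then have "p i = p (Suc j)" "p j = p (Suc i)" using ij(3) by (auto simp: doubleton_eq_iff)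
    then have "p i = p (Suc (Suc i))" by (metis cycle_param_eq_iff mod_Suc_eq)
    then show False using cycle_param_neq[of i "Suc (Suc i)"] cycle_param_basic(1) by simp
  qed
  ultimately show "card C = l" "finite C" by (simp_all add: card_image)
qed

text \<open>The position is a successor so that shifting by \<open>a\<close> puts \<open>w\<close>
  at 1, with neighbours at 0 and 2, and shifting by \<open>Suc a\<close> puts it at 0.\<close>

lemma cycle_param_at:
  assumes "w \<in> \<Union>C"
  obtains a where "p (Suc a) = w"
proof -
  obtain i where "w = p i" using assms unfolding cycle_param_Union by blast
  then have "p (Suc (i + (l - 1))) = w" using cycle_param_basic(1,3) by simp
  then show ?thesis by (rule that)
qed

end

lemma cycle_edges_through:
  assumes "cycle_edges C" "w \<in> \<Union>C"
  obtains p l where "cycle_param p l C" "p (Suc 0) = w"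
proof -
  obtain p l where p: "cycle_param p l C" using cycle_edges_param[OF assms(1)] by blast
  obtain a where "p (Suc a) = w" using cycle_param_at[OF p assms(2)] by blast
  then show ?thesis using that[OF cycle_param_shift[OF p, of a]] by simp
qed

section \<open>Walks, cycles and bipartitions\<close>

definition adj :: "'v set set \<Rightarrow> ('v \<times> 'v) set" where
  "adj F = {(x, y). {x, y} \<in> F}"

lemma sym_adj: "sym (adj F)"
  by (auto simp: adj_def sym_def insert_commute)

lemma walk_segment:
  assumes "\<forall>i<k. (f i, f (Suc i)) \<in> R" "i \<le> j" "j \<le> k"
  shows "(f i, f j) \<in> R ^^ (j - i)"
  unfolding relpow_fun_conv using assms by (intro exI[of _ "\<lambda>m. f (i + m)"]) auto

lemma shortest_path:
  assumes "(a, b) \<in> R\<^sup>*" "a \<noteq> b"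
  shows "\<exists>f k. 1 \<le> k \<and> f 0 = a \<and> f k = b \<and> (\<forall>i<k. (f i, f (Suc i)) \<in> R) \<and> inj_on f {..k}"
proof -
  have ex: "\<exists>k. (a, b) \<in> R ^^ k" using assms(1) by (rule rtrancl_imp_relpow)
  define k where "k = (LEAST k. (a, b) \<in> R ^^ k)"
  have k: "(a, b) \<in> R ^^ k" unfolding k_def using ex by (rule LeastI_ex)
  have least: "k \<le> j" if "(a, b) \<in> R ^^ j" for j unfolding k_def using that by (rule Least_le)
  obtain f where f: "f 0 = a" "f k = b" "\<And>i. i < k \<Longrightarrow> (f i, f (Suc i)) \<in> R"
    using k unfolding relpow_fun_conv by blast
  have neq: "f i \<noteq> f j" if "i < j" "j \<le> k" for i j
  proof
    assume eq: "f i = f j"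
    have "(a, f i) \<in> R ^^ i" using walk_segment[of k f R 0 i] that f by simp
    moreover have "(f i, b) \<in> R ^^ (k - j)" using walk_segment[of k f R j k] that f eq by simp
    ultimately have "(a, b) \<in> R ^^ (i + (k - j))" by (auto simp: relpow_add)
    then show False using least that by fastforce
  qed
  have "inj_on f {..k}" using neq by (auto simp: inj_on_def) (metis neq not_less_iff_gr_or_eq)
  moreover have "1 \<le> k" using f(1,2) assms(2) by (cases k) auto
  ultimately show ?thesis using f by blast
qed

lemma closed_path_cycle:
  fixes f :: "nat \<Rightarrow> 'v"
  assumes L: "3 \<le> L" and inj: "inj_on f {..<L}" and step: "\<And>i. Suc i < L \<Longrightarrow> {f i, f (Suc i)} \<in> E"
    and close: "{f (L - 1), f 0} \<in> E"
  shows "\<exists>C. cycle_edges C \<and> C \<subseteq> E \<and> {f 0, f 1} \<in> C \<and> card C = L \<and> \<Union>C = f ` {..<L}"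
proof -
  define vs where "vs = map f [0..<L]"
  have len: "length vs = L" by (simp add: vs_def)
  have nth: "i < L \<Longrightarrow> vs ! i = f i" for i by (simp add: vs_def)
  define C where "C = {{vs ! i, vs ! (Suc i mod length vs)} | i. i < length vs}"
  have C_alt: "C = {{f i, f (Suc i mod L)} | i. i < L}"
    unfolding C_def len
  proof (rule Collect_cong)
    have "vs ! i = f i \<and> vs ! (Suc i mod L) = f (Suc i mod L)" if "i < L" for i using nth that L by simp
    then show "(\<exists>i. e = {vs ! i, vs ! (Suc i mod L)} \<and> i < L) = (\<exists>i. e = {f i, f (Suc i mod L)} \<and> i < L)" for e
      by metis
  qed
  have cyc: "cycle_edges C"
    unfolding cycle_edges_def C_def using inj L len
    by (intro exI[of _ vs]) (auto simp: vs_def distinct_map atLeast0LessThan)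
  have "C \<subseteq> E"
  proof
    fix e assume "e \<in> C"
    then obtain i where i: "i < L" "e = {f i, f (Suc i mod L)}" unfolding C_alt by blast
    show "e \<in> E"
    proof (cases "Suc i < L")
      case True then show ?thesis using i step by simp
    next
      case False
      then have "Suc i = L" using i(1) by simp
      then have "i = L - 1" "Suc i mod L = 0" by auto
      then show ?thesis using i(2) close by simp
    qed
  qed
  moreover have "{f 0, f 1} \<in> C" unfolding C_alt using L by (intro CollectI exI[of _ 0]) auto
  moreover have U: "\<Union>C = f ` {..<L}"
  proof
    show "\<Union>C \<subseteq> f ` {..<L}" unfolding C_alt using L by auto
    show "f ` {..<L} \<subseteq> \<Union>C" unfolding C_alt by auto
  qed
  moreover have "card C = L"
  proof -
    obtain p l where p: "cycle_param p l C" using cycle_edges_param[OF cyc] by blast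
    have "card (\<Union>C) = L" unfolding U using inj by (simp add: card_image)
    then show ?thesis using cycle_param_card[OF p] by simp
  qed
  ultimately show ?thesis using cyc by blast
qed

lemma path_cycle:
  assumes k: "1 \<le> k" and inj: "inj_on f {..k}" and step: "\<And>i. i < k \<Longrightarrow> {f i, f (Suc i)} \<in> E"
    and w: "w \<notin> f ` {..k}" "{w, f 0} \<in> E" "{w, f k} \<in> E"
  shows "\<exists>C. cycle_edges C \<and> C \<subseteq> E \<and> {w, f 0} \<in> C \<and> card C = k + 2 \<and> \<Union>C = insert w (f ` {..k})"
proof -
  define g where "g i = (case i of 0 \<Rightarrow> w | Suc j \<Rightarrow> f j)" for i
  have "inj_on g {..<k + 2}"
    using inj w(1) by (auto simp: inj_on_def g_def split: nat.splits)
  moreover have "{g i, g (Suc i)} \<in> E" if "Suc i < k + 2" for i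
    using that w(2) step by (auto simp: g_def split: nat.splits)
  moreover have "{g (k + 2 - 1), g 0} \<in> E" using w(3) by (simp add: g_def insert_commute)
  ultimately obtain C where C: "cycle_edges C" "C \<subseteq> E" "{g 0, g 1} \<in> C" "card C = k + 2" "\<Union>C = g ` {..<k + 2}"
    using closed_path_cycle[of "k + 2" g E] k by auto
  have "{..<k + 2} = insert 0 (Suc ` {..k})"
    by (simp add: lessThan_Suc_atMost atMost_Suc_eq_insert_0)
  then have "g ` {..<k + 2} = insert w (f ` {..k})" by (simp add: g_def image_image)
  then show ?thesis using C by (auto simp: g_def)
qed

text \<open>A repeated vertex splits the walk into two shorter closed walks, one of them odd;
  without repetition the walk is a cycle.\<close>

lemma odd_closed_walk_cycle:
  assumes "(r, r) \<in> adj F ^^ k" "odd k" "\<And>x. {x, x} \<notin> F"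
  shows "\<exists>C. cycle_edges C \<and> C \<subseteq> F"
  using assms(1,2)
proof (induction k arbitrary: r rule: less_induct)
  case (less k)
  obtain f where f: "f 0 = r" "f k = r" "\<And>i. i < k \<Longrightarrow> (f i, f (Suc i)) \<in> adj F"
    using less.prems(1) unfolding relpow_fun_conv by blast
  show ?case
  proof (cases "inj_on f {..<k}")
    case True
    have "k \<noteq> 1"
    proof
      assume "k = 1"
      then have "{r, r} \<in> F" using f(3)[of 0] f(1,2) by (simp add: adj_def)
      then show False using assms(3) by blast
    qed
    then have k: "3 \<le> k" using less.prems(2) by (cases k; cases "k - 1"; cases "k - 2") auto
    have "{f (k - 1), f 0} \<in> F" using f(3)[of "k - 1"] f(1,2) k by (simp add: adj_def)
    then show ?thesis
      using closed_path_cycle[OF k True, of F] f(3) by (auto simp: adj_def)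
  next
    case False
    then obtain i j where ij: "i < j" "j < k" "f i = f j"
      by (auto simp: inj_on_def) (metis linorder_neqE_nat)
    have 1: "(f i, f i) \<in> adj F ^^ (j - i)" using walk_segment[of k f "adj F" i j] ij f by simp
    have "(r, f i) \<in> adj F ^^ i" using walk_segment[of k f "adj F" 0 i] ij f by simp
    moreover have "(f i, r) \<in> adj F ^^ (k - j)" using walk_segment[of k f "adj F" j k] ij f by simp
    ultimately have 2: "(r, r) \<in> adj F ^^ (i + (k - j))" by (auto simp: relpow_add)
    have "k = (j - i) + (i + (k - j))" using ij by simp
    then have "odd (j - i) \<or> odd (i + (k - j))" using less.prems(2) by (metis odd_add)
    moreover have "j - i < k" "i + (k - j) < k" using ij by auto
    ultimately show ?thesis using less.IH[OF _ 1] less.IH[OF _ 2] by blast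
  qed
qed

text \<open>Every component is rooted at its least vertex and coloured by the parity of walks from
  the root. The parity is well defined, since an odd closed walk would yield a cycle.\<close>

lemma acyclic_bipartition:
  fixes F :: "nat set set"
  assumes loop: "\<And>x. {x, x} \<notin> F" and acyc: "\<And>C. cycle_edges C \<Longrightarrow> C \<subseteq> F \<Longrightarrow> False"
  obtains \<rho> :: "nat \<Rightarrow> nat" and col :: "nat \<Rightarrow> bool"
  where "\<And>x. (x, \<rho> x) \<in> (adj F)\<^sup>*" "\<And>x y. \<rho> x = \<rho> y \<longleftrightarrow> (x, y) \<in> (adj F)\<^sup>*"
    "\<And>x. col (\<rho> x)" "\<And>x y k. (x, y) \<in> adj F ^^ k \<Longrightarrow> (col x = col y) = even k"
proof -
  let ?R = "adj F"
  define \<rho> where "\<rho> x = (LEAST y. (x, y) \<in> ?R\<^sup>*)" for x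
  define col where "col x = (\<exists>k. even k \<and> (\<rho> x, x) \<in> ?R ^^ k)" for x
  have sym: "(y, x) \<in> ?R\<^sup>*" if "(x, y) \<in> ?R\<^sup>*" for x y
    using that sym_rtrancl[OF sym_adj, of F] by (auto simp: sym_def)
  have \<rho>: "(x, \<rho> x) \<in> ?R\<^sup>*" for x
    unfolding \<rho>_def by (rule LeastI[of "\<lambda>y. (x, y) \<in> ?R\<^sup>*" x]) simp
  have same: "\<rho> x = \<rho> y" if "(x, y) \<in> ?R\<^sup>*" for x y
  proof -
    have "(x, z) \<in> ?R\<^sup>* \<longleftrightarrow> (y, z) \<in> ?R\<^sup>*" for z
      using rtrancl_trans[OF that, of z] rtrancl_trans[OF sym[OF that], of z] by blast
    then show ?thesis by (simp add: \<rho>_def)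
  qed
  have iff: "\<rho> x = \<rho> y \<longleftrightarrow> (x, y) \<in> ?R\<^sup>*" for x y
  proof
    assume "\<rho> x = \<rho> y"
    then have "(x, \<rho> y) \<in> ?R\<^sup>*" using \<rho>[of x] by simp
    then show "(x, y) \<in> ?R\<^sup>*" using sym[OF \<rho>[of y]] by (rule rtrancl_trans)
  qed (rule same)
  have symk: "(y, x) \<in> ?R ^^ k" if "(x, y) \<in> ?R ^^ k" for x y k
    using that
  proof (induction k arbitrary: x)
    case (Suc k)
    then obtain z where "(x, z) \<in> ?R" "(z, y) \<in> ?R ^^ k" by (metis relpow_Suc_D2)
    then show ?case using Suc.IH sym_adj[of F] by (meson relpow_Suc_I symD)
  qed simp
  have par: "even j = even k" if "(x, y) \<in> ?R ^^ j" "(x, y) \<in> ?R ^^ k" for x y j k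
  proof (rule ccontr)
    assume "\<not> ?thesis"
    then have "odd (j + k)" by auto
    moreover have "(x, x) \<in> ?R ^^ (j + k)" using that(1) symk[OF that(2)] by (auto simp: relpow_add)
    ultimately show False using odd_closed_walk_cycle[of x "j + k" F] loop acyc by blast
  qed
  have col_iff: "col x = even k" if "(\<rho> x, x) \<in> ?R ^^ k" for x k
    unfolding col_def using par that by blast
  have "col (\<rho> x)" for x
  proof -
    have "\<rho> (\<rho> x) = \<rho> x" using same[OF \<rho>[of x]] by simp
    then show ?thesis using col_iff[of "\<rho> x" 0] by simp
  qed
  moreover have "(col x = col y) = even k" if "(x, y) \<in> ?R ^^ k" for x y k
  proof -
    have eq: "\<rho> x = \<rho> y" using that by (intro same) (auto intro: relpow_imp_rtrancl)
    obtain j where j: "(\<rho> x, x) \<in> ?R ^^ j" using sym[OF \<rho>[of x]] rtrancl_imp_relpow by blast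
    then have "(\<rho> y, y) \<in> ?R ^^ (j + k)" using that eq by (auto simp: relpow_add)
    then show ?thesis using col_iff[OF j] col_iff[of y "j + k"] by auto
  qed
  ultimately show ?thesis using \<rho> iff by (intro that)
qed

section \<open>Odd unicyclic graphs with a chord\<close>

locale chord_graph =
  fixes n u v :: nat and H G C :: "nat set set"
  assumes H: "simple_graph {1..n} H" and uni: "odd_unicyclic H"
    and C: "cycle_edges C" "C \<subseteq> H" and uC: "u \<in> \<Union>C" and vC: "v \<in> \<Union>C" and uv: "u \<noteq> v" "{u, v} \<notin> H"
    and degu: "graph_degree H u = 2" and degv: "graph_degree H v = 2"
    and G_def: "G = insert {u, v} H" and conn: "graph_connected {1..n} G"
begin

lemma cycle_unique: "cycle_edges D \<Longrightarrow> D \<subseteq> H \<Longrightarrow> D = C"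
  using uni C unfolding odd_unicyclic_def by blast

lemma card_C_odd: "odd (card C)"
  using uni C unfolding odd_unicyclic_def by blast

lemma C_vertices: "\<Union>C \<subseteq> {1..n}"
  using C(2) H by (auto simp: simple_graph_def)

lemma G_simple: "simple_graph {1..n} G"
proof -
  have "u \<in> {1..n}" "v \<in> {1..n}" using uC vC C_vertices by auto
  then show ?thesis using H uv(1) by (simp add: G_def simple_graph_def)
qed

lemma loop: "{x, x} \<notin> G"
  using simple_graphD(3)[OF G_simple, of x x] by blast

lemma HG: "H \<subseteq> G" by (auto simp: G_def)

text \<open>The two cycle edges at \<open>x\<close> already exhaust its degree.\<close>

lemma cycle_edges_at:
  assumes "x \<in> \<Union>C" "graph_degree H x = 2" "e \<in> H" "x \<in> e" shows "e \<in> C"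
proof -
  obtain p l where p: "cycle_param p l C" "p (Suc 0) = x" using cycle_edges_through[OF C(1) assms(1)] by blast
  have l: "3 \<le> l" using cycle_param_basic(1)[OF p(1)] .
  have ne: "p 0 \<noteq> p 2" "p 0 \<noteq> p 1" "p 1 \<noteq> p 2"
    using cycle_param_neq[OF p(1), of 0 2] cycle_param_neq[OF p(1), of 0 1] cycle_param_neq[OF p(1), of 1 2] l by auto
  let ?N = "{e \<in> H. x \<in> e}"
  have "{p 0, p 1} \<in> C" "{p 1, p 2} \<in> C"
    using cycle_param_basic(4)[OF p(1), of 0] cycle_param_basic(4)[OF p(1), of 1] by (auto simp: numeral_2_eq_2)
  moreover have "{p 0, p 1} \<noteq> {p 1, p 2}" using ne by (auto simp: doubleton_eq_iff)
  ultimately have sub: "{{p 0, p 1}, {p 1, p 2}} \<subseteq> ?N \<inter> C" "card {{p 0, p 1}, {p 1, p 2}} = 2"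
    using C(2) p(2) by auto
  have "finite ?N" using simple_graph_finite[OF H] by simp
  then have "{{p 0, p 1}, {p 1, p 2}} = ?N"
    using sub assms(2) by (intro card_subset_eq) (auto simp: graph_degree_def)
  then show ?thesis using sub(1) assms(3,4) by blast
qed

text \<open>Both chord ends lie on the cycle and so in \<open>W\<close>; the edge by which the
  connected graph \<open>G\<close> leaves \<open>W\<close> therefore belongs to
  \<open>H\<close>.\<close>

lemma crossing_edge:
  assumes "\<Union>C \<subseteq> W" "W \<subset> {1..n}"
  shows "\<exists>x\<in>W. \<exists>y\<in>{1..n} - W. {x, y} \<in> H"
proof -
  obtain b where b: "b \<in> {1..n}" "b \<notin> W" using assms(2) by blast
  have u: "u \<in> W" "u \<in> {1..n}" using uC assms(1) C_vertices by blast+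
  have "(u, b) \<in> {(x, y). {x, y} \<in> G}\<^sup>*" using conn b u by (auto simp: graph_connected_def)
  then have "b \<in> W \<or> (\<exists>x y. {x, y} \<in> G \<and> x \<in> W \<and> y \<notin> W)"
    by (induction rule: rtrancl_induct) (use u in auto)
  then obtain x y where xy: "{x, y} \<in> G" "x \<in> W" "y \<notin> W" using b by blast
  have "{x, y} \<noteq> {u, v}" using xy(3) uC vC assms(1) by (auto simp: doubleton_eq_iff)
  then have "{x, y} \<in> H" using xy(1) by (simp add: G_def)
  moreover have "y \<in> {1..n}" using simple_graphD(2)[OF G_simple xy(1)] .
  ultimately show ?thesis using xy by blast
qed

text \<open>The cycle has as many edges as vertices, and each vertex reached along a crossing edge
  brings at least one more edge. A largest vertex set with at least as many edges inside is
  therefore everything.\<close>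

lemma card_H_ge: "n \<le> card H"
proof -
  let ?Q = "\<lambda>W. \<Union>C \<subseteq> W \<and> W \<subseteq> {1..n} \<and> card W \<le> card {e \<in> H. e \<subseteq> W}"
  have fin: "finite H" by (rule simple_graph_finite[OF H])
  obtain p l where p: "cycle_param p l C" using cycle_edges_param[OF C(1)] by blast
  have "card C \<le> card {e \<in> H. e \<subseteq> \<Union>C}" using C(2) fin by (intro card_mono) auto
  then have Q0: "?Q (\<Union>C)" using cycle_param_card[OF p] C_vertices by simp
  have "\<exists>W. ?Q W \<and> (\<forall>W'. ?Q W' \<longrightarrow> card W' \<le> card W)"
  proof (rule ex_has_greatest_nat[of ?Q "\<Union>C" card "Suc n"])
    show "\<forall>W. ?Q W \<longrightarrow> card W < Suc n" using card_mono[of "{1..n}"] by (simp add: less_Suc_eq_le)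
  qed (rule Q0)
  then obtain W where W: "?Q W" "\<And>W'. ?Q W' \<Longrightarrow> card W' \<le> card W" by blast
  have finW: "finite W" using W(1) finite_subset by blast
  have "W = {1..n}"
  proof (rule ccontr)
    assume "W \<noteq> {1..n}"
    then obtain x y where xy: "x \<in> W" "y \<in> {1..n} - W" "{x, y} \<in> H" using crossing_edge[of W] W(1) by blast
    have "card (insert {x, y} {e \<in> H. e \<subseteq> W}) \<le> card {e \<in> H. e \<subseteq> insert y W}"
      using xy fin by (intro card_mono) auto
    moreover have "card (insert {x, y} {e \<in> H. e \<subseteq> W}) = Suc (card {e \<in> H. e \<subseteq> W})"
      using xy fin by (intro card_insert_disjoint) auto
    ultimately have "?Q (insert y W)" using W(1) xy finW by auto
    then have "card (insert y W) \<le> card W" by (rule W(2))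
    then show False using xy finW by simp
  qed
  then have "n \<le> card {e \<in> H. e \<subseteq> W}" using W(1) by simp
  also have "\<dots> \<le> card H" using fin by (intro card_mono) auto
  finally show ?thesis .
qed

lemma card_G: "card G = Suc (card H)"
  using uv(2) simple_graph_finite[OF H] by (simp add: G_def)

lemma branch_vertex:
  assumes "\<not> odd_cycle_graph {1..n} H"
  shows "\<exists>w a. w \<in> \<Union>C \<and> {w, a} \<in> H - C"
proof (cases "\<Union>C = {1..n}")
  case True
  have "H \<noteq> C"
  proof
    assume "H = C"
    moreover obtain p l where "cycle_param p l C" using cycle_edges_param[OF C(1)] by blast
    ultimately have "odd_cycle_graph {1..n} H"
      using C(1) True card_C_odd cycle_param_card[of p l C] by (simp add: odd_cycle_graph_def)
    then show False using assms by blast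
  qed
  then obtain e where e: "e \<in> H - C" using C(2) by blast
  then obtain i j where ij: "e = {i, j}" "i \<in> {1..n}" using simple_graph_edge[OF H] by blast
  have "i \<in> \<Union>C \<and> {i, j} \<in> H - C" using e ij True by simp
  then show ?thesis by (intro exI)
next
  case False
  then obtain x y where "x \<in> \<Union>C" "y \<in> {1..n} - \<Union>C" "{x, y} \<in> H"
    using crossing_edge[of "\<Union>C"] C_vertices by blast
  then show ?thesis by blast
qed

text \<open>Deleting \<open>w\<close> from the forest \<open>F\<close> separates its neighbours, since a path between two of
  them would close up to a cycle through \<open>w\<close>.\<close>

lemma separated:
  assumes F: "F \<subseteq> {e \<in> H. w \<notin> e}" and ab: "a \<noteq> b" "{w, a} \<in> H" "{w, b} \<in> H" and conn: "(a, b) \<in> (adj F)\<^sup>*"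
  obtains k where "{w, a} \<in> C" "card C = k + 2" "\<Union>C \<subseteq> insert w (insert a (\<Union>F))" "(a, b) \<in> adj F ^^ k"
proof -
  obtain f k where f: "1 \<le> k" "f 0 = a" "f k = b" "\<And>i. i < k \<Longrightarrow> (f i, f (Suc i)) \<in> adj F" "inj_on f {..k}"
    using shortest_path[OF conn ab(1)] by blast
  have sub: "f ` {..k} \<subseteq> insert a (\<Union>F)"
  proof
    fix x assume "x \<in> f ` {..k}"
    then obtain i where i: "i \<le> k" "x = f i" by auto
    show "x \<in> insert a (\<Union>F)"
    proof (cases i)
      case 0 then show ?thesis using i f(2) by simp
    next
      case (Suc j) then show ?thesis using f(4)[of j] i by (auto simp: adj_def)
    qed
  qed
  have "w \<noteq> a" using ab(2) loop HG by auto
  then have w: "w \<notin> f ` {..k}" using sub F by blast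
  have "\<exists>D. cycle_edges D \<and> D \<subseteq> H \<and> {w, f 0} \<in> D \<and> card D = k + 2 \<and> \<Union>D = insert w (f ` {..k})"
    using f F ab w by (intro path_cycle) (auto simp: adj_def)
  then obtain D where D: "cycle_edges D" "D \<subseteq> H" "{w, f 0} \<in> D" "card D = k + 2" "\<Union>D = insert w (f ` {..k})"
    by blast
  have "D = C" using cycle_unique D by blast
  moreover have "(a, b) \<in> adj F ^^ k" using walk_segment[of k f "adj F" 0 k] f(2-4) by simp
  ultimately show ?thesis using D f(2) sub by (intro that[of k]) auto
qed

lemma root_in:
  assumes "(x, y) \<in> (adj {e \<in> E. e \<inter> T = {}})\<^sup>*" "x \<in> {1..n} - T" "simple_graph {1..n} E"
  shows "y \<in> {1..n} - T"
  using assms(1,2)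
  by (induction rule: rtrancl_induct) (use simple_graphD[OF assms(3)] in \<open>auto simp: adj_def\<close>)

text \<open>Deleting \<open>T\<close> bounds the height by \<open>2 * n\<close> minus the number of
  remaining vertices and of components, so one component more than deleted vertices is needed. If a
  chord end \<open>x\<close> is not adjacent to \<open>w\<close>, deleting both leaves
  \<open>a\<close> and the two cycle neighbours of \<open>w\<close> in three components. Otherwise
  the chord ends are the cycle neighbours of \<open>w\<close>, and deleting \<open>w\<close> alone
  separates them from \<open>a\<close>.\<close>

lemma height_bound_not_cycle:
  fixes \<epsilon> :: "'k::field"
  assumes "\<not> odd_cycle_graph {1..n} H"
  shows "ideal_height (ring_of (xy_polys n)) (edge_ideal n \<epsilon> G) \<le> enat (n - 1)"
proof -
  obtain w a where wa: "w \<in> \<Union>C" "{w, a} \<in> H" "{w, a} \<notin> C" using branch_vertex[OF assms] by blast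
  have wu: "w \<noteq> u" "w \<noteq> v"
    using cycle_edges_at[OF uC degu wa(2)] cycle_edges_at[OF vC degv wa(2)] wa(3) by auto
  obtain p l where p: "cycle_param p l C" "p (Suc 0) = w" using cycle_edges_through[OF C(1) wa(1)] by blast
  have l: "3 \<le> l" by (rule cycle_param_basic(1)[OF p(1)])
  have ne: "p 0 \<noteq> p 2" using cycle_param_neq[OF p(1), of 0 2] l by simp
  have pC: "{w, p 0} \<in> C" "{w, p 2} \<in> C"
    using cycle_param_basic(4)[OF p(1), of 0] cycle_param_basic(4)[OF p(1), of 1] p(2)
    by (auto simp: numeral_2_eq_2 insert_commute)
  have an: "a \<noteq> p 0" "a \<noteq> p 2" using pC wa(3) by auto
  have in_n: "w \<in> {1..n}" "u \<in> {1..n}" "v \<in> {1..n}" "a \<in> {1..n}" "p 0 \<in> {1..n}" "p 2 \<in> {1..n}"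
    using wa uC vC C_vertices simple_graphD[OF H wa(2)] pC simple_graphD(2)[OF H, of w "p 0"]
      simple_graphD(2)[OF H, of w "p 2"] C(2) by auto
  show ?thesis
  proof (cases "\<exists>x\<in>{u, v}. {w, x} \<notin> H")
    case True
    then obtain x where x: "x \<in> {u, v}" "{w, x} \<notin> H" by blast
    let ?T = "{x, w}"
    let ?F = "{e \<in> H. e \<inter> ?T = {}}"
    have xC: "x \<in> \<Union>C" using x uC vC by auto
    have xw: "x \<noteq> w" using x(1) wu by auto
    have xU: "x \<notin> \<Union>?F" by auto
    have acyc: "False" if "cycle_edges D" "D \<subseteq> ?F" for D
    proof -
      have "D = C" using that by (intro cycle_unique) auto
      then show False using that(2) xC by blast
    qed
    obtain \<rho> col where bip: "\<And>x. (x, \<rho> x) \<in> (adj ?F)\<^sup>*" "\<And>x y. \<rho> x = \<rho> y \<longleftrightarrow> (x, y) \<in> (adj ?F)\<^sup>*"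
      "\<And>x. col (\<rho> x)" "\<And>x y k. (x, y) \<in> adj ?F ^^ k \<Longrightarrow> (col x = col y) = even k"
      by (rule acyclic_bipartition[of ?F]) (use loop HG acyc in auto)
    \<comment> \<open>A path between two neighbours of \<open>w\<close> would close up to the cycle,
      which passes through the deleted vertex \<open>x\<close>.\<close>
    have sep: "\<rho> b \<noteq> \<rho> c" if "b \<noteq> c" "{w, b} \<in> H" "{w, c} \<in> H" for b c
    proof
      assume "\<rho> b = \<rho> c"
      then have con: "(b, c) \<in> (adj ?F)\<^sup>*" by (simp add: bip(2))
      have "b \<noteq> x" using that x(2) by auto
      have "\<Union>C \<subseteq> insert w (insert b (\<Union>?F))"
        by (rule separated[OF _ that con]) auto
      then show False using xC xU xw \<open>b \<noteq> x\<close> by blast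
    qed
    have nb: "\<rho> (p 0) \<noteq> \<rho> (p 2)" "\<rho> a \<noteq> \<rho> (p 0)" "\<rho> a \<noteq> \<rho> (p 2)"
      using sep ne an pC C(2) wa(2) by auto
    have T: "?T \<subseteq> {1..n}" using x in_n by auto
    have mem: "{a, p 0, p 2} \<subseteq> {1..n} - ?T"
      using in_n x(2) wa(2) pC C(2) loop HG by auto
    have "ideal_height (ring_of (xy_polys n)) (edge_ideal n \<epsilon> G) \<le>
      enat (2 * n - (card ({1..n} - ?T) + card (\<rho> ` ({1..n} - ?T))))"
    proof (rule edge_ideal_height_le[OF G_simple T, of \<rho> col])
      fix i assume "i \<in> {1..n} - ?T"
      then have "\<rho> i \<in> {1..n} - ?T" using root_in[OF bip(1) _ H] by blast
      moreover have "\<rho> (\<rho> i) = \<rho> i" using bip(1)[of i] bip(2)[of i "\<rho> i"] by simp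
      ultimately show "\<rho> i \<in> {1..n} - ?T \<and> col (\<rho> i) \<and> \<rho> (\<rho> i) = \<rho> i" using bip(3) by blast
    next
      fix i j assume ij: "{i, j} \<in> G" "i \<notin> ?T" "j \<notin> ?T"
      then have "{i, j} \<noteq> {u, v}" using x(1) by (auto simp: doubleton_eq_iff)
      then have "(i, j) \<in> adj ?F" using ij by (auto simp: adj_def G_def)
      then show "\<rho> i = \<rho> j \<and> col i \<noteq> col j" using bip(2)[of i j] bip(4)[of i j 1] by auto
    qed
    moreover have "3 \<le> card (\<rho> ` ({1..n} - ?T))"
    proof -
      have "card (\<rho> ` {a, p 0, p 2}) = 3" using nb by auto
      moreover have "card (\<rho> ` {a, p 0, p 2}) \<le> card (\<rho> ` ({1..n} - ?T))"
        using mem by (intro card_mono image_mono) auto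
      ultimately show ?thesis by simp
    qed
    moreover have "card ({1..n} - ?T) = n - 2" "n \<ge> 2"
      using T xw card_mono[of "{1..n}" ?T] by (auto simp: card_Diff_subset)
    ultimately show ?thesis by (elim order_trans) simp
  next
    case False
    then have nbr: "{w, u} \<in> H" "{w, v} \<in> H" by auto
    let ?T = "{w}"
    let ?F = "{e \<in> H. e \<inter> ?T = {}}"
    have acyc: "False" if "cycle_edges D" "D \<subseteq> ?F" for D
    proof -
      have "D = C" using that by (intro cycle_unique) auto
      then show False using that(2) wa(1) by blast
    qed
    obtain \<rho> col where bip: "\<And>x. (x, \<rho> x) \<in> (adj ?F)\<^sup>*" "\<And>x y. \<rho> x = \<rho> y \<longleftrightarrow> (x, y) \<in> (adj ?F)\<^sup>*"
      "\<And>x. col (\<rho> x)" "\<And>x y k. (x, y) \<in> adj ?F ^^ k \<Longrightarrow> (col x = col y) = even k"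
      by (rule acyclic_bipartition[of ?F]) (use loop HG acyc in auto)
    have nbrC: "{w, u} \<in> C" "{w, v} \<in> C"
      using cycle_edges_at[OF uC degu nbr(1)] cycle_edges_at[OF vC degv nbr(2)] by auto
    have "x \<in> {p 0, p 2}" if "{w, x} \<in> C" for x
      using cycle_param_edge_at[OF p(1) that, of 0] p(2) loop HG C(2) that
      by (auto simp: numeral_2_eq_2 doubleton_eq_iff)
    then have uvp: "{u, v} = {p 0, p 2}" using nbrC uv(1) by blast
    have path: "(p 2, p (2 + i)) \<in> (adj ?F)\<^sup>*" if "2 + i \<le> l" for i
      using that
    proof (induction i)
      case (Suc i)
      have "w \<noteq> p (2 + i)" "w \<noteq> p (2 + Suc i)"
        using cycle_param_neq[OF p(1), of 1 "2 + i"] cycle_param_neq[OF p(1), of 1 "2 + Suc i"] p(2) Suc.prems by auto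
      then have "(p (2 + i), p (2 + Suc i)) \<in> adj ?F"
        using cycle_param_basic(4)[OF p(1), of "2 + i"] C(2) by (auto simp: adj_def)
      then show ?case using Suc by (auto intro: rtrancl_into_rtrancl)
    qed simp
    have pl: "p l = p 0" using cycle_param_basic(3)[OF p(1), of 0] by simp
    have con0: "(p 2, p 0) \<in> (adj ?F)\<^sup>*" 
    proof -
      have "2 + (l - 2) = l" using l by simp
      then show ?thesis using path[of "l - 2"] pl by simp
    qed
    then have "\<rho> (p 2) = \<rho> (p 0)" by (simp add: bip(2))
    then have uv_same: "\<rho> u = \<rho> v" using uvp by (auto simp: doubleton_eq_iff)
    then have con: "(u, v) \<in> (adj ?F)\<^sup>*" by (simp add: bip(2))
    \<comment> \<open>The chord survives this deletion, so its ends need different colours: the path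
      joining them is the odd cycle without two edges, hence of odd length.\<close>
    have uv_col: "col u \<noteq> col v"
    proof (rule separated[OF _ uv(1) nbr con])
      fix k assume k: "card C = k + 2" "(u, v) \<in> adj ?F ^^ k"
      then have "odd k" using card_C_odd by auto
      then show ?thesis using bip(4)[OF k(2)] by simp
    qed auto
    have au: "a \<noteq> u" "a \<noteq> v" using wa(3) nbrC by auto
    have a_sep: "\<rho> a \<noteq> \<rho> u"
    proof
      assume "\<rho> a = \<rho> u"
      then have con': "(a, u) \<in> (adj ?F)\<^sup>*" by (simp add: bip(2))
      have "{w, a} \<in> C" by (rule separated[OF _ au(1) wa(2) nbr(1) con']) auto
      then show False using wa(3) by blast
    qed
    have T: "?T \<subseteq> {1..n}" using in_n by auto
    have mem: "{a, u} \<subseteq> {1..n} - ?T" using in_n wu simple_graphD(3)[OF H wa(2)] by auto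
    have "ideal_height (ring_of (xy_polys n)) (edge_ideal n \<epsilon> G) \<le>
      enat (2 * n - (card ({1..n} - ?T) + card (\<rho> ` ({1..n} - ?T))))"
    proof (rule edge_ideal_height_le[OF G_simple T, of \<rho> col])
      fix i assume "i \<in> {1..n} - ?T"
      then have "\<rho> i \<in> {1..n} - ?T" using root_in[OF bip(1) _ H] by blast
      moreover have "\<rho> (\<rho> i) = \<rho> i" using bip(1)[of i] bip(2)[of i "\<rho> i"] by simp
      ultimately show "\<rho> i \<in> {1..n} - ?T \<and> col (\<rho> i) \<and> \<rho> (\<rho> i) = \<rho> i" using bip(3) by blast
    next
      fix i j assume ij: "{i, j} \<in> G" "i \<notin> ?T" "j \<notin> ?T"
      show "\<rho> i = \<rho> j \<and> col i \<noteq> col j"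
      proof (cases "{i, j} = {u, v}")
        case True
        then show ?thesis using uv_same uv_col by (auto simp: doubleton_eq_iff)
      next
        case False
        then have "(i, j) \<in> adj ?F" using ij by (auto simp: adj_def G_def)
        then show ?thesis using bip(2)[of i j] bip(4)[of i j 1] by auto
      qed
    qed
    moreover have "2 \<le> card (\<rho> ` ({1..n} - ?T))"
    proof -
      have "card (\<rho> ` {a, u}) = 2" using a_sep by auto
      moreover have "card (\<rho> ` {a, u}) \<le> card (\<rho> ` ({1..n} - ?T))"
        using mem by (intro card_mono image_mono) auto
      ultimately show ?thesis by simp
    qed
    moreover have "card ({1..n} - ?T) = n - 1" "n \<ge> 1"
      using in_n by auto
    ultimately show ?thesis by (elim order_trans) simp
  qed
qed

lemma not_aci_not_cycle:
  fixes \<epsilon> :: "'k::field"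
  assumes "\<not> odd_cycle_graph {1..n} H"
  shows "\<not> almost_complete_intersection n (edge_ideal n \<epsilon> G)"
proof
  assume "almost_complete_intersection n (edge_ideal n \<epsilon> G)"
  then have "enat (card G) = ideal_height (ring_of (xy_polys n)) (edge_ideal n \<epsilon> G) + 1"
    by (simp add: almost_complete_intersection_def mu_edge_ideal[OF G_simple] xy_ring_eq)
  also have "\<dots> \<le> enat (n - 1) + 1" by (rule add_right_mono[OF height_bound_not_cycle[OF assms]])
  also have "\<dots> = enat (n - 1 + 1)" by (simp add: one_enat_def)
  finally have "card G \<le> n - 1 + 1" by simp
  moreover have "1 \<le> n" using uC C_vertices by auto
  ultimately show False using card_G card_H_ge by simp
qed

end

section \<open>Primes over the edge ideal of an odd cycle\<close>

text \<open>Ideals contracted from the local ring at \<open>P\<close>. Stated for these, the walk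
  relations apply both to \<open>P\<close> itself and to the contraction \<open>loc_closure\<close>
  of the cycle ideal.\<close>

definition cancels :: "'a::idom set \<Rightarrow> 'a set \<Rightarrow> 'a set \<Rightarrow> bool" where
  "cancels S P I \<longleftrightarrow> ideal_in S I \<and> (\<forall>s\<in>S - P. \<forall>f\<in>S. s * f \<in> I \<longrightarrow> f \<in> I)"

definition loc_closure :: "'a::idom set \<Rightarrow> 'a set \<Rightarrow> 'a set \<Rightarrow> 'a set" where
  "loc_closure S P I = {f \<in> S. \<exists>s\<in>S - P. s * f \<in> I}"

lemma cancels_prime: "prime_in S P \<Longrightarrow> cancels S P P"
  unfolding cancels_def using prime_inD by blast

lemma loc_closure:
  assumes S: "subdom S" and P: "prime_in S P" and I: "ideal_in S I"
  shows "cancels S P (loc_closure S P I)" "I \<subseteq> loc_closure S P I"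
proof -
  have unit: "s * t \<in> S - P" if "s \<in> S - P" "t \<in> S - P" for s t
    using that prime_inD(3)[OF P] subdomD(4)[OF S] by blast
  have one: "1 \<in> S - P" using subdomD(2)[OF S] prime_inD(2)[OF P] by blast
  show "I \<subseteq> loc_closure S P I"
  proof
    fix f assume "f \<in> I"
    then have "f \<in> S" "1 * f \<in> I" using ideal_inD(1)[OF I] by auto
    then show "f \<in> loc_closure S P I" unfolding loc_closure_def using one by blast
  qed
  then have zero: "0 \<in> loc_closure S P I" using ideal_inD(2)[OF I] by blast
  show "cancels S P (loc_closure S P I)"
    unfolding cancels_def ideal_in_def
  proof (intro conjI ballI impI)
    fix f g assume "f \<in> loc_closure S P I" "g \<in> loc_closure S P I"
    then obtain s t where st: "f \<in> S" "g \<in> S" "s \<in> S - P" "t \<in> S - P" "s * f \<in> I" "t * g \<in> I"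
      by (auto simp: loc_closure_def)
    have "t * (s * f) + s * (t * g) \<in> I"
      using st(3,4) by (intro ideal_inD(3)[OF I] ideal_inD(4)[OF I _ st(5)] ideal_inD(4)[OF I _ st(6)]) auto
    then have "(s * t) * (f + g) \<in> I" by (simp add: algebra_simps)
    then show "f + g \<in> loc_closure S P I"
      unfolding loc_closure_def using unit[OF st(3,4)] subdomD(3)[OF S st(1,2)] by blast
  next
    fix r f assume r: "r \<in> S" "f \<in> loc_closure S P I"
    then obtain s where s: "f \<in> S" "s \<in> S - P" "s * f \<in> I" by (auto simp: loc_closure_def)
    then have "s * (r * f) \<in> I" using ideal_inD(4)[OF I r(1) s(3)] by (simp add: mult_ac)
    then show "r * f \<in> loc_closure S P I"
      unfolding loc_closure_def using s(2) subdomD(4)[OF S r(1) s(1)] by blast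
  next
    fix t f assume t: "t \<in> S - P" "f \<in> S" "t * f \<in> loc_closure S P I"
    then obtain s where s: "s \<in> S - P" "s * (t * f) \<in> I" by (auto simp: loc_closure_def)
    then have "(s * t) * f \<in> I" by (simp add: mult.assoc)
    then show "f \<in> loc_closure S P I" unfolding loc_closure_def using unit[OF s(1) t(1)] t(2) by blast
  qed (use zero in \<open>auto simp: loc_closure_def\<close>)
qed

text \<open>The determinant of two vectors, which expresses that they are parallel.\<close>

definition par_poly :: "nat \<Rightarrow> nat \<Rightarrow> 'k::field xy_poly" where
  "par_poly i j = Var (X i) * Var (Y j) - Var (X j) * Var (Y i)"

lemma is_hom_eval: "is_hom (subst (\<lambda>c. c) \<beta>)"
  by (rule is_hom_subst[OF is_hom_id])

lemma edge_poly_nonzero: "edge_poly \<epsilon> i j \<noteq> 0"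
proof
  assume z: "edge_poly \<epsilon> i j = 0"
  let ?h = "subst (\<lambda>c. c) (\<lambda>v. case v of X _ \<Rightarrow> 1 | Y _ \<Rightarrow> 0)"
  have "?h (edge_poly \<epsilon> i j) = 1"
    by (simp add: edge_poly_def is_homD[OF is_hom_eval] subst_Var[OF is_hom_id])
  then show False using z by (simp add: is_homD[OF is_hom_eval])
qed

lemma par_poly_nonzero: "i \<noteq> j \<Longrightarrow> par_poly i j \<noteq> (0 :: 'k::field xy_poly)"
proof
  assume "i \<noteq> j" and z: "par_poly i j = (0 :: 'k xy_poly)"
  let ?h = "subst (\<lambda>c. c) (\<lambda>v. if v = X i \<or> v = Y j then 1 else 0) :: 'k xy_poly \<Rightarrow> 'k"
  have "?h (par_poly i j) = 1"
    using \<open>i \<noteq> j\<close> by (simp add: par_poly_def is_homD[OF is_hom_eval] subst_Var[OF is_hom_id])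
  then show False using z by (simp add: is_homD[OF is_hom_eval])
qed

lemma cycle_param_cancel:
  assumes p: "cycle_param p l C" and eq: "p (a + k) = p (b + k)" shows "p a = p b"
proof -
  have "p (a + k + (k * l - k)) = p (b + k + (k * l - k))"
    using eq unfolding cycle_param_eq_iff[OF p] by (metis mod_add_left_eq)
  moreover have "k \<le> k * l" using cycle_param_basic(1)[OF p] by (cases l) auto
  then have "a + k + (k * l - k) = a + k * l" "b + k + (k * l - k) = b + k * l" by auto
  ultimately show ?thesis by (simp add: cycle_param_eq_iff[OF p])
qed

locale odd_cycle =
  fixes n :: nat and C :: "nat set set" and \<epsilon> :: "'k::field"
  assumes C: "simple_graph {1..n} C" and verts: "\<Union>C = {1..n}" and odd_n: "odd n"
    and eps: "\<epsilon> * \<epsilon> = 1" and two: "(2 :: 'k) \<noteq> 0"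
begin

abbreviation "S \<equiv> xy_polys n :: 'k xy_poly set"
abbreviation "I \<equiv> edge_ideal n \<epsilon> C"
abbreviation "edge i j \<equiv> edge_poly \<epsilon> i j"
abbreviation "par i j \<equiv> par_poly i j :: 'k xy_poly"
abbreviation "x i \<equiv> Var (X i) :: 'k xy_poly"
abbreviation "y i \<equiv> Var (Y i) :: 'k xy_poly"

lemma S: "subdom S" by (rule subdom_polys)

lemma CstE: "Cst \<epsilon> * (Cst \<epsilon> * f) = (f :: 'k xy_poly)"
proof -
  have "Cst \<epsilon> * Cst \<epsilon> = (1 :: 'k xy_poly)"
    using Cst_simps(4)[of \<epsilon> \<epsilon>] eps by (simp del: Cst_simps(4))
  then show ?thesis by (simp add: mult.assoc[symmetric])
qed

lemma I: "ideal_in S I" by (rule edge_ideal_ideal[OF C])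

lemma param_range: "cycle_param p n C \<Longrightarrow> p i \<in> {1..n}"
  using cycle_param_basic(4)[of p n C i] verts by blast

lemma xS: "i \<in> {1..n} \<Longrightarrow> x i \<in> S" "i \<in> {1..n} \<Longrightarrow> y i \<in> S"
  by auto

lemma edgeS: "i \<in> {1..n} \<Longrightarrow> j \<in> {1..n} \<Longrightarrow> edge i j \<in> S" "i \<in> {1..n} \<Longrightarrow> j \<in> {1..n} \<Longrightarrow> par i j \<in> S"
  by (auto simp: edge_poly_def par_poly_def)

lemma edge_in_I: "cycle_param p n C \<Longrightarrow> edge (p i) (p (Suc i)) \<in> I"
  using edge_ideal_gen[OF C] cycle_param_basic(4) by blast

text \<open>Two vectors orthogonal to the same vector are parallel, after multiplication by a
  coordinate of that vector. The second identity uses that \<open>\<epsilon>\<close> is its own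
  inverse.\<close>

lemma x_par: "x m * par a c = y c * edge a m - y a * edge m c"
  and y_par: "y m * par a c = Cst \<epsilon> * (x a * edge m c - x c * edge a m)"
proof -
  show "x m * par a c = y c * edge a m - y a * edge m c"
    by (simp add: edge_poly_def par_poly_def algebra_simps)
  have "Cst \<epsilon> * (x a * edge m c - x c * edge a m) =
      Cst \<epsilon> * (Cst \<epsilon> * (x a * (y m * y c))) - Cst \<epsilon> * (Cst \<epsilon> * (x c * (y a * y m)))"
    by (simp add: edge_poly_def algebra_simps)
  then show "y m * par a c = Cst \<epsilon> * (x a * edge m c - x c * edge a m)"
    unfolding CstE by (simp add: par_poly_def algebra_simps)
qed

lemma x_edge: "x m * edge a c = x a * edge m c - Cst \<epsilon> * (y c * par a m)"
  and y_edge: "y m * edge a c = y a * edge m c + x c * par a m"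
  by (simp_all add: edge_poly_def par_poly_def algebra_simps)

lemma par_multiples:
  assumes b: "ideal_in S b" and "edge a m \<in> b" "edge m c \<in> b" and v: "a \<in> {1..n}" "m \<in> {1..n}" "c \<in> {1..n}"
  shows "x m * par a c \<in> b" "y m * par a c \<in> b"
  unfolding x_par y_par using assms
  by (auto intro!: ideal_in_diff[OF S b] ideal_inD(4)[OF b])

definition vanishes :: "'k xy_poly set \<Rightarrow> nat \<Rightarrow> bool" where
  "vanishes P i \<longleftrightarrow> x i \<in> P \<and> y i \<in> P"

text \<open>Orthogonality and parallelism alternate along the walk. Each step divides by a
  coordinate of the vertex just passed, so only interior vertices must be nonzero modulo
  \<open>P\<close>.\<close>

lemma walk_relation:
  assumes p: "cycle_param p n C" and b: "cancels S P b" and k: "1 \<le> k"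
    and e: "\<And>i. edge (p i) (p (Suc i)) \<in> b"
    and nz: "\<And>i. a < i \<Longrightarrow> i < a + k \<Longrightarrow> \<not> vanishes P (p i)"
  shows "if odd k then edge (p a) (p (a + k)) \<in> b else par (p a) (p (a + k)) \<in> b"
  using k nz
proof (induction k rule: dec_induct)
  case base
  then show ?case using e[of a] by simp
next
  case (step k)
  note id = b[unfolded cancels_def, THEN conjunct1]
  have cancel: "f \<in> b" if "x m * f \<in> b" "y m * f \<in> b" "\<not> vanishes P m" "f \<in> S" "m \<in> {1..n}" for m f
    using b that xS[of m] unfolding cancels_def vanishes_def by blast
  let ?m = "p (a + k)" and ?c = "p (a + Suc k)"
  have IH: "if odd k then edge (p a) ?m \<in> b else par (p a) ?m \<in> b" using step by simp
  have v: "p a \<in> {1..n}" "?m \<in> {1..n}" "?c \<in> {1..n}" using param_range[OF p] by blast+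
  have emc: "edge ?m ?c \<in> b" using e[of "a + k"] by simp
  have nzm: "\<not> vanishes P ?m" using step by simp
  show ?case
  proof (cases "odd k")
    case True
    then have "x ?m * par (p a) ?c \<in> b" "y ?m * par (p a) ?c \<in> b"
      using IH par_multiples[OF id _ emc v] by simp_all
    then have "par (p a) ?c \<in> b" using cancel[OF _ _ nzm] edgeS v by blast
    then show ?thesis using True by simp
  next
    case False
    then have pr: "par (p a) ?m \<in> b" using IH by simp
    have "x ?m * edge (p a) ?c \<in> b" "y ?m * edge (p a) ?c \<in> b"
      unfolding x_edge[of ?m "p a" ?c] y_edge[of ?m "p a" ?c] using pr emc v
      by (auto intro!: ideal_in_diff[OF S id] ideal_inD(3,4)[OF id])
    then have "edge (p a) ?c \<in> b" using cancel[OF _ _ nzm] edgeS v by blast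
    then show ?thesis using False by simp
  qed
qed

text \<open>Between two vertices both of whose coordinates belong to an independent set \<open>A\<close>
  there is a vertex none of whose coordinates does.\<close>

lemma card_independent_le:
  assumes p: "cycle_param p n C" and P: "prime_in S P" and IP: "I \<subseteq> P"
    and A: "A \<subseteq> xy_vars n" "P \<inter> polys A \<subseteq> {0}"
  shows "card A \<le> n"
proof -
  define B where "B = {i \<in> {1..n}. X i \<in> A \<and> Y i \<in> A}"
  define N where "N = {i \<in> {1..n}. X i \<notin> A \<and> Y i \<notin> A}"
  \<comment> \<open>The first later vertex with both or no coordinates in \<open>A\<close>; it
    exists because a full turn comes back to \<open>B\<close>.\<close>
  define nxt where "nxt i = (LEAST k. 1 \<le> k \<and> p (i + k) \<in> B \<union> N)" for i
  define J where "J = {i. i < n \<and> p i \<in> B}"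
  have BN: "B \<inter> N = {}" by (auto simp: B_def N_def)
  have ex: "1 \<le> n \<and> p (i + n) \<in> B \<union> N" if "p i \<in> B" for i
    using that cycle_param_basic(1,3)[OF p] by auto
  have nxt: "1 \<le> nxt i" "p (i + nxt i) \<in> B \<union> N" "nxt i \<le> n" if "p i \<in> B" for i
    using LeastI[of "\<lambda>k. 1 \<le> k \<and> p (i + k) \<in> B \<union> N", OF ex[OF that]]
      Least_le[of "\<lambda>k. 1 \<le> k \<and> p (i + k) \<in> B \<union> N", OF ex[OF that]] by (auto simp: nxt_def)
  have nxt_least: "p (i + k) \<notin> B \<union> N" if "1 \<le> k" "k < nxt i" for i k
    using not_less_Least[of k "\<lambda>k. 1 \<le> k \<and> p (i + k) \<in> B \<union> N"] that by (auto simp: nxt_def)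
  have varA: "Var v \<notin> P" if "v \<in> A" for v
  proof
    assume "Var v \<in> P"
    then have "Var v = (0 :: 'k xy_poly)" using A(2) that by auto
    then show False by (simp add: Var_def) (metis lookup_single_eq lookup_zero zero_neq_one)
  qed
  \<comment> \<open>If the walk ended in \<open>B\<close>, all vectors passed would be nonzero
    modulo \<open>P\<close>, and the walk relation would put a nonzero polynomial in the variables
    of \<open>A\<close> into \<open>P\<close>. For an even walk the ends are distinct, as a full
    turn is odd.\<close>
  have inN: "p (i + nxt i) \<in> N" if i: "p i \<in> B" for i
  proof (rule ccontr)
    assume "\<not> ?thesis"
    then have iB: "p (i + nxt i) \<in> B" using nxt(2)[OF i] by blast
    have nz: "\<not> vanishes P (p j)" if "i < j" "j < i + nxt i" for j
    proof -
      have "p (i + (j - i)) \<notin> B \<union> N" using that by (intro nxt_least) auto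
      then have "p j \<notin> N" using that by simp
      then have "X (p j) \<in> A \<or> Y (p j) \<in> A" using param_range[OF p, of j] by (auto simp: N_def)
      then show ?thesis using varA by (auto simp: vanishes_def)
    qed
    have rel: "if odd (nxt i) then edge (p i) (p (i + nxt i)) \<in> P else par (p i) (p (i + nxt i)) \<in> P"
      using edge_in_I[OF p] IP by (intro walk_relation[OF p cancels_prime[OF P] nxt(1)[OF i] _ nz]) auto
    have memA: "edge (p i) (p (i + nxt i)) \<in> polys A" "par (p i) (p (i + nxt i)) \<in> polys A"
      using i iB by (auto simp: edge_poly_def par_poly_def B_def)
    show False
    proof (cases "odd (nxt i)")
      case True
      then show False using rel memA(1) A(2) edge_poly_nonzero by auto
    next
      case False
      then have "nxt i < n" using nxt(3)[OF i] odd_n by (metis le_neq_implies_less)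
      then have "p i \<noteq> p (i + nxt i)"
        using cycle_param_neq[OF p, of i "i + nxt i"] nxt(1)[OF i] by simp
      then show False using False rel memA(2) A(2) par_poly_nonzero by auto
    qed
  qed
  \<comment> \<open>If two starting points led to the same vertex, the nearer one would already have
    stopped the walk from the other.\<close>
  have le: "i = j" if "i \<in> J" "j \<in> J" "p (i + nxt i) = p (j + nxt j)" "nxt i \<le> nxt j" for i j
  proof -
    have "p (i + nxt i) = p ((j + (nxt j - nxt i)) + nxt i)" using that(3,4) by simp
    then have eq: "p i = p (j + (nxt j - nxt i))" by (rule cycle_param_cancel[OF p])
    have "nxt j = nxt i"
    proof (rule ccontr)
      assume "nxt j \<noteq> nxt i"
      then have "p (j + (nxt j - nxt i)) \<notin> B \<union> N"
        using that nxt(1)[of i] by (intro nxt_least) (auto simp: J_def)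
      then show False using eq that(1) by (auto simp: J_def)
    qed
    then have "p i = p j" using eq by simp
    then show ?thesis using inj_onD[OF cycle_param_basic(2)[OF p]] that(1,2) by (auto simp: J_def)
  qed
  have "inj_on (\<lambda>i. p (i + nxt i)) J"
  proof (rule inj_onI)
    fix i j assume "i \<in> J" "j \<in> J" "p (i + nxt i) = p (j + nxt j)"
    then show "i = j" using le[of i j] le[of j i] by (cases "nxt i \<le> nxt j") auto
  qed
  moreover have "(\<lambda>i. p (i + nxt i)) ` J \<subseteq> N" using inN by (auto simp: J_def)
  moreover have "finite N" by (simp add: N_def)
  ultimately have "card J \<le> card N" by (rule card_inj_on_le)
  moreover have "B \<subseteq> p ` J"
  proof
    fix i assume i: "i \<in> B"
    then have "i \<in> p ` {..<n}" using verts cycle_param_Union[OF p] by (simp add: B_def)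
    then obtain m where "m < n" "i = p m" by blast
    then show "i \<in> p ` J" using i by (simp add: J_def)
  qed
  then have "card B \<le> card J" by (intro surj_card_le) (auto simp: J_def)
  ultimately have BleN: "card B \<le> card N" by simp
  define U where "U = {i \<in> {1..n}. X i \<in> A}"
  define W where "W = {i \<in> {1..n}. Y i \<in> A}"
  have fin: "finite U" "finite W" by (simp_all add: U_def W_def)
  have "A = X ` U \<union> Y ` W"
  proof (intro equalityI subsetI)
    fix v assume "v \<in> A"
    then show "v \<in> X ` U \<union> Y ` W" using A(1) by (cases v) (auto simp: U_def W_def)
  qed (auto simp: U_def W_def)
  then have "card A = card (X ` U) + card (Y ` W)" using fin by (simp only:) (rule card_Un_disjoint, auto)
  also have "\<dots> = card U + card W" by (simp add: card_image inj_on_def)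
  also have "\<dots> = card (U \<union> W) + card (U \<inter> W)" by (rule card_Un_Int[OF fin])
  also have "U \<inter> W = B" by (auto simp: U_def W_def B_def)
  also have "card (U \<union> W) + card B \<le> card (U \<union> W) + card N" using BleN by simp
  also have "\<dots> = card ((U \<union> W) \<union> N)"
    using fin by (subst card_Un_disjoint) (auto simp: U_def W_def N_def)
  also have "(U \<union> W) \<union> N = {1..n}" by (auto simp: U_def W_def N_def)
  finally show ?thesis by simp
qed

lemma height_ge:
  assumes p: "cycle_param p n C" and P: "prime_in S P" and IP: "I \<subseteq> P"
  shows "enat n \<le> prime_height (ring_of S) P"
proof -
  obtain A where A: "A \<subseteq> xy_vars n" "P \<inter> polys A \<subseteq> {0}"
    "\<And>z. z \<in> xy_vars n - A \<Longrightarrow> \<not> P \<inter> polys (insert z A) \<subseteq> {0}"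
    "prime_height (ring_of S) P = enat (card (xy_vars n) - card A)"
    using prime_height_eq[OF finite_xy_vars P] by blast
  have "card A \<le> n" by (rule card_independent_le[OF p P IP A(1,2)])
  then show ?thesis by (simp add: A(4) card_xy_vars)
qed

text \<open>At \<open>t = 0\<close> the family is the identity, so the pullback \<open>Q\<close>
  lies in \<open>P\<close>; it still contains the cycle ideal but not \<open>h\<close>. Primes over
  the cycle ideal have height at least \<open>n\<close>, so the strictly larger \<open>P\<close>
  gains one.\<close>

lemma deformation:
  fixes \<beta> :: "xy_var \<Rightarrow> 'k xy_poly poly"
  assumes p: "cycle_param p n C" and P: "prime_in S P" and IP: "I \<subseteq> P"
    and \<beta>: "\<And>v. v \<in> xy_vars n \<Longrightarrow> \<beta> v \<in> coeffs_in S" "\<And>v. v \<in> xy_vars n \<Longrightarrow> coeff (\<beta> v) 0 = Var v"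
    and e: "\<And>i. into_poly \<beta> (edge (p i) (p (Suc i))) \<in> coeffs_in P"
    and h: "h \<in> P" "into_poly \<beta> h \<notin> coeffs_in P"
  shows "enat (Suc n) \<le> prime_height (ring_of S) P"
proof -
  define Q where "Q = {f \<in> S. into_poly \<beta> f \<in> coeffs_in P}"
  have Q: "prime_in S Q" unfolding Q_def by (rule prime_pull[OF P \<beta>(1)])
  have "Q \<subseteq> P"
  proof
    fix f assume f: "f \<in> Q"
    have "poly (into_poly \<beta> f) 0 = f"
      by (rule is_hom_eqI[OF is_hom_comp[OF is_hom_poly_eval is_hom_into_poly] is_hom_id, of _ _ "xy_vars n"])
        (use f \<beta>(2) in \<open>auto simp: Q_def poly_0_coeff_0\<close>)
    then have "coeff (into_poly \<beta> f) 0 = f" by (simp add: poly_0_coeff_0)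
    moreover have "coeff (into_poly \<beta> f) 0 \<in> P" using f by (simp add: Q_def coeffs_in_def)
    ultimately show "f \<in> P" by simp
  qed
  then have sub: "Q \<subset> P" using h by (auto simp: Q_def)
  have IQ: "I \<subseteq> Q"
  proof (rule edge_ideal_least[OF C prime_inD(1)[OF Q]])
    fix i j assume ij: "{i, j} \<in> C"
    then obtain k where k: "{i, j} = {p k, p (Suc k)}" using p by (auto simp: cycle_param_def)
    then have "edge i j = edge (p k) (p (Suc k))"
      by (auto simp: doubleton_eq_iff edge_poly_commute)
    moreover have "edge (p k) (p (Suc k)) \<in> Q"
      using e[of k] edgeS param_range[OF p] by (simp add: Q_def)
    ultimately show "edge i j \<in> Q" by simp
  qed
  show ?thesis by (rule prime_height_Suc_le[OF S P Q sub height_ge[OF p Q IQ]])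
qed

lemma coeffs_in_pCons: "0 \<in> D \<Longrightarrow> [:a, b:] \<in> coeffs_in D \<longleftrightarrow> a \<in> D \<and> b \<in> D"
proof
  assume "[:a, b:] \<in> coeffs_in D"
  then have "coeff [:a, b:] 0 \<in> D \<and> coeff [:a, b:] (Suc 0) \<in> D" by (simp only: coeffs_in_def mem_Collect_eq)
  then show "a \<in> D \<and> b \<in> D" by simp
qed (auto simp: coeffs_in_def coeff_pCons split: nat.split)

text \<open>The neighbours of the zero vector are parallel modulo \<open>P\<close>, so some
  direction \<open>(c, d)\<close> is orthogonal to both, and the zero vector can be moved along
  it.\<close>

lemma vertex_deformation:
  assumes p: "cycle_param p n C" and P: "prime_in S P" and IP: "I \<subseteq> P"
    and zero: "vanishes P (p (Suc 0))" and pr: "par (p 0) (p 2) \<in> P"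
  shows "enat (Suc n) \<le> prime_height (ring_of S) P"
proof -
  note J = prime_inD(1)[OF P]
  let ?u = "p (Suc 0)"
  have v: "p i \<in> {1..n}" for i by (rule param_range[OF p])
  have epsP: "f \<in> P" if "Cst \<epsilon> * f \<in> P" for f
    using ideal_inD(4)[OF J polys_Cst that, of \<epsilon>] by (simp add: CstE)
  have "\<exists>c d. c \<in> S \<and> d \<in> S \<and> x (p 0) * c + Cst \<epsilon> * (y (p 0) * d) \<in> P \<and>
      x (p 2) * c + Cst \<epsilon> * (y (p 2) * d) \<in> P \<and> (c \<notin> P \<or> d \<notin> P)"
  proof (cases "vanishes P (p 0) \<and> vanishes P (p 2)")
    case True
    then show ?thesis
      using prime_inD(2)[OF P] by (intro exI[of _ 1] exI[of _ 0]) (simp add: vanishes_def)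
  next
    case False
    \<comment> \<open>The direction orthogonal to a nonzero neighbour; by parallelism it is
      orthogonal to the other one as well.\<close>
    have perp: "x i * (- (Cst \<epsilon> * y j)) + Cst \<epsilon> * (y i * x j) = - (Cst \<epsilon> * par i j)" for i j
      by (simp add: par_poly_def algebra_simps)
    have "par (p 2) (p 0) = - par (p 0) (p 2)" by (simp add: par_poly_def)
    then have pr': "par (p i) (p j) \<in> P" if "i \<in> {0, 2}" "j \<in> {0, 2}" for i j
      using that pr ideal_in_uminus[OF S J pr] ideal_inD(2)[OF J] by (auto simp: par_poly_def)
    obtain j where j: "j \<in> {0, 2}" "\<not> vanishes P (p j)" using False by auto
    have "x (p i) * (- (Cst \<epsilon> * y (p j))) + Cst \<epsilon> * (y (p i) * x (p j)) \<in> P" if "i \<in> {0, 2}" for i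
      unfolding perp using pr'[OF that j(1)] by (intro ideal_in_uminus[OF S J] ideal_inD(4)[OF J polys_Cst])
    moreover have "- (Cst \<epsilon> * y (p j)) \<notin> P \<or> x (p j) \<notin> P"
      using j(2) epsP ideal_in_uminus[OF S J, of "- (Cst \<epsilon> * y (p j))"] by (auto simp: vanishes_def)
    moreover have "- (Cst \<epsilon> * y (p j)) \<in> S" "x (p j) \<in> S" using v[of j] by auto
    ultimately show ?thesis by blast
  qed
  then obtain c d where cd: "c \<in> S" "d \<in> S" "x (p 0) * c + Cst \<epsilon> * (y (p 0) * d) \<in> P"
    "x (p 2) * c + Cst \<epsilon> * (y (p 2) * d) \<in> P" "c \<notin> P \<or> d \<notin> P" by blast
  define \<beta> where "\<beta> w = (if w = X ?u then [:Var w, c:] else if w = Y ?u then [:Var w, d:] else [:Var w:])" for w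
  have zP: "0 \<in> P" by (rule ideal_inD(2)[OF J])
  have edge_u: "into_poly \<beta> (edge i ?u) = [:edge i ?u, x i * c + Cst \<epsilon> * (y i * d):]" if "i \<noteq> ?u" for i
    using that by (simp add: edge_poly_def into_poly_hom \<beta>_def algebra_simps)
  have key: "into_poly \<beta> (edge i j) \<in> coeffs_in P" if e: "{i, j} \<in> C" and eP: "edge i j \<in> P" for i j
  proof (cases "?u \<in> {i, j}")
    case False
    then have "into_poly \<beta> (edge i j) = [:edge i j:]" by (auto simp: edge_poly_def into_poly_hom \<beta>_def)
    then show ?thesis using eP zP by (simp add: const_in_coeffs_in)
  next
    case True
    have ne: "i \<noteq> j" using simple_graphD(3)[OF C e] .
    from cycle_param_edge_at[OF p e True] obtain k where k: "{i, j} = {p k, ?u}" "k \<in> {0, 2}"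
      by (auto simp: numeral_2_eq_2 insert_commute)
    then have ed: "edge i j = edge (p k) ?u" "p k \<noteq> ?u" using ne by (auto simp: doubleton_eq_iff edge_poly_commute)
    show ?thesis
      unfolding ed(1) edge_u[OF ed(2)] coeffs_in_pCons[OF zP] using eP ed(1) k(2) cd(3,4) by auto
  qed
  show ?thesis
  proof (rule deformation[OF p P IP, of \<beta>])
    show "\<beta> w \<in> coeffs_in S" "coeff (\<beta> w) 0 = Var w" if "w \<in> xy_vars n" for w
      using that cd by (auto simp: \<beta>_def coeffs_in_pCons const_in_coeffs_in)
    show "into_poly \<beta> (edge (p i) (p (Suc i))) \<in> coeffs_in P" for i
      using cycle_param_basic(4)[OF p] edge_in_I[OF p] IP by (intro key) auto
    \<comment> \<open>The coordinate of the moved vector whose velocity is outside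
      \<open>P\<close>.\<close>
    let ?h = "if c \<notin> P then x ?u else y ?u"
    show "?h \<in> P" using zero by (simp add: vanishes_def)
    show "into_poly \<beta> ?h \<notin> coeffs_in P" using cd(5) by (auto simp: \<beta>_def coeffs_in_pCons[OF zP])
  qed
qed

text \<open>Between two zero vectors at positions \<open>0\<close> and \<open>d\<close>, a one-parameter family \<open>g\<close> of
  matrices may act at the positions of one parity and its adjoint at the others.\<close>

lemma arc_deformation:
  assumes p: "cycle_param p n C" and P: "prime_in S P" and IP: "I \<subseteq> P"
    and z0: "vanishes P (p 0)" and zd: "vanishes P (p d)" and d: "d \<le> n"
    and j: "0 < j" "j < d" "j < k" "k < n" "even (k - j)" and e: "edge (p j) (p k) \<in> P"
    and co: "if k < d then x (p j) * x (p k) \<notin> P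
      else Cst a * (x (p j) * x (p k)) + Cst b * (y (p j) * x (p k)) + Cst c * (Cst \<epsilon> * (x (p j) * y (p k))) \<notin> P"
    and abc: "k < d \<Longrightarrow> a = 1 \<and> b = 0 \<and> c = 0"
  shows "enat (Suc n) \<le> prime_height (ring_of S) P"
proof -
  note J = prime_inD(1)[OF P]
  have v: "p i \<in> {1..n}" for i by (rule param_range[OF p])
  have inj: "inj_on p {..<n}" by (rule cycle_param_basic(2)[OF p])
  have n0: "0 < n" using cycle_param_basic(1)[OF p] by linarith
  define idx where "idx = inv_into {..<n} p"
  have idx: "idx (p i) = i mod n" for i
    using inv_into_f_f[OF inj, of "i mod n"] n0 by (simp add: idx_def cycle_param_mod[OF p])
  have zP: "0 \<in> P" by (rule ideal_inD(2)[OF J])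
  \<comment> \<open>The matrix \<open>((1 + a t, b t), (c t, 1))\<close>, the identity at
    \<open>t = 0\<close>.\<close>
  define g11 g12 g21 :: "'k xy_poly poly"
    where "g11 = [:1, Cst a:]" and "g12 = [:0, Cst b:]" and "g21 = [:0, Cst c:]"
  define ec :: "'k xy_poly poly" where "ec = [:Cst \<epsilon>:]"
  have ecE: "ec * (ec * f) = f" for f
    unfolding ec_def by (simp add: CstE[of 1, simplified])
  define \<beta>x where "\<beta>x i = (if 0 < idx i \<and> idx i < d
      then if even (idx i) = even j then g11 * [:x i:] + g12 * [:y i:] else [:x i:] - ec * (g21 * [:y i:])
      else [:x i:])" for i
  define \<beta>y where "\<beta>y i = (if 0 < idx i \<and> idx i < d
      then if even (idx i) = even j then g21 * [:x i:] + [:y i:] else g11 * [:y i:] - ec * (g12 * [:x i:])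
      else [:y i:])" for i
  define \<beta> where "\<beta> w = (case w of X i \<Rightarrow> \<beta>x i | Y i \<Rightarrow> \<beta>y i)" for w
  have gS: "g11 \<in> coeffs_in S" "g12 \<in> coeffs_in S" "g21 \<in> coeffs_in S" "ec \<in> coeffs_in S"
    by (simp_all add: g11_def g12_def g21_def ec_def coeffs_in_pCons const_in_coeffs_in)
  note T = subdom_coeffs_in[OF S] and TI = ideal_coeffs_in[OF S J]
  have \<beta>S: "\<beta>x i \<in> coeffs_in S" "\<beta>y i \<in> coeffs_in S" if "i \<in> {1..n}" for i
  proof -
    have "[:x i:] \<in> coeffs_in S" "[:y i:] \<in> coeffs_in S" using that by (simp_all add: const_in_coeffs_in)
    then show "\<beta>x i \<in> coeffs_in S" "\<beta>y i \<in> coeffs_in S"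
      using gS by (auto simp: \<beta>x_def \<beta>y_def simp del: mult_pCons_left mult_pCons_right
          intro!: subdomD(3,4,6)[OF T])
  qed
  have in_edge: "into_poly \<beta> (edge i i') = \<beta>x i * \<beta>x i' + ec * (\<beta>y i * \<beta>y i')" for i i'
    by (simp add: edge_poly_def into_poly_hom \<beta>_def ec_def)
  have const_edge: "[:edge i i':] = [:x i:] * [:x i':] + ec * ([:y i:] * [:y i':])" for i i'
    by (simp add: edge_poly_def ec_def)
  have key: "into_poly \<beta> (edge (p i) (p (Suc i))) \<in> coeffs_in P" if i: "i < n" for i
  proof -
    have eP: "[:edge (p i) (p (Suc i)):] \<in> coeffs_in P"
      using edge_in_I[OF p, of i] IP zP by (intro const_in_coeffs_in) auto
    have idx1: "idx (p i) = i" using idx i by simp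
    have idx2: "idx (p (Suc i)) = (if Suc i = n then 0 else Suc i)" using idx[of "Suc i"] i by auto
    let ?D = "\<lambda>i. 0 < idx (p i) \<and> idx (p i) < d"
    \<comment> \<open>At an end of the arc only one of two neighbours moves, but the other is zero
      modulo \<open>P\<close>, so the edge still vanishes.\<close>
    have zero_or: "vanishes P (p i)" if "\<not> ?D i" "?D (Suc i)"
    proof -
      have "i = 0" using that idx1 idx2 by (auto split: if_splits)
      then show ?thesis using z0 by simp
    qed
    have zero_or2: "vanishes P (p (Suc i))" if "?D i" "\<not> ?D (Suc i)"
    proof -
      have "Suc i = d" using that idx1 idx2 d by (auto split: if_splits)
      then show ?thesis using zd by simp
    qed
    have cP: "[:x l:] \<in> coeffs_in P" "[:y l:] \<in> coeffs_in P" if "vanishes P l" for l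
      using that zP by (simp_all add: vanishes_def const_in_coeffs_in)
    consider "?D i" "?D (Suc i)" | "\<not> ?D i" "\<not> ?D (Suc i)" | "\<not> ?D i" "?D (Suc i)" | "?D i" "\<not> ?D (Suc i)" by blast
    then show ?thesis
    proof cases
      case 1
      have "idx (p (Suc i)) = Suc (idx (p i))" using 1 idx1 idx2 by (auto split: if_splits)
      then have parity: "even (idx (p (Suc i))) \<noteq> even (idx (p i))" by simp
      \<comment> \<open>Inside the arc the pairing of neighbours is multiplied by the
        determinant.\<close>
      have "into_poly \<beta> (edge (p i) (p (Suc i))) = (g11 - g12 * g21) * [:edge (p i) (p (Suc i)):]"
      proof (cases "even (idx (p i)) = even j")
        case True
        then have B: "\<beta>x (p i) = g11 * [:x (p i):] + g12 * [:y (p i):]" "\<beta>y (p i) = g21 * [:x (p i):] + [:y (p i):]"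
          "\<beta>x (p (Suc i)) = [:x (p (Suc i)):] - ec * (g21 * [:y (p (Suc i)):])"
          "\<beta>y (p (Suc i)) = g11 * [:y (p (Suc i)):] - ec * (g12 * [:x (p (Suc i)):])"
          using 1 parity by (auto simp: \<beta>x_def \<beta>y_def)
        show ?thesis unfolding in_edge const_edge B
          using ecE[of "g12 * (g21 * ([:x (p i):] * [:x (p (Suc i)):]))"]
            ecE[of "g12 * ([:y (p i):] * [:x (p (Suc i)):])"] by (simp only: algebra_simps)
      next
        case False
        then have B: "\<beta>x (p (Suc i)) = g11 * [:x (p (Suc i)):] + g12 * [:y (p (Suc i)):]"
          "\<beta>y (p (Suc i)) = g21 * [:x (p (Suc i)):] + [:y (p (Suc i)):]"
          "\<beta>x (p i) = [:x (p i):] - ec * (g21 * [:y (p i):])"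
          "\<beta>y (p i) = g11 * [:y (p i):] - ec * (g12 * [:x (p i):])"
          using 1 parity by (auto simp: \<beta>x_def \<beta>y_def)
        show ?thesis unfolding in_edge const_edge B
          using ecE[of "g12 * (g21 * ([:x (p i):] * [:x (p (Suc i)):]))"]
            ecE[of "g12 * ([:x (p i):] * [:y (p (Suc i)):])"] by (simp only: algebra_simps)
      qed
      also have "\<dots> \<in> coeffs_in P"
        using gS by (intro ideal_inD(4)[OF TI _ eP] subdomD(4,6)[OF T])
      finally show ?thesis .
    next
      case 2
      then have "into_poly \<beta> (edge (p i) (p (Suc i))) = [:edge (p i) (p (Suc i)):]"
        unfolding in_edge const_edge by (auto simp: \<beta>x_def \<beta>y_def)
      then show ?thesis using eP by simp
    next
      case 3
      then have "\<beta>x (p i) \<in> coeffs_in P" "\<beta>y (p i) \<in> coeffs_in P"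
        using cP[OF zero_or] by (auto simp: \<beta>x_def \<beta>y_def)
      then show ?thesis unfolding in_edge using \<beta>S[OF v[of "Suc i"]] gS
        by (intro ideal_inD(3)[OF TI] ideal_inD(4)[OF TI gS(4)] ideal_inD(5)[OF TI])
    next
      case 4
      then have "\<beta>x (p (Suc i)) \<in> coeffs_in P" "\<beta>y (p (Suc i)) \<in> coeffs_in P"
        using cP[OF zero_or2] by (auto simp: \<beta>x_def \<beta>y_def)
      then show ?thesis unfolding in_edge using \<beta>S[OF v[of i]] gS
        by (intro ideal_inD(3)[OF TI] ideal_inD(4)[OF TI])
    qed
  qed
  show ?thesis
  proof (rule deformation[OF p P IP, of \<beta> "edge (p j) (p k)"])
    fix w assume w: "w \<in> xy_vars n"
    show "\<beta> w \<in> coeffs_in S" using w \<beta>S by (cases w) (auto simp: \<beta>_def)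
    show "coeff (\<beta> w) 0 = Var w"
      by (cases w) (auto simp: \<beta>_def \<beta>x_def \<beta>y_def g11_def g12_def g21_def ec_def)
  next
    fix i
    have "p (Suc i) = p (Suc (i mod n))" by (metis cycle_param_eq_iff[OF p] mod_Suc_eq)
    moreover have "p i = p (i mod n)" by (simp add: cycle_param_mod[OF p])
    ultimately show "into_poly \<beta> (edge (p i) (p (Suc i))) \<in> coeffs_in P"
      using key[of "i mod n"] n0 by simp
  next
    have idxj: "idx (p j) = j" "idx (p k) = k" using idx j by auto
    have par: "even k = even j" using j by auto
    have Bj: "\<beta>x (p j) = g11 * [:x (p j):] + g12 * [:y (p j):]" "\<beta>y (p j) = g21 * [:x (p j):] + [:y (p j):]"
      using j idxj by (auto simp: \<beta>x_def \<beta>y_def)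
    show "into_poly \<beta> (edge (p j) (p k)) \<notin> coeffs_in P"
    proof (cases "k < d")
      case True
      then have Bk: "\<beta>x (p k) = g11 * [:x (p k):] + g12 * [:y (p k):]" "\<beta>y (p k) = g21 * [:x (p k):] + [:y (p k):]"
        using j idxj par by (auto simp: \<beta>x_def \<beta>y_def)
      \<comment> \<open>Both ends carry the factor \<open>1 + t\<close> on the first coordinate,
        whence the factor 2 in the derivative.\<close>
      have "coeff (into_poly \<beta> (edge (p j) (p k))) 1 = Cst 2 * (x (p j) * x (p k))"
        unfolding in_edge Bj Bk using abc[OF True]
        by (simp add: g11_def g12_def g21_def ec_def Cst_simps(3)[of 1 1, simplified] algebra_simps)
      moreover have "Cst 2 * (x (p j) * x (p k)) \<notin> P"
      proof
        assume "Cst 2 * (x (p j) * x (p k)) \<in> P"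
        then have "Cst (1 / 2) * (Cst 2 * (x (p j) * x (p k))) \<in> P" by (rule ideal_inD(4)[OF J polys_Cst])
        moreover have "Cst (1 / 2) * Cst 2 = (1 :: 'k xy_poly)"
          using two Cst_simps(4)[of "1 / 2 :: 'k" 2, symmetric] by simp
        ultimately show False using co True by (simp add: mult.assoc[symmetric])
      qed
      ultimately show ?thesis by (auto simp: coeffs_in_def intro!: exI[of _ 1])
    next
      case False
      then have Bk: "\<beta>x (p k) = [:x (p k):]" "\<beta>y (p k) = [:y (p k):]"
        using idxj by (auto simp: \<beta>x_def \<beta>y_def)
      have "coeff (into_poly \<beta> (edge (p j) (p k))) 1 =
          Cst a * (x (p j) * x (p k)) + Cst b * (y (p j) * x (p k)) + Cst c * (Cst \<epsilon> * (x (p j) * y (p k)))"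
        unfolding in_edge Bj Bk by (simp add: g11_def g12_def g21_def ec_def algebra_simps)
      then show ?thesis using co False by (auto simp: coeffs_in_def intro!: exI[of _ 1])
    qed
  qed (rule e)
qed

text \<open>If the neighbours of the zero vector at \<open>u\<close> are parallel modulo
  \<open>P\<close>, it can be moved. Otherwise their determinant is a unit locally, and its products
  with both coordinates of \<open>u\<close> lie in the cycle ideal, which brings
  \<open>edge u v\<close> into it.\<close>

lemma dichotomy_zero:
  assumes p: "cycle_param p n C" and P: "prime_in S P" and IP: "I \<subseteq> P"
    and u: "u \<in> {1..n}" "vanishes P u" and v: "v \<in> {1..n}"
  shows "(\<exists>s\<in>S - P. s * edge u v \<in> I) \<or> enat (Suc n) \<le> prime_height (ring_of S) P"
proof -
  have "u \<in> \<Union>C" using u(1) verts by simp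
  then obtain a where a: "p (Suc a) = u" using cycle_param_at[OF p] by blast
  define q where "q i = p (i + a)" for i
  have q: "cycle_param q n C" unfolding q_def by (rule cycle_param_shift[OF p])
  have qu: "q (Suc 0) = u" using a by (simp add: q_def)
  show ?thesis
  proof (cases "par (q 0) (q 2) \<in> P")
    case True
    then show ?thesis using vertex_deformation[OF q P IP] u(2) qu by simp
  next
    case False
    have e: "edge (q 0) u \<in> I" "edge u (q 2) \<in> I"
      using edge_in_I[OF q, of 0] edge_in_I[OF q, of 1] qu by (simp_all add: numeral_2_eq_2)
    have m: "x u * par (q 0) (q 2) \<in> I" "y u * par (q 0) (q 2) \<in> I"
      using par_multiples[OF I e] param_range[OF q] u(1) by blast+
    have "par (q 0) (q 2) * edge u v = x v * (x u * par (q 0) (q 2)) + Cst \<epsilon> * y v * (y u * par (q 0) (q 2))"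
      by (simp add: edge_poly_def algebra_simps)
    also have "\<dots> \<in> I"
      using xS[OF v]
      by (intro ideal_inD(3)[OF I] ideal_inD(4)[OF I _ m(1)] ideal_inD(4)[OF I _ m(2)]) auto
    finally show ?thesis using False edgeS(2)[of "q 0" "q 2"] param_range[OF q] by blast
  qed
qed

text \<open>Without zero vectors on the odd walk, the walk relation makes the chord redundant.
  Otherwise positions are counted from a zero vertex on it, and the moved arc depends on the other
  walk: a zero vertex there leaves just one chord end on the arc; if there is none, the arc is the
  whole cycle cut open and both ends move.\<close>

lemma dichotomy_nonzero:
  assumes p: "cycle_param p n C" and P: "prime_in S P" and IP: "I \<subseteq> P"
    and k: "0 < k" "k < n" "odd k" and nz: "\<not> vanishes P (p 0)" "\<not> vanishes P (p k)"
    and e: "edge (p 0) (p k) \<in> P"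
  shows "(\<exists>s\<in>S - P. s * edge (p 0) (p k) \<in> I) \<or> enat (Suc n) \<le> prime_height (ring_of S) P"
proof (cases "\<exists>c. 0 < c \<and> c < k \<and> vanishes P (p c)")
  case False
  note lc = loc_closure[OF S P I]
  have "if odd k then edge (p 0) (p (0 + k)) \<in> loc_closure S P I else par (p 0) (p (0 + k)) \<in> loc_closure S P I"
    using False k(1) edge_in_I[OF p] lc(2) by (intro walk_relation[OF p lc(1)]) auto
  then show ?thesis using k(3) by (auto simp: loc_closure_def)
next
  case True
  then obtain c where c: "0 < c" "c < k" "vanishes P (p c)" by blast
  define q where "q i = p (i + c)" for i
  have q: "cycle_param q n C" unfolding q_def by (rule cycle_param_shift[OF p])
  let ?j = "k - c" and ?m = "n - c"
  have qj: "q ?j = p k" using c by (simp add: q_def)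
  have qm: "q ?m = p 0" using c k cycle_param_basic(3)[OF p, of 0] by (simp add: q_def)
  \<comment> \<open>The complementary walk has even length \<open>n - k\<close>, since
    \<open>n\<close> and \<open>k\<close> are odd.\<close>
  have jm: "0 < ?j" "?j < ?m" "?m < n" "even (?m - ?j)"
    using c k odd_n by auto
  have z0: "vanishes P (q 0)" using c(3) by (simp add: q_def)
  then have zn: "vanishes P (q n)" using cycle_param_basic(3)[OF q, of 0] by simp
  have ePq: "edge (q ?j) (q ?m) \<in> P" using e unfolding qj qm by (simp add: edge_poly_commute)
  have J: "ideal_in S P" by (rule prime_inD(1)[OF P])
  have pr: "f \<in> P \<or> g \<in> P" if "f * g \<in> P" "f \<in> S" "g \<in> S" for f g
    using prime_inD(3)[OF P that(2,3,1)] .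
  have v: "q i \<in> {1..n}" for i by (rule param_range[OF q])
  have xyS: "x (q i) \<in> S" "y (q i) \<in> S" for i using v[of i] by auto
  have nzj: "x (q ?j) \<notin> P \<or> y (q ?j) \<notin> P" and nzm: "x (q ?m) \<notin> P \<or> y (q ?m) \<notin> P"
    using nz unfolding qj qm by (auto simp: vanishes_def)
  have yy: "y (q ?j) \<in> P \<or> y (q ?m) \<in> P" if "x (q ?j) * x (q ?m) \<in> P"
  proof -
    have "edge (q ?j) (q ?m) - x (q ?j) * x (q ?m) \<in> P" by (rule ideal_in_diff[OF S J ePq that])
    then have "Cst \<epsilon> * (y (q ?j) * y (q ?m)) \<in> P" by (simp add: edge_poly_def)
    then have "y (q ?j) * y (q ?m) \<in> P" using ideal_inD(4)[OF J polys_Cst, of _ \<epsilon>] CstE by metis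
    then show ?thesis using pr xyS by blast
  qed
  show ?thesis
  proof (cases "\<exists>d. ?j < d \<and> d < ?m \<and> vanishes P (q d)")
    case True
    then obtain d where d: "?j < d" "d < ?m" "vanishes P (q d)" by blast
    \<comment> \<open>If the derivative vanished for every matrix, three of the four products of
      coordinates would lie in \<open>P\<close>; together with the chord this makes one of the two
      vectors zero.\<close>
    have "\<exists>a b c. Cst a * (x (q ?j) * x (q ?m)) + Cst b * (y (q ?j) * x (q ?m)) + Cst c * (Cst \<epsilon> * (x (q ?j) * y (q ?m))) \<notin> P"
    proof (rule ccontr)
      assume "\<not> ?thesis"
      then have all: "Cst a * (x (q ?j) * x (q ?m)) + Cst b * (y (q ?j) * x (q ?m)) + Cst c * (Cst \<epsilon> * (x (q ?j) * y (q ?m))) \<in> P"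
        for a b c by blast
      have 1: "x (q ?j) * x (q ?m) \<in> P" "y (q ?j) * x (q ?m) \<in> P"
        using all[of 1 0 0] all[of 0 1 0] by simp_all
      have "Cst \<epsilon> * (x (q ?j) * y (q ?m)) \<in> P" using all[of 0 0 1] by simp
      then have 2: "x (q ?j) * y (q ?m) \<in> P" using ideal_inD(4)[OF J polys_Cst, of _ \<epsilon>] CstE by metis
      show False using pr[OF 1(1)] pr[OF 1(2)] pr[OF 2] yy[OF 1(1)] xyS nzj nzm by blast
    qed
    then obtain a b c where abc: "Cst a * (x (q ?j) * x (q ?m)) + Cst b * (y (q ?j) * x (q ?m)) +
      Cst c * (Cst \<epsilon> * (x (q ?j) * y (q ?m))) \<notin> P" by blast
    have "enat (Suc n) \<le> prime_height (ring_of S) P"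
      using d jm abc ePq by (intro arc_deformation[OF q P IP z0 d(3), where a = a and b = b and c = c]) auto
    then show ?thesis ..
  next
    case False
    have "if odd (?m - ?j) then edge (q ?j) (q (?j + (?m - ?j))) \<in> P else par (q ?j) (q (?j + (?m - ?j))) \<in> P"
      using False jm edge_in_I[OF q] IP by (intro walk_relation[OF q cancels_prime[OF P]]) auto
    moreover have "?j + (?m - ?j) = ?m" using jm(2) by simp
    ultimately have par: "par (q ?j) (q ?m) \<in> P" by (simp only: jm(4) not_True_eq_False if_False)
    \<comment> \<open>The two vectors are orthogonal and parallel modulo \<open>P\<close>; a zero
      first coordinate would then force one of them to vanish.\<close>
    have "x (q ?j) * x (q ?m) \<notin> P"
    proof
      assume xx: "x (q ?j) * x (q ?m) \<in> P"
      have "x (q ?j) \<in> P \<and> y (q ?m) \<in> P \<or> x (q ?m) \<in> P \<and> y (q ?j) \<in> P"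
        using pr[OF xx] yy[OF xx] xyS nzj nzm by blast
      then show False
      proof
        assume a: "x (q ?j) \<in> P \<and> y (q ?m) \<in> P"
        have "x (q ?j) * y (q ?m) - par (q ?j) (q ?m) \<in> P"
          using a xyS by (intro ideal_in_diff[OF S J _ par] ideal_inD(5)[OF J]) auto
        then have "x (q ?m) * y (q ?j) \<in> P" by (simp add: par_poly_def)
        then show False using pr xyS a nzj nzm by blast
      next
        assume a: "x (q ?m) \<in> P \<and> y (q ?j) \<in> P"
        have "par (q ?j) (q ?m) + x (q ?m) * y (q ?j) \<in> P"
          using a xyS by (intro ideal_inD(3)[OF J par] ideal_inD(5)[OF J]) auto
        then have "x (q ?j) * y (q ?m) \<in> P" by (simp add: par_poly_def)
        then show False using pr xyS a nzj nzm by blast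
      qed
    qed
    then have "enat (Suc n) \<le> prime_height (ring_of S) P"
      using jm ePq by (intro arc_deformation[OF q P IP z0 zn, where j = ?j and k = ?m and a = 1 and b = 0 and c = 0]) auto
    then show ?thesis ..
  qed
qed

text \<open>As the cycle is odd, one of the two ways round between \<open>u\<close> and
  \<open>v\<close> has odd length.\<close>

lemma dichotomy:
  assumes p: "cycle_param p n C" and P: "prime_in S P" and IP: "I \<subseteq> P"
    and u: "u \<in> {1..n}" and v: "v \<in> {1..n}" and uv: "u \<noteq> v" and e: "edge u v \<in> P"
  shows "(\<exists>s\<in>S - P. s * edge u v \<in> I) \<or> enat (Suc n) \<le> prime_height (ring_of S) P"
proof (cases "vanishes P u \<or> vanishes P v")
  case True
  then show ?thesis
    using dichotomy_zero[OF p P IP u _ v] dichotomy_zero[OF p P IP v _ u] edge_poly_commute[of \<epsilon> u v] by auto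
next
  case False
  have "u \<in> \<Union>C" using u verts by simp
  then obtain a where a: "p (Suc a) = u" using cycle_param_at[OF p] by blast
  define q where "q i = p (i + Suc a)" for i
  have q: "cycle_param q n C" unfolding q_def by (rule cycle_param_shift[OF p])
  have q0: "q 0 = u" using a by (simp add: q_def)
  have "v \<in> q ` {..<n}" using v verts cycle_param_Union[OF q] by simp
  then obtain k where k: "k < n" "q k = v" by blast
  have k0: "0 < k" using k q0 uv by (cases k) auto
  show ?thesis
  proof (cases "odd k")
    case True
    then show ?thesis using dichotomy_nonzero[OF q P IP k0 k(1)] False e q0 k(2) by simp
  next
    case even: False
    define r where "r i = q (i + k)" for i
    have r: "cycle_param r n C" unfolding r_def by (rule cycle_param_shift[OF q])
    have r0: "r 0 = v" using k by (simp add: r_def)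
    have rk: "r (n - k) = u" using k q0 cycle_param_basic(3)[OF q, of 0] by (simp add: r_def)
    have "odd (n - k)" using even odd_n k(1) by simp
    then show ?thesis
      using dichotomy_nonzero[OF r P IP, of "n - k"] k0 k(1) False e r0 rk edge_poly_commute[of \<epsilon> u v] by simp
  qed
qed

end

section \<open>Almost complete intersections\<close>

context chord_graph
begin

lemma odd_cycle_eq:
  assumes "odd_cycle_graph {1..n} H"
  shows "H = C" "\<Union>C = {1..n}" "odd n" "card H = n" "\<exists>p. cycle_param p n C"
proof -
  show HC: "H = C" using assms cycle_unique[of H] by (simp add: odd_cycle_graph_def)
  then show U: "\<Union>C = {1..n}" "odd n" using assms by (auto simp: odd_cycle_graph_def)
  obtain p l where p: "cycle_param p l C" using cycle_edges_param[OF C(1)] by blast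
  then have "l = n" using cycle_param_card(2)[OF p] U by simp
  then show "card H = n" "\<exists>p. cycle_param p n C" using HC cycle_param_card[OF p] p by auto
qed

text \<open>Deleting \<open>u\<close> removes the chord and leaves a path on \<open>n - 1\<close>
  vertices with one component, so the bound is \<open>2 * n - ((n - 1) + 1)\<close>.\<close>

lemma height_le_odd_cycle:
  fixes \<epsilon> :: "'k::field"
  assumes H_cycle: "odd_cycle_graph {1..n} H"
  shows "ideal_height (ring_of (xy_polys n)) (edge_ideal n \<epsilon> G) \<le> enat n"
proof -
  note hc = odd_cycle_eq[OF H_cycle]
  obtain p0 where p0: "cycle_param p0 n C" using hc(5) by blast
  obtain a where a: "p0 (Suc a) = u" using cycle_param_at[OF p0 uC] by blast
  define p where "p i = p0 (i + Suc a)" for i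
  have p: "cycle_param p n C" unfolding p_def by (rule cycle_param_shift[OF p0])
  have pu: "p 0 = u" using a by (simp add: p_def)
  have n3: "3 \<le> n" by (rule cycle_param_basic(1)[OF p])
  define idx where "idx = inv_into {..<n} p"
  have idx: "idx (p i) = i mod n" for i
    using inv_into_f_f[OF cycle_param_basic(2)[OF p], of "i mod n"] n3
    by (simp add: idx_def cycle_param_mod[OF p])
  have p1: "p 1 \<in> {1..n} - {u}"
    using cycle_param_neq[OF p, of 0 1] n3 pu cycle_param_basic(4)[OF p, of 1] hc(2) by auto
  have "ideal_height (ring_of (xy_polys n)) (edge_ideal n \<epsilon> G) \<le>
    enat (2 * n - (card ({1..n} - {u}) + card ((\<lambda>i. p 1) ` ({1..n} - {u}))))"
  proof (rule edge_ideal_height_le[OF G_simple, of "{u}" _ "\<lambda>i. odd (idx i)"])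
    show "{u} \<subseteq> {1..n}" using uC hc(2) by auto
    show "p 1 \<in> {1..n} - {u} \<and> odd (idx (p 1)) \<and> p 1 = p 1" using p1 idx[of 1] n3 by simp
    fix i j assume ij: "{i, j} \<in> G" "i \<notin> {u}" "j \<notin> {u}"
    then have "{i, j} \<in> C" by (auto simp: G_def hc(1) doubleton_eq_iff)
    then obtain k where k: "{i, j} = {p k, p (Suc k)}" using p by (auto simp: cycle_param_def)
    have ne: "p k \<noteq> p 0" "p (Suc k) \<noteq> p 0" using k ij pu by (auto simp: doubleton_eq_iff)
    \<comment> \<open>An edge avoiding position 0 does not wrap around, so its positions are
      consecutive and of opposite parity.\<close>
    then have "Suc k mod n \<noteq> 0" by (auto simp: cycle_param_eq_iff[OF p])
    then have "Suc k mod n = Suc (k mod n)" by (simp add: mod_Suc split: if_splits)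
    then have "odd (idx (p k)) \<noteq> odd (idx (p (Suc k)))" by (simp add: idx)
    then show "p 1 = p 1 \<and> odd (idx i) \<noteq> odd (idx j)" using k by (auto simp: doubleton_eq_iff)
  qed
  moreover have "(\<lambda>i. p 1) ` ({1..n} - {u}) = {p 1}" using p1 by auto
  moreover have "card ({1..n} - {u}) = n - 1" using uC hc(2) by simp
  ultimately show ?thesis using n3 by simp
qed

lemma aci_odd_cycle:
  fixes \<epsilon> :: "'k::field"
  assumes H_cycle: "odd_cycle_graph {1..n} H" and eps: "\<epsilon> * \<epsilon> = 1" and two: "(2 :: 'k) \<noteq> 0"
  shows "almost_complete_intersection n (edge_ideal n \<epsilon> G)"
proof -
  note hc = odd_cycle_eq[OF H_cycle]
  obtain p where p: "cycle_param p n C" using hc(5) by blast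
  have Cs: "simple_graph {1..n} C" using H hc(1) by simp
  interpret oc: odd_cycle n C \<epsilon>
    by unfold_locales (fact Cs hc eps two)+
  let ?S = "xy_polys n :: 'k xy_poly set" and ?I = "edge_ideal n \<epsilon> G" and ?J = "edge_ideal n \<epsilon> C"
  note S = subdom_polys[of "xy_vars n"] and I = edge_ideal_ideal[OF G_simple, of \<epsilon>]
  have JI: "?J \<subseteq> ?I"
    by (rule edge_ideal_least[OF Cs I]) (use edge_ideal_gen[OF G_simple] hc(1) HG in blast)
  have uvn: "u \<in> {1..n}" "v \<in> {1..n}" using uC vC hc(2) by auto
  have euv: "edge_poly \<epsilon> u v \<in> ?I" by (rule edge_ideal_gen[OF G_simple]) (simp add: G_def)
  have card: "card G = Suc n" using card_G hc(4) by simp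
  have "enat n \<le> ideal_height (ring_of ?S) ?I"
    unfolding ideal_height_def primeideal_ring_of[OF S]
    by (rule INF_greatest) (use oc.height_ge[OF p] JI in auto)
  then have ht: "ideal_height (ring_of ?S) ?I = enat n"
    using height_le_odd_cycle[OF H_cycle, of \<epsilon>] by (rule antisym[rotated])
  have "enat (min_gens (local_ring_at (ring_of ?S) P) (local_ideal_at (ring_of ?S) P ?I)) =
      ideal_height (local_ring_at (ring_of ?S) P) (local_ideal_at (ring_of ?S) P ?I)"
    if mp: "minimal_prime_over (ring_of ?S) ?I P" for P
  proof -
    have P: "prime_in ?S P" and IP: "?I \<subseteq> P"
      and min: "\<And>Q. prime_in ?S Q \<Longrightarrow> ?I \<subseteq> Q \<Longrightarrow> Q \<subseteq> P \<Longrightarrow> Q = P"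
      using mp unfolding minimal_prime_over_def primeideal_ring_of[OF S] by blast+
    interpret pl: prime_localization ?S P by unfold_locales (fact S P)+
    have lh: "ideal_height (local_ring_at (ring_of ?S) P) (local_ideal_at (ring_of ?S) P ?I) =
        prime_height (ring_of ?S) P"
      by (rule pl.ideal_height_ext[OF I IP min])
    \<comment> \<open>The least number of local generators is at most \<open>card F\<close>, hence
      at most the height; Krull's theorem for lifted minimal generators gives the converse.\<close>
    have squeeze: ?thesis
      if F: "finite F" "F \<subseteq> ?I" "\<And>g. g \<in> ?I \<Longrightarrow> \<exists>s\<in>?S - P. s * g \<in> gen_in ?S F"
        and le: "enat (card F) \<le> prime_height (ring_of ?S) P" for F
    proof -
      let ?m = "min_gens (local_ring_at (ring_of ?S) P) (local_ideal_at (ring_of ?S) P ?I)"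
      have m: "?m \<le> card F" by (rule pl.min_gens_le(1)[OF I F])
      obtain F' where F': "finite F'" "F' \<subseteq> ?I" "card F' \<le> ?m" "\<forall>g\<in>?I. \<exists>s\<in>?S - P. s * g \<in> gen_in ?S F'"
        using pl.min_gens_le(2)[OF I F] by blast
      have "prime_height (ring_of ?S) P \<le> enat (card F')"
        using F'(4) by (intro krull_height[OF finite_xy_vars P I IP min F'(1,2)]) auto
      also have "\<dots> \<le> enat ?m" using F'(3) by simp
      finally have "prime_height (ring_of ?S) P \<le> enat ?m" .
      moreover have "enat ?m \<le> prime_height (ring_of ?S) P" using m le by (meson enat_ord_simps(1) order_trans)
      ultimately show ?thesis unfolding lh by (rule antisym[rotated])
    qed
    have JP: "?J \<subseteq> P" using JI IP by blast
    have "(\<exists>s\<in>?S - P. s * edge_poly \<epsilon> u v \<in> ?J) \<or> enat (Suc n) \<le> prime_height (ring_of ?S) P"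
      using euv IP by (intro oc.dichotomy[OF p P JP uvn uv(1)]) auto
    then show ?thesis
    proof
      \<comment> \<open>The chord is redundant locally: the \<open>n\<close> cycle generators
        suffice, and every prime over the cycle ideal has height at least \<open>n\<close>.\<close>
      assume red: "\<exists>s\<in>?S - P. s * edge_poly \<epsilon> u v \<in> ?J"
      note lc = loc_closure[OF S P oc.I]
      have "edge_poly \<epsilon> u v \<in> loc_closure ?S P ?J"
        using red ideal_inD(1)[OF I euv] by (auto simp: loc_closure_def)
      then have "edge_poly \<epsilon> i j \<in> loc_closure ?S P ?J" if "{i, j} \<in> G" for i j
        using that lc(2) edge_ideal_gen[OF Cs, of i j \<epsilon>] edge_poly_commute[of \<epsilon> u v]
        by (auto simp: G_def hc(1) doubleton_eq_iff)
      then have "?I \<subseteq> loc_closure ?S P ?J"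
        using lc(1) by (intro edge_ideal_least[OF G_simple]) (auto simp: cancels_def)
      then have gens: "\<exists>s\<in>?S - P. s * g \<in> gen_in ?S (edge_polys \<epsilon> C)" if "g \<in> ?I" for g
        using that by (auto simp: loc_closure_def edge_ideal_def)
      have fin: "finite (edge_polys \<epsilon> C)" "card (edge_polys \<epsilon> C) \<le> n"
        using edge_polys_finite_card[OF Cs, of \<epsilon>] hc(1,4) by auto
      have sub: "edge_polys \<epsilon> C \<subseteq> ?I"
        using gen_in_incl[OF S edge_polys_sub[OF Cs, of \<epsilon>]] JI by (simp add: edge_ideal_def)
      show ?thesis
      proof (rule squeeze[OF fin(1) sub gens])
        have "enat (card (edge_polys \<epsilon> C)) \<le> enat n" using fin(2) by simp
        then show "enat (card (edge_polys \<epsilon> C)) \<le> prime_height (ring_of ?S) P"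
          using oc.height_ge[OF p P JP] by (rule order_trans)
      qed
    next
      assume big: "enat (Suc n) \<le> prime_height (ring_of ?S) P"
      have fin: "finite (edge_polys \<epsilon> G)" "card (edge_polys \<epsilon> G) \<le> Suc n"
        using edge_polys_finite_card[OF G_simple, of \<epsilon>] card by auto
      have sub: "edge_polys \<epsilon> G \<subseteq> ?I"
        using gen_in_incl[OF S edge_polys_sub[OF G_simple, of \<epsilon>]] by (simp add: edge_ideal_def)
      show ?thesis
      proof (rule squeeze[OF fin(1) sub])
        show "\<exists>s\<in>?S - P. s * g \<in> gen_in ?S (edge_polys \<epsilon> G)" if "g \<in> ?I" for g
          using that prime_inD(2)[OF P] by (intro bexI[of _ 1]) (simp_all add: edge_ideal_def)
        have "enat (card (edge_polys \<epsilon> G)) \<le> enat (Suc n)" using fin(2) by simp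
        then show "enat (card (edge_polys \<epsilon> G)) \<le> prime_height (ring_of ?S) P"
          using big by (rule order_trans)
      qed
    qed
  qed
  then show ?thesis
    unfolding almost_complete_intersection_def xy_ring_eq
    by (simp add: homogeneous_edge_ideal[OF G_simple] mu_edge_ideal[OF G_simple] card ht one_enat_def)
qed

lemma aci_iff:
  fixes \<epsilon> :: "'k::field"
  assumes "\<epsilon> * \<epsilon> = 1" "CHAR('k) \<noteq> 2"
  shows "almost_complete_intersection n (edge_ideal n \<epsilon> G) \<longleftrightarrow> odd_cycle_graph {1..n} H"
proof -
  have "(2 :: 'k) \<noteq> 0"
  proof
    assume "(2 :: 'k) = 0"
    \<comment> \<open>If 2 vanished, the only characteristic left besides 2 would be 1, which a
      field does not have.\<close>
    then have dvd: "CHAR('k) dvd 2" using of_nat_eq_0_iff_char_dvd[of 2, where 'a = 'k] by simp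
    have "CHAR('k) \<le> 2" using dvd by (rule dvd_imp_le) simp
    moreover have "CHAR('k) \<noteq> 0" using dvd by (intro notI) simp
    ultimately have "CHAR('k) = 1" using assms(2) by linarith
    then have "of_nat 1 = (0 :: 'k)" using of_nat_CHAR[where 'a = 'k] by simp
    then show False by simp
  qed
  then show ?thesis using aci_odd_cycle[OF _ assms(1)] not_aci_not_cycle by blast
qed

end

theorem theorem3p10:
  fixes n u v :: nat and H G C :: "nat set set"
  assumes "simple_graph {1..n} H"
    and "odd_unicyclic H"
    and "cycle_edges C" and "C \<subseteq> H"
    and "u \<in> \<Union>C" and "v \<in> \<Union>C" and "u \<noteq> v" and "{u, v} \<notin> H"
    and "graph_degree H u = 2" and "graph_degree H v = 2"
    and "G = insert {u, v} H"
    and "graph_connected {1..n} G"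
    and "CHAR('k::field) \<noteq> 2"
  shows "(almost_complete_intersection n (lss_ideal n G :: 'k xy_poly set) \<longleftrightarrow>
          almost_complete_intersection n (parity_binomial_edge_ideal n G :: 'k xy_poly set)) \<and>
         (almost_complete_intersection n (parity_binomial_edge_ideal n G :: 'k xy_poly set) \<longleftrightarrow>
          odd_cycle_graph {1..n} H)"
proof -
  interpret chord_graph n u v H G C by unfold_locales (fact assms)+
  show ?thesis
    unfolding lss_ideal_eq parity_binomial_edge_ideal_eq
    using aci_iff[of "1 :: 'k"] aci_iff[of "- 1 :: 'k"] assms(13) by simp
qed

end
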